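(* Let $r\ge 1$ be a fixed integer and let $\mathcal N_r$ be the family of all finite-dimensional nest algebras with $r$ non-zero nest projections. Then $\mathcal N_r$ is a stable family. That is: for every $\epsilon>0$ and every $\mathcal A_1\in\mathcal N_r$ there exists $\delta>0$ such that whenever $\mathcal A_2\in\mathcal N_r$, $n\ge 1$, and $\phi_1:\mathcal A_1\to M_n$, $\phi_2:\mathcal A_2\to M_n$ are star extendible embeddings with $\phi_1(\mathcal A_1)\subseteq_\delta\phi_2(\mathcal A_2)$, there exists a star extendible algebra injection $\psi:\mathcal A_1\to M_n$ with $\|\phi_1-\psi\|<\epsilon$ and $\psi(\mathcal A_1)\subseteq\phi_2(\mathcal A_2)$.
   Context: $M_n$ is the algebra of $n\times n$ complex matrices with the operator norm. A member of $\mathcal N_r$ is determined by positive integers $n_1,\dots,n_r$: it is the algebra of all block upper triangular matrices in $M_{n_1+\cdots+n_r}$ with respect to the block decomposition of sizes $n_1,\dots,n_r$ (equivalently, the algebra of all matrices leaving invariant the ranges of a chain of projections $0<p_1<\dots<p_r=I$); its self-adjoint part is $M_{n_1}\oplus\cdots\oplus M_{n_r}$. For an operator algebra $\mathcal A$, $C^*(\mathcal A)$ denotes the $C^*$-algebra it generates. A star extendible embedding (or injection) of $\mathcal A$ into an operator algebra $\mathcal B$ is an algebra homomorphism $\mathcal A\to\mathcal B$ that is the restriction of an injective $*$-homomorphism $C^*(\mathcal A)\to C^*(\mathcal B)$; it is not required to be unital. For subalgebras $X,Y$ of a common $C^*$-algebra, $X\subseteq_\delta Y$ means that for every $x\in X$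 with $\|x\|\le 1$ there is $y\in Y$ with $\|y\|\le1$ and $\|x-y\|\le\delta$. $\|\phi_1-\psi\|$ is the norm of $\phi_1-\psi$ as a linear map. *)

theory Defs
  imports "Jordan_Normal_Form.Schur_Decomposition" "HOL-Analysis.L2_Norm"
begin

text \<open>
  The matrix size \<open>n\<close> is quantified inside the definition of stability, so \<open>M\<^sub>n\<close> is the carrier
  set \<open>carrier_mat n n\<close>.  An operator algebra inside \<open>M\<^sub>n\<close> is a set of matrices, accompanied
  by \<open>n\<close> where the surrounding matrix algebra matters.
\<close>

definition l2_norm :: "complex vec \<Rightarrow> real" where
  "l2_norm v = L2_set (\<lambda>i. cmod (v $ i)) {..<dim_vec v}"

definition op_norm :: "complex mat \<Rightarrow> real" where
  "op_norm A = Sup {l2_norm (A *\<^sub>v v) | v. v \<in> carrier_vec (dim_col A) \<and> l2_norm v \<le> 1}"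

definition map_norm :: "complex mat set \<Rightarrow> (complex mat \<Rightarrow> complex mat) \<Rightarrow> real" where
  "map_norm \<A> f = Sup {op_norm (f x) | x. x \<in> \<A> \<and> op_norm x \<le> 1}"

text \<open>C*-subalgebras of \<open>M\<^sub>n\<close>; they need not contain the identity matrix.\<close>

definition cstar_subalgebra :: "nat \<Rightarrow> complex mat set \<Rightarrow> bool" where
  "cstar_subalgebra n \<C> \<longleftrightarrow>
     \<C> \<subseteq> carrier_mat n n \<and>
     0\<^sub>m n n \<in> \<C> \<and>
     (\<forall>x\<in>\<C>. \<forall>y\<in>\<C>. x + y \<in> \<C>) \<and>
     (\<forall>c. \<forall>x\<in>\<C>. c \<cdot>\<^sub>m x \<in> \<C>) \<and>
     (\<forall>x\<in>\<C>. \<forall>y\<in>\<C>. x * y \<in> \<C>) \<and>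
     (\<forall>x\<in>\<C>. mat_adjoint x \<in> \<C>) \<and>
     (\<forall>X. \<forall>a\<in>carrier_mat n n.
        (\<forall>k::nat. X k \<in> \<C>) \<and> (\<lambda>k. op_norm (X k - a)) \<longlonglongrightarrow> 0 \<longrightarrow> a \<in> \<C>)"

definition cstar_generated :: "nat \<Rightarrow> complex mat set \<Rightarrow> complex mat set" where
  "cstar_generated n S = \<Inter>{\<C>. cstar_subalgebra n \<C> \<and> S \<subseteq> \<C>}"

definition algebra_hom ::
    "complex mat set \<Rightarrow> complex mat set \<Rightarrow> (complex mat \<Rightarrow> complex mat) \<Rightarrow> bool" where
  "algebra_hom \<A> \<B> f \<longleftrightarrow>
     f ` \<A> \<subseteq> \<B> \<and>
     (\<forall>x\<in>\<A>. \<forall>y\<in>\<A>. f (x + y) = f x + f y) \<and>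
     (\<forall>c. \<forall>x\<in>\<A>. f (c \<cdot>\<^sub>m x) = c \<cdot>\<^sub>m f x) \<and>
     (\<forall>x\<in>\<A>. \<forall>y\<in>\<A>. f (x * y) = f x * f y)"

definition star_hom ::
    "complex mat set \<Rightarrow> complex mat set \<Rightarrow> (complex mat \<Rightarrow> complex mat) \<Rightarrow> bool" where
  "star_hom \<A> \<B> f \<longleftrightarrow>
     algebra_hom \<A> \<B> f \<and> (\<forall>x\<in>\<A>. f (mat_adjoint x) = mat_adjoint (f x))"

text \<open>
  Star extendible embeddings of \<open>\<A> \<subseteq> M\<^sub>m\<close> into \<open>\<B> \<subseteq> M\<^sub>n\<close>.  Only the values of \<open>f\<close> on \<open>\<A>\<close> matter.
\<close>

definition star_extendible_embedding ::
    "nat \<Rightarrow> complex mat set \<Rightarrow> nat \<Rightarrow> complex mat set \<Rightarrow> (complex mat \<Rightarrow> complex mat) \<Rightarrow> bool" where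
  "star_extendible_embedding m \<A> n \<B> f \<longleftrightarrow>
     algebra_hom \<A> \<B> f \<and>
     (\<exists>g. star_hom (cstar_generated m \<A>) (cstar_generated n \<B>) g \<and>
          inj_on g (cstar_generated m \<A>) \<and>
          (\<forall>x\<in>\<A>. f x = g x))"

definition near_subset :: "real \<Rightarrow> complex mat set \<Rightarrow> complex mat set \<Rightarrow> bool" where
  "near_subset \<delta> \<X> \<Y> \<longleftrightarrow>
     (\<forall>x\<in>\<X>. op_norm x \<le> 1 \<longrightarrow> (\<exists>y\<in>\<Y>. op_norm y \<le> 1 \<and> op_norm (x - y) \<le> \<delta>))"

text \<open>Block sizes are given as a list, and blocks and indices are counted from 0.\<close>

definition block :: "nat list \<Rightarrow> nat \<Rightarrow> nat set" where
  "block ns p = {sum_list (take p ns) ..< sum_list (take (Suc p) ns)}"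

definition nest_algebra :: "nat list \<Rightarrow> complex mat set" where
  "nest_algebra ns =
     {x \<in> carrier_mat (sum_list ns) (sum_list ns).
        \<forall>p<length ns. \<forall>q<p. \<forall>i\<in>block ns p. \<forall>j\<in>block ns q. x $$ (i, j) = 0}"

definition nest_family :: "nat \<Rightarrow> (nat \<times> complex mat set) set" where
  "nest_family r =
     {(sum_list ns, nest_algebra ns) | ns. length ns = r \<and> (\<forall>m\<in>set ns. 0 < m)}"

definition stable_family :: "(nat \<times> complex mat set) set \<Rightarrow> bool" where
  "stable_family \<F> \<longleftrightarrow>
     (\<forall>\<epsilon>>0. \<forall>(m\<^sub>1, \<A>\<^sub>1)\<in>\<F>. \<exists>\<delta>>0.
        \<forall>(m\<^sub>2, \<A>\<^sub>2)\<in>\<F>. \<forall>n\<ge>1. \<forall>\<phi>\<^sub>1 \<phi>\<^sub>2.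
          star_extendible_embedding m\<^sub>1 \<A>\<^sub>1 n (carrier_mat n n) \<phi>\<^sub>1 \<and>
          star_extendible_embedding m\<^sub>2 \<A>\<^sub>2 n (carrier_mat n n) \<phi>\<^sub>2 \<and>
          near_subset \<delta> (\<phi>\<^sub>1 ` \<A>\<^sub>1) (\<phi>\<^sub>2 ` \<A>\<^sub>2) \<longrightarrow>
          (\<exists>\<psi>. star_extendible_embedding m\<^sub>1 \<A>\<^sub>1 n (carrier_mat n n) \<psi> \<and>
               map_norm \<A>\<^sub>1 (\<lambda>x. \<phi>\<^sub>1 x - \<psi> x) < \<epsilon> \<and>
               \<psi> ` \<A>\<^sub>1 \<subseteq> \<phi>\<^sub>2 ` \<A>\<^sub>2))"

end

theory Submission
  imports Defs "HOL-Computational_Algebra.Polynomial"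
begin

text \<open>
  An embedding of the first nest algebra is a system of matrix units \<open>f i j\<close> in \<open>M\<^sub>n\<close>, and the
  hypothesis says that those units with \<open>i\<close> in an earlier block than \<open>j\<close>, or in the same one, are
  close to the image \<open>B\<close> of the second nest algebra.  The second embedding extends to a *-homomorphism
  of a full matrix algebra, with image \<open>C\<close>, and \<open>B\<close> consists of the elements of \<open>C\<close> that leave a chain
  of projections \<open>E 0 \<le> \<dots> \<le> E r\<close> invariant.  A partial isometry \<open>u\<close> close to the sum of the
  \<open>f i i\<close> is wanted such that \<open>u f i j u*\<close> lies in \<open>B\<close> for those \<open>i\<close>, \<open>j\<close>; conjugating the first
  embedding by \<open>u\<close> then gives the perturbed one.

  Three facts produce \<open>u\<close>.

  \<^item> If \<open>x\<close> and \<open>x*\<close> are both close to \<open>B\<close>, then \<open>x\<close> almost commutes with the \<open>E l\<close>, so it is close to the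
    diagonal \<open>D\<close> of \<open>B\<close> (\<open>asymptotic_diagonal\<close>).  As \<open>D\<close> is closed under the functional calculus, the
    projections \<open>f i i\<close> can be replaced by orthogonal projections in \<open>D\<close>
    (\<open>orthogonal_projections_in_D\<close>).

  \<^item> An element of \<open>B\<close> that is close to a partial isometry between projections of \<open>D\<close> is close to a
    partial isometry in \<open>B\<close> between the same projections (\<open>partial_isometry_in_B\<close>).  The polar
    decomposition does not stay in \<open>B\<close>, since \<open>B\<close> is not closed under adjoints; block by block
    orthonormalisation along the chain does, because all corrections are upper triangular.  The
    error grows with each block, so a fixed number \<open>r\<close> of blocks keeps it under control.

  \<^item> Matrix units are determined by those next to the diagonal, so it suffices to treat the
    finitely many units \<open>f i (i+1)\<close> and to multiply (\<open>conjugate_into_nest\<close>).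

  The number \<open>\<delta>\<close> may depend neither on \<open>n\<close> nor on the second algebra.  Instead of tracking constants,
  the argument takes a sequence of hypothetical counterexamples with \<open>\<delta>\<close> tending to \<open>0\<close> and computes
  modulo sequences that tend to \<open>0\<close> in norm.  The only analysis in it is the functional calculus for a
  self-adjoint matrix \<open>h\<close> with \<open>h\<^sup>2\<close> close to \<open>h\<close>; its estimates do not involve the size of the matrix
  (\<open>spectral_projection\<close>).
\<close>

section \<open>The operator norm on complex matrices\<close>

lemma mult_mat_vec_index_sum:
  assumes "A \<in> carrier_mat n k" "v \<in> carrier_vec k" "i < n"
  shows "(A *\<^sub>v v) $ i = (\<Sum>j<k. A $$ (i,j) * v $ j)"
  using assms by (auto simp: scalar_prod_def lessThan_atLeast0 intro!: sum.cong)

lemma mult_mat_index_sum: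
  assumes "A \<in> carrier_mat n k" "B \<in> carrier_mat k l" "i < n" "j < l"
  shows "(A * B) $$ (i,j) = (\<Sum>a<k. A $$ (i,a) * B $$ (a,j))"
  using assms by (auto simp: scalar_prod_def lessThan_atLeast0 intro!: sum.cong)

lemma mat_adjoint_dim [simp]:
  "dim_row (mat_adjoint A) = dim_col A" "dim_col (mat_adjoint A) = dim_row A"
  by (auto simp: mat_adjoint_def)

lemma mat_adjoint_carrier [simp]:
  "A \<in> carrier_mat n k \<Longrightarrow> mat_adjoint A \<in> carrier_mat k n"
  by (auto intro!: carrier_matI)

lemma mat_adjoint_index [simp]:
  "i < dim_col A \<Longrightarrow> j < dim_row A \<Longrightarrow> mat_adjoint A $$ (i,j) = cnj (A $$ (j,i))"
  by (simp add: mat_adjoint_def mat_of_rows_index)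

lemma mat_adjoint_adjoint [simp]: "mat_adjoint (mat_adjoint A) = (A :: complex mat)"
  by (rule eq_matI) auto

lemma adjoint_zero_mat: "mat_adjoint (0\<^sub>m n k :: complex mat) = 0\<^sub>m k n"
  by (rule eq_matI) auto

lemma mat_adjoint_mult:
  fixes A :: "complex mat"
  assumes A: "A \<in> carrier_mat n k" and B: "B \<in> carrier_mat k l"
  shows "mat_adjoint (A * B) = mat_adjoint B * mat_adjoint A"
proof (rule eq_matI)
  fix i j assume ij: "i < dim_row (mat_adjoint B * mat_adjoint A)"
    "j < dim_col (mat_adjoint B * mat_adjoint A)"
  then have i: "i < l" and j: "j < n" using A B by auto
  show "mat_adjoint (A * B) $$ (i,j) = (mat_adjoint B * mat_adjoint A) $$ (i,j)"
    using A B i j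
    by (simp add: mult_mat_index_sum[OF A B j i]
        mult_mat_index_sum[OF mat_adjoint_carrier[OF B] mat_adjoint_carrier[OF A] i j]
        mult.commute del: index_mult_mat(1))
qed (use A B in auto)

lemma mat_adjoint_add:
  fixes A :: "complex mat"
  assumes "A \<in> carrier_mat n k" and "B \<in> carrier_mat n k"
  shows "mat_adjoint (A + B) = mat_adjoint A + mat_adjoint B"
  using assms by (intro eq_matI) auto

lemma mat_adjoint_smult: "mat_adjoint (c \<cdot>\<^sub>m A) = cnj c \<cdot>\<^sub>m mat_adjoint (A :: complex mat)"
  by (rule eq_matI) auto

lemma l2_norm_nonneg [simp]: "0 \<le> l2_norm v"
  by (simp add: l2_norm_def)

lemma l2_norm_zero [simp]: "l2_norm (0\<^sub>v n) = 0"
  by (simp add: l2_norm_def L2_set_def)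

lemma l2_norm_sq: "(l2_norm v)\<^sup>2 = (\<Sum>i<dim_vec v. (cmod (v $ i))\<^sup>2)"
  by (simp add: l2_norm_def L2_set_def sum_nonneg)

lemma component_le_l2_norm: "i < dim_vec v \<Longrightarrow> cmod (v $ i) \<le> l2_norm v"
  unfolding l2_norm_def by (rule member_le_L2_set) auto

lemma l2_norm_triangle:
  assumes "v \<in> carrier_vec n" "w \<in> carrier_vec n"
  shows "l2_norm (v + w) \<le> l2_norm v + l2_norm w"
proof -
  have "l2_norm (v + w) \<le> L2_set (\<lambda>i. cmod (v $ i) + cmod (w $ i)) {..<n}"
    using assms unfolding l2_norm_def by (auto intro!: L2_set_mono norm_triangle_ineq)
  also have "\<dots> \<le> l2_norm v + l2_norm w"
    using assms L2_set_triangle_ineq unfolding l2_norm_def by auto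
  finally show ?thesis .
qed

lemma l2_norm_smult: "l2_norm (c \<cdot>\<^sub>v v) = cmod c * l2_norm v"
proof -
  have "l2_norm (c \<cdot>\<^sub>v v) = L2_set (\<lambda>i. cmod c * cmod (v $ i)) {..<dim_vec v}"
    unfolding l2_norm_def by (rule L2_set_cong) (auto simp: norm_mult)
  then show ?thesis by (simp add: l2_norm_def L2_set_right_distrib)
qed

lemma l2_norm_eq_0:
  assumes "v \<in> carrier_vec n" "l2_norm v = 0"
  shows "v = 0\<^sub>v n"
  using assms component_le_l2_norm[of _ v] by (intro eq_vecI) auto

lemma cauchy_schwarz:
  assumes "v \<in> carrier_vec n" "w \<in> carrier_vec n"
  shows "cmod (\<Sum>i<n. v $ i * cnj (w $ i)) \<le> l2_norm v * l2_norm w"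
proof -
  have "cmod (\<Sum>i<n. v $ i * cnj (w $ i)) \<le> (\<Sum>i<n. \<bar>cmod (v $ i)\<bar> * \<bar>cmod (w $ i)\<bar>)"
    by (rule order_trans[OF norm_sum]) (simp add: norm_mult)
  also have "\<dots> \<le> l2_norm v * l2_norm w"
    using assms L2_set_mult_ineq[of "\<lambda>i. cmod (v $ i)" "\<lambda>i. cmod (w $ i)" "{..<n}"]
    unfolding l2_norm_def by auto
  finally show ?thesis .
qed

text \<open>
  Crude, but it shows that the supremum in the definition of the operator norm is finite, without
  which nothing can be derived about that norm.
\<close>

lemma l2_norm_mult_vec_bound:
  assumes A: "A \<in> carrier_mat n k" and v: "v \<in> carrier_vec k"
  shows "l2_norm (A *\<^sub>v v) \<le> (\<Sum>i<n. \<Sum>j<k. cmod (A $$ (i,j))) * l2_norm v"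
proof -
  have "l2_norm (A *\<^sub>v v) \<le> (\<Sum>i<n. cmod ((A *\<^sub>v v) $ i))"
    using A v unfolding l2_norm_def by (auto intro!: L2_set_le_sum simp del: index_mult_mat_vec)
  also have "\<dots> \<le> (\<Sum>i<n. \<Sum>j<k. cmod (A $$ (i,j)) * l2_norm v)"
  proof (rule sum_mono)
    fix i assume "i \<in> {..<n}"
    then have "cmod ((A *\<^sub>v v) $ i) = cmod (\<Sum>j<k. A $$ (i,j) * v $ j)"
      using mult_mat_vec_index_sum[OF A v] by simp
    also have "\<dots> \<le> (\<Sum>j<k. cmod (A $$ (i,j)) * l2_norm v)"
      using v by (intro order_trans[OF norm_sum] sum_mono)
        (auto simp: norm_mult intro!: mult_left_mono component_le_l2_norm)
    finally show "cmod ((A *\<^sub>v v) $ i) \<le> (\<Sum>j<k. cmod (A $$ (i,j)) * l2_norm v)" .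
  qed
  finally show ?thesis by (simp add: sum_distrib_right)
qed

lemma op_norm_set_bdd:
  "bdd_above {l2_norm (A *\<^sub>v v) | v. v \<in> carrier_vec (dim_col A) \<and> l2_norm v \<le> 1}"
proof -
  define K where "K = (\<Sum>i<dim_row A. \<Sum>j<dim_col A. cmod (A $$ (i,j)))"
  have K: "K \<ge> 0" by (simp add: K_def sum_nonneg)
  show ?thesis
  proof (rule bdd_aboveI[of _ K])
    fix x assume "x \<in> {l2_norm (A *\<^sub>v v) | v. v \<in> carrier_vec (dim_col A) \<and> l2_norm v \<le> 1}"
    then obtain v where v: "x = l2_norm (A *\<^sub>v v)" "v \<in> carrier_vec (dim_col A)" "l2_norm v \<le> 1"
      by auto
    have "x \<le> K * l2_norm v" using l2_norm_mult_vec_bound[of A "dim_row A" "dim_col A" v] v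
      by (auto simp: K_def)
    also have "\<dots> \<le> K" using K v by (simp add: mult_left_le)
    finally show "x \<le> K" .
  qed
qed

lemma op_norm_nonneg [simp]: "0 \<le> op_norm A"
proof -
  have "0 = l2_norm (A *\<^sub>v 0\<^sub>v (dim_col A))" by (simp add: l2_norm_def L2_set_def scalar_prod_def)
  also have "\<dots> \<le> op_norm A"
    unfolding op_norm_def by (rule cSup_upper[OF _ op_norm_set_bdd]) (auto intro!: exI[of _ "0\<^sub>v (dim_col A)"])
  finally show ?thesis .
qed

lemma l2_norm_mult_vec:
  assumes A: "A \<in> carrier_mat n k" and v: "v \<in> carrier_vec k"
  shows "l2_norm (A *\<^sub>v v) \<le> op_norm A * l2_norm v"
proof (cases "l2_norm v = 0")
  case True
  then have "v = 0\<^sub>v k" using v by (rule l2_norm_eq_0[rotated])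
  then show ?thesis using A by (simp add: l2_norm_def L2_set_def scalar_prod_def)
next
  case False
  define c where "c = complex_of_real (1 / l2_norm v)"
  have c: "cmod c = 1 / l2_norm v" by (simp add: c_def norm_divide)
  have "l2_norm (A *\<^sub>v (c \<cdot>\<^sub>v v)) \<le> op_norm A"
    unfolding op_norm_def
    by (rule cSup_upper[OF _ op_norm_set_bdd]) (use A v c False in \<open>auto simp: l2_norm_smult\<close>)
  also have "A *\<^sub>v (c \<cdot>\<^sub>v v) = c \<cdot>\<^sub>v (A *\<^sub>v v)"
    using A v by (rule mult_mat_vec)
  finally show ?thesis using False c 
    by (simp add: l2_norm_smult pos_divide_le_eq order_less_le)
qed

lemma op_norm_le:
  assumes A: "A \<in> carrier_mat n k" and "0 \<le> c"
    and bd: "\<And>v. v \<in> carrier_vec k \<Longrightarrow> l2_norm (A *\<^sub>v v) \<le> c * l2_norm v"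
  shows "op_norm A \<le> c"
  unfolding op_norm_def
proof (rule cSup_least)
  show "{l2_norm (A *\<^sub>v v) | v. v \<in> carrier_vec (dim_col A) \<and> l2_norm v \<le> 1} \<noteq> {}"
    by (auto intro!: exI[of _ "0\<^sub>v (dim_col A)"])
  fix x assume "x \<in> {l2_norm (A *\<^sub>v v) | v. v \<in> carrier_vec (dim_col A) \<and> l2_norm v \<le> 1}"
  then obtain v where v: "x = l2_norm (A *\<^sub>v v)" "v \<in> carrier_vec k" "l2_norm v \<le> 1"
    using A by auto
  then have "x \<le> c * l2_norm v" using bd by simp
  also have "\<dots> \<le> c" using v \<open>0 \<le> c\<close> by (simp add: mult_left_le)
  finally show "x \<le> c" .
qed

lemma op_norm_zero [simp]: "op_norm (0\<^sub>m n k) = 0"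
proof -
  have "op_norm (0\<^sub>m n k) \<le> 0"
    by (rule op_norm_le[of _ n k]) (auto simp: l2_norm_def L2_set_def scalar_prod_def)
  then show ?thesis using op_norm_nonneg[of "0\<^sub>m n k"] by linarith
qed

lemma op_norm_triangle:
  assumes A: "A \<in> carrier_mat n k" and B: "B \<in> carrier_mat n k"
  shows "op_norm (A + B) \<le> op_norm A + op_norm B"
proof (rule op_norm_le[of _ n k])
  fix v :: "complex vec" assume v: "v \<in> carrier_vec k"
  have "l2_norm ((A + B) *\<^sub>v v) = l2_norm (A *\<^sub>v v + B *\<^sub>v v)"
    using add_mult_distrib_mat_vec[OF A B v] by simp
  also have "\<dots> \<le> l2_norm (A *\<^sub>v v) + l2_norm (B *\<^sub>v v)"
    by (rule l2_norm_triangle[OF mult_mat_vec_carrier[OF A v] mult_mat_vec_carrier[OF B v]])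
  also have "\<dots> \<le> (op_norm A + op_norm B) * l2_norm v"
    using l2_norm_mult_vec[OF A v] l2_norm_mult_vec[OF B v] by (simp add: algebra_simps)
  finally show "l2_norm ((A + B) *\<^sub>v v) \<le> (op_norm A + op_norm B) * l2_norm v" .
qed (use assms in auto)

lemma op_norm_mult:
  assumes A: "A \<in> carrier_mat n k" and B: "B \<in> carrier_mat k l"
  shows "op_norm (A * B) \<le> op_norm A * op_norm B"
proof (rule op_norm_le[of _ n l])
  fix v :: "complex vec" assume v: "v \<in> carrier_vec l"
  have "l2_norm (A * B *\<^sub>v v) = l2_norm (A *\<^sub>v (B *\<^sub>v v))"
    using assoc_mult_mat_vec[OF A B v] by simp
  also have "\<dots> \<le> op_norm A * l2_norm (B *\<^sub>v v)"
    using B v by (intro l2_norm_mult_vec[OF A]) auto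
  also have "\<dots> \<le> op_norm A * (op_norm B * l2_norm v)"
    using l2_norm_mult_vec[OF B v] by (simp add: mult_left_mono)
  finally show "l2_norm (A * B *\<^sub>v v) \<le> op_norm A * op_norm B * l2_norm v"
    by (simp add: mult.assoc)
qed (use assms in auto)

lemma smult_mat_mult_vec:
  fixes A :: "complex mat"
  assumes "A \<in> carrier_mat n k" "v \<in> carrier_vec k"
  shows "(c \<cdot>\<^sub>m A) *\<^sub>v v = c \<cdot>\<^sub>v (A *\<^sub>v v)"
  using assms by (intro eq_vecI) auto

lemma op_norm_smult_le: "op_norm (c \<cdot>\<^sub>m A) \<le> cmod c * op_norm A"
proof (rule op_norm_le[of _ "dim_row A" "dim_col A"])
  fix v :: "complex vec" assume v: "v \<in> carrier_vec (dim_col A)"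
  have A: "A \<in> carrier_mat (dim_row A) (dim_col A)" by auto
  show "l2_norm ((c \<cdot>\<^sub>m A) *\<^sub>v v) \<le> cmod c * op_norm A * l2_norm v"
    using l2_norm_mult_vec[OF A v] smult_mat_mult_vec[OF A v]
    by (simp add: l2_norm_smult mult.assoc mult_left_mono)
qed auto

lemma op_norm_smult: "op_norm (c \<cdot>\<^sub>m A) = cmod c * op_norm A"
proof (cases "c = 0")
  case True
  then have "c \<cdot>\<^sub>m A = 0\<^sub>m (dim_row A) (dim_col A)" by (intro eq_matI) auto
  then show ?thesis using True by simp
next
  case False
  have "A = inverse c \<cdot>\<^sub>m (c \<cdot>\<^sub>m A)" using False by (intro eq_matI) auto
  then have "op_norm A \<le> cmod (inverse c) * op_norm (c \<cdot>\<^sub>m A)"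
    using op_norm_smult_le[of "inverse c" "c \<cdot>\<^sub>m A"] by simp
  then have "cmod c * op_norm A \<le> cmod c * (cmod (inverse c) * op_norm (c \<cdot>\<^sub>m A))"
    by (rule mult_left_mono) simp
  then have "cmod c * op_norm A \<le> op_norm (c \<cdot>\<^sub>m A)"
    using False by (simp add: norm_inverse mult.assoc[symmetric])
  then show ?thesis using op_norm_smult_le[of c A] by linarith
qed

lemma entry_le_op_norm:
  assumes A: "A \<in> carrier_mat n k" and ij: "i < n" "j < k"
  shows "cmod (A $$ (i,j)) \<le> op_norm A"
proof -
  have "(l2_norm (unit_vec k j :: complex vec))\<^sup>2 = (\<Sum>i<k. if i = j then 1 else 0)"
    unfolding l2_norm_sq by (intro sum.cong) (auto simp: unit_vec_def)
  then have u: "l2_norm (unit_vec k j :: complex vec) = 1"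
    using ij l2_norm_nonneg[of "unit_vec k j"] by (simp add: power2_eq_1_iff)
  have "(A *\<^sub>v unit_vec k j) $ i = A $$ (i,j)"
    using A ij by simp
  then have "cmod (A $$ (i,j)) \<le> l2_norm (A *\<^sub>v unit_vec k j)"
    using component_le_l2_norm[of i "A *\<^sub>v unit_vec k j"] A ij by simp
  also have "\<dots> \<le> op_norm A"
    using l2_norm_mult_vec[OF A, of "unit_vec k j"] u by simp
  finally show ?thesis .
qed

lemma adjoint_inner:
  assumes A: "A \<in> carrier_mat n k" and u: "u \<in> carrier_vec n" and v: "v \<in> carrier_vec k"
  shows "(\<Sum>j<k. (mat_adjoint A *\<^sub>v u) $ j * cnj (v $ j)) = (\<Sum>i<n. u $ i * cnj ((A *\<^sub>v v) $ i))"
proof -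
  have "(\<Sum>j<k. (mat_adjoint A *\<^sub>v u) $ j * cnj (v $ j))
      = (\<Sum>j<k. \<Sum>i<n. cnj (A $$ (i,j)) * u $ i * cnj (v $ j))"
    using A mult_mat_vec_index_sum[OF mat_adjoint_carrier[OF A] u]
    by (simp add: sum_distrib_right)
  also have "\<dots> = (\<Sum>i<n. \<Sum>j<k. cnj (A $$ (i,j)) * u $ i * cnj (v $ j))"
    by (rule sum.swap)
  also have "\<dots> = (\<Sum>i<n. u $ i * cnj ((A *\<^sub>v v) $ i))"
    using mult_mat_vec_index_sum[OF A v]
    by (auto simp: sum_distrib_left mult_ac intro!: sum.cong)
  finally show ?thesis .
qed

text \<open>
  This half of the C*-identity is the Cauchy--Schwarz inequality applied to
  \<open>\<parallel>Av\<parallel>\<^sup>2 = \<langle>A*Av, v\<rangle>\<close>.  The other half and the invariance of the norm under adjoints follow from it.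
\<close>

lemma op_norm_adjoint_mult:
  assumes A: "A \<in> carrier_mat n k"
  shows "(op_norm A)\<^sup>2 \<le> op_norm (mat_adjoint A * A)"
proof -
  define B where "B = mat_adjoint A * A"
  have B: "B \<in> carrier_mat k k" using A by (auto simp: B_def)
  have "op_norm A \<le> sqrt (op_norm B)"
  proof (rule op_norm_le[OF A])
    fix v :: "complex vec" assume v: "v \<in> carrier_vec k"
    have Av: "A *\<^sub>v v \<in> carrier_vec n" using A v by auto
    have "of_real ((l2_norm (A *\<^sub>v v))\<^sup>2) = (\<Sum>i<n. (A *\<^sub>v v) $ i * cnj ((A *\<^sub>v v) $ i))"
      using carrier_vecD[OF Av] by (simp add: l2_norm_sq complex_norm_square[symmetric] of_real_power[symmetric] del: of_real_power index_mult_mat_vec dim_mult_mat_vec)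
    also have "\<dots> = (\<Sum>j<k. (B *\<^sub>v v) $ j * cnj (v $ j))"
      unfolding adjoint_inner[OF A Av v, symmetric] B_def
      using assoc_mult_mat_vec[OF mat_adjoint_carrier[OF A] A v] by simp
    finally have "(l2_norm (A *\<^sub>v v))\<^sup>2 \<le> l2_norm (B *\<^sub>v v) * l2_norm v"
      using cauchy_schwarz[of "B *\<^sub>v v" k v] B v
      by (metis abs_of_nonneg mult_mat_vec_carrier norm_of_real zero_le_power2)
    also have "\<dots> \<le> op_norm B * l2_norm v * l2_norm v"
      using l2_norm_mult_vec[OF B v] by (simp add: mult_right_mono)
    finally have "(l2_norm (A *\<^sub>v v))\<^sup>2 \<le> (sqrt (op_norm B) * l2_norm v)\<^sup>2"
      by (simp add: power_mult_distrib power2_eq_square mult_ac)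
    then show "l2_norm (A *\<^sub>v v) \<le> sqrt (op_norm B) * l2_norm v"
      by (rule power2_le_imp_le) simp
  qed simp
  then have "(op_norm A)\<^sup>2 \<le> (sqrt (op_norm B))\<^sup>2"
    by (rule power_mono) simp
  then show ?thesis by (simp add: B_def)
qed

lemma op_norm_adjoint:
  assumes A: "A \<in> carrier_mat n n"
  shows "op_norm (mat_adjoint A) \<le> op_norm A"
proof (cases "op_norm (mat_adjoint A) = 0")
  case False
  have "(op_norm (mat_adjoint A))\<^sup>2 \<le> op_norm A * op_norm (mat_adjoint A)"
    using op_norm_adjoint_mult[OF mat_adjoint_carrier[OF A]]
      op_norm_mult[OF A mat_adjoint_carrier[OF A]] by simp
  then have "op_norm (mat_adjoint A) * op_norm (mat_adjoint A) \<le> op_norm A * op_norm (mat_adjoint A)"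
    by (simp add: power2_eq_square)
  then show ?thesis using False op_norm_nonneg[of "mat_adjoint A"] by (simp add: mult_le_cancel_right)
qed simp

section \<open>Eigenprojections of self-adjoint matrices\<close>

lemma trace_mult_commute:
  fixes X Y :: "complex mat"
  assumes X: "X \<in> carrier_mat n n" and Y: "Y \<in> carrier_mat n n"
  shows "(\<Sum>i<n. (X * Y) $$ (i,i)) = (\<Sum>i<n. (Y * X) $$ (i,i))"
proof -
  have "(\<Sum>i<n. (X * Y) $$ (i,i)) = (\<Sum>i<n. \<Sum>j<n. X $$ (i,j) * Y $$ (j,i))"
    by (intro sum.cong) (auto simp: mult_mat_index_sum[OF X Y] simp del: index_mult_mat)
  also have "\<dots> = (\<Sum>j<n. \<Sum>i<n. X $$ (i,j) * Y $$ (j,i))" by (rule sum.swap)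
  also have "\<dots> = (\<Sum>i<n. (Y * X) $$ (i,i))"
    by (intro sum.cong) (auto simp: mult_mat_index_sum[OF Y X] mult.commute simp del: index_mult_mat)
  finally show ?thesis .
qed

text \<open>
  The trace of \<open>h\<^sup>2 = h*h\<close> is the sum of the squared moduli of the entries of \<open>h\<close>, hence not zero.  Read
  off from a triangular form it is the sum of the squares of the eigenvalues, so these are not all zero.
\<close>

lemma self_adjoint_nonzero_eigenvalue:
  fixes h :: "complex mat"
  assumes h: "h \<in> carrier_mat n n" and sa: "mat_adjoint h = h" and nz: "h \<noteq> 0\<^sub>m n n"
  obtains k where "k \<noteq> 0" "eigenvalue h k"
proof -
  obtain es where es: "char_poly h = (\<Prod>a\<leftarrow>es. [:- a, 1:])"
    using char_poly_factorized[OF h] by auto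
  obtain B P Q where "schur_decomposition h es = (B, P, Q)" by (metis prod_cases3)
  from schur_decomposition[OF h es this]
  have sim: "similar_mat_wit h B P Q" and ut: "upper_triangular B" and dg: "diag_mat B = es"
    by auto
  from similar_mat_witD2[OF h sim] have PQ: "P * Q = 1\<^sub>m n" "Q * P = 1\<^sub>m n" "h = P * B * Q"
    and c: "B \<in> carrier_mat n n" "P \<in> carrier_mat n n" "Q \<in> carrier_mat n n" by auto
  have sym: "h $$ (j,i) = cnj (h $$ (i,j))" if "i < n" "j < n" for i j
    using arg_cong[OF sa, of "\<lambda>m. m $$ (j,i)"] that h by simp
  have "h * h = P * (B * B * Q)"
  proof -
    have "h * h = P * (B * ((Q * P) * (B * Q)))"
      unfolding PQ(3) using c by (simp add: assoc_mult_mat[of _ n n _ n _ n])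
    then show ?thesis using c by (simp add: PQ assoc_mult_mat[of _ n n _ n _ n])
  qed
  then have "(\<Sum>i<n. (h * h) $$ (i,i)) = (\<Sum>i<n. (B * B * Q * P) $$ (i,i))"
    using trace_mult_commute[of P n "B * B * Q"] c by simp
  also have "B * B * Q * P = B * B"
    using c by (simp add: PQ assoc_mult_mat[of _ n n _ n _ n])
  also have "(\<Sum>i<n. (B * B) $$ (i,i)) = (\<Sum>i<n. (B $$ (i,i))\<^sup>2)"
  proof (rule sum.cong[OF refl])
    fix i assume "i \<in> {..<n}"
    then have i: "i < n" by simp
    have "(B * B) $$ (i,i) = (\<Sum>a<n. B $$ (i,a) * B $$ (a,i))"
      by (rule mult_mat_index_sum[OF c(1) c(1) i i])
    also have "\<dots> = (\<Sum>a<n. if a = i then (B $$ (i,i))\<^sup>2 else 0)"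
    proof (rule sum.cong[OF refl])
      fix a assume "a \<in> {..<n}"
      then show "B $$ (i,a) * B $$ (a,i) = (if a = i then (B $$ (i,i))\<^sup>2 else 0)"
        using upper_triangularD[OF ut] c i
        by (cases a i rule: linorder_cases) (auto simp: power2_eq_square)
    qed
    finally show "(B * B) $$ (i,i) = (B $$ (i,i))\<^sup>2" using i by simp
  qed
  finally have tr: "(\<Sum>i<n. (h * h) $$ (i,i)) = (\<Sum>i<n. (B $$ (i,i))\<^sup>2)" .
  have tr2: "(\<Sum>i<n. (h * h) $$ (i,i)) = of_real (\<Sum>i<n. \<Sum>a<n. (cmod (h $$ (i,a)))\<^sup>2)"
  proof -
    have "(h * h) $$ (i,i) = (\<Sum>a<n. of_real ((cmod (h $$ (i,a)))\<^sup>2))" if i: "i < n" for i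
      unfolding mult_mat_index_sum[OF h h i i]
    proof (rule sum.cong[OF refl])
      fix a assume "a \<in> {..<n}"
      then show "h $$ (i,a) * h $$ (a,i) = of_real ((cmod (h $$ (i,a)))\<^sup>2)"
        unfolding complex_norm_square using sym[OF i, of a] by simp
    qed
    then show ?thesis by (simp add: of_real_sum del: index_mult_mat of_real_power)
  qed
  have "\<exists>i<n. B $$ (i,i) \<noteq> 0"
  proof (rule ccontr)
    assume "\<not> ?thesis"
    then have "(\<Sum>i<n. \<Sum>a<n. (cmod (h $$ (i,a)))\<^sup>2) = 0" using tr tr2
      by (metis (mono_tags, lifting) lessThan_iff of_real_eq_0_iff sum.neutral zero_power2)
    then have "\<forall>i<n. \<forall>a<n. h $$ (i,a) = 0"
      by (simp add: sum_nonneg_eq_0_iff sum_nonneg)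
    then have "h = 0\<^sub>m n n" using h by (intro eq_matI) auto
    then show False using nz by simp
  qed
  then obtain i where i: "i < n" "B $$ (i,i) \<noteq> 0" by auto
  then have "B $$ (i,i) \<in> set es" unfolding dg[symmetric] diag_mat_def using c by auto
  then have "poly (char_poly h) (B $$ (i,i)) = 0"
    unfolding es poly_prod_list by (auto simp: prod_list_zero_iff image_iff)
  then show ?thesis using that[OF i(2)] eigenvalue_root_char_poly[OF h] by auto
qed

text \<open>
  The projection onto the line of an eigenvector.  Its trace is recorded because it later bounds how
  many such projections can be orthogonal to each other.
\<close>

lemma self_adjoint_eigenprojection:
  fixes h :: "complex mat"
  assumes h: "h \<in> carrier_mat n n" and sa: "mat_adjoint h = h" and nz: "h \<noteq> 0\<^sub>m n n"
  obtains l :: real and e where "l \<noteq> 0" "e \<in> carrier_mat n n" "mat_adjoint e = e" "e * e = e"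
    "h * e = of_real l \<cdot>\<^sub>m e" "(\<Sum>i<n. e $$ (i,i)) = 1"
proof -
  obtain k where k: "k \<noteq> 0" "eigenvalue h k"
    using self_adjoint_nonzero_eigenvalue[OF assms] by blast
  then obtain v where v: "v \<in> carrier_vec n" "v \<noteq> 0\<^sub>v n" "h *\<^sub>v v = k \<cdot>\<^sub>v v"
    unfolding eigenvalue_def eigenvector_def using h by auto
  define N where "N = (\<Sum>i<n. (cmod (v $ i))\<^sup>2)"
  have N: "N > 0"
  proof -
    have "l2_norm v \<noteq> 0" using l2_norm_eq_0[OF v(1)] v(2) by auto
    then have "(l2_norm v)\<^sup>2 > 0" by simp
    then show ?thesis using v(1) by (simp add: l2_norm_sq N_def)
  qed
  have vv: "(\<Sum>i<n. v $ i * cnj (v $ i)) = of_real N"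
    by (simp add: N_def complex_norm_square del: of_real_power)
  have hv: "(h *\<^sub>v v) $ i = k * v $ i" if "i < n" for i
    using v that by simp
  have "(\<Sum>i<n. (h *\<^sub>v v) $ i * cnj (v $ i)) = (\<Sum>i<n. v $ i * cnj ((h *\<^sub>v v) $ i))"
    using adjoint_inner[OF h v(1) v(1)] sa by simp
  moreover have "(\<Sum>i<n. (h *\<^sub>v v) $ i * cnj (v $ i)) = k * of_real N"
    unfolding vv[symmetric] sum_distrib_left by (intro sum.cong) (auto simp: hv)
  moreover have "(\<Sum>i<n. v $ i * cnj ((h *\<^sub>v v) $ i)) = cnj k * of_real N"
    unfolding vv[symmetric] sum_distrib_left by (intro sum.cong) (auto simp: hv)
  ultimately have "cnj k = k" using N by simp
  then have kr: "k = of_real (Re k)" by (simp add: complex_eq_iff)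
  define e where "e = mat n n (\<lambda>(i,j). v $ i * cnj (v $ j) / of_real N)"
  have e: "e \<in> carrier_mat n n" by (simp add: e_def)
  have "mat_adjoint e = e"
    by (rule eq_matI) (auto simp: e_def mult.commute)
  moreover have "e * e = e"
  proof (rule eq_matI)
    fix i j assume "i < dim_row e" "j < dim_col e"
    then have ij: "i < n" "j < n" by (auto simp: e_def)
    have "(e * e) $$ (i,j) = (\<Sum>a<n. (v $ i * cnj (v $ j) / (of_real N * of_real N)) * (v $ a * cnj (v $ a)))"
      unfolding mult_mat_index_sum[OF e e ij]
      by (intro sum.cong) (auto simp: e_def ij)
    also have "\<dots> = e $$ (i,j)"
      unfolding sum_distrib_left[symmetric] vv using N ij by (simp add: e_def)
    finally show "(e * e) $$ (i,j) = e $$ (i,j)" .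
  qed (auto simp: e_def)
  moreover have "h * e = of_real (Re k) \<cdot>\<^sub>m e"
  proof (rule eq_matI)
    fix i j assume "i < dim_row (of_real (Re k) \<cdot>\<^sub>m e)" "j < dim_col (of_real (Re k) \<cdot>\<^sub>m e)"
    then have ij: "i < n" "j < n" by (auto simp: e_def)
    have "(h * e) $$ (i,j) = (\<Sum>a<n. h $$ (i,a) * v $ a) * (cnj (v $ j) / of_real N)"
      unfolding mult_mat_index_sum[OF h e ij] sum_distrib_right
      by (intro sum.cong) (auto simp: e_def ij)
    also have "\<dots> = k * v $ i * (cnj (v $ j) / of_real N)"
      unfolding mult_mat_vec_index_sum[OF h v(1) ij(1), symmetric] hv[OF ij(1)] ..
    finally show "(h * e) $$ (i,j) = (of_real (Re k) \<cdot>\<^sub>m e) $$ (i,j)"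
      using ij kr[symmetric] by (simp add: e_def)
  qed (use h in \<open>auto simp: e_def\<close>)
  moreover have "(\<Sum>i<n. e $$ (i,i)) = 1"
  proof -
    have "(\<Sum>i<n. e $$ (i,i)) = (\<Sum>i<n. v $ i * cnj (v $ i)) / of_real N"
      unfolding sum_divide_distrib by (intro sum.cong) (auto simp: e_def)
    then show ?thesis unfolding vv using N by simp
  qed
  moreover have "Re k \<noteq> 0" using k(1) kr by (metis of_real_0)
  ultimately show ?thesis using that[of "Re k" e] e by blast
qed

section \<open>Functional calculus in C*-normed algebras\<close>

text \<open>
  Matrices of all sizes together do not form a ring, so the argument is carried out in an abstract
  algebra into which they embed.  A unit is not assumed, because the embeddings need
  not be unital and the matrix algebras that matter sit inside a larger algebra with another unit.
\<close>

class cstar_normed_algebra = real_normed_algebra +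
  fixes adj :: "'a \<Rightarrow> 'a"
  assumes adj_adj [simp]: "adj (adj x) = x"
    and adj_add: "adj (x + y) = adj x + adj y"
    and adj_mult: "adj (x * y) = adj y * adj x"
    and adj_scaleR: "adj (c *\<^sub>R x) = c *\<^sub>R adj x"
    and norm_adj_mult: "(norm x)\<^sup>2 \<le> norm (adj x * x)"
lemma adj_zero [simp]: "adj (0::'a::cstar_normed_algebra) = 0"
  using adj_scaleR[of 0 0] by simp

lemma adj_uminus: "adj (- x) = - adj (x::'a::cstar_normed_algebra)"
  using adj_scaleR[of "-1" x] by simp

lemma adj_diff: "adj (x - y) = adj x - adj (y::'a::cstar_normed_algebra)"
  using adj_add[of x "- y"] by (simp add: adj_uminus)

lemma norm_le_norm_adj: "norm x \<le> norm (adj (x::'a::cstar_normed_algebra))"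
proof (cases "norm x = 0")
  case False
  have "norm x * norm x \<le> norm (adj x) * norm x"
    using norm_adj_mult[of x] norm_mult_ineq[of "adj x" x] by (simp add: power2_eq_square)
  then show ?thesis using False by (simp add: mult_le_cancel_right)
qed simp

lemma norm_adj [simp]: "norm (adj x) = norm (x::'a::cstar_normed_algebra)"
  using norm_le_norm_adj[of x] norm_le_norm_adj[of "adj x"] by simp

definition projection :: "'a::cstar_normed_algebra \<Rightarrow> bool" where
  "projection p \<longleftrightarrow> adj p = p \<and> p * p = p"

lemma projection_norm_le:
  assumes "projection p"
  shows "norm p \<le> 1"
proof -
  have "norm p * norm p \<le> 1 * norm p"
    using norm_adj_mult[of p] assms by (simp add: projection_def power2_eq_square)
  then show ?thesis by (cases "norm p = 0") (auto simp: mult_le_cancel_right)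
qed

text \<open>
  Comparing \<open>p\<close> with \<open>p\<^sup>2\<close>.  This is how two projections, one below the other, are recognised as equal
  as soon as they are close.
\<close>

lemma projection_eq_0:
  assumes "projection p" "norm p < 1"
  shows "p = 0"
proof (rule ccontr)
  assume "p \<noteq> 0"
  then have "norm p * norm p < 1 * norm p" using assms(2) by (intro mult_strict_right_mono) auto
  then show False using norm_mult_ineq[of p p] assms(1) by (simp add: projection_def)
qed

lemma partial_isometry_norm_le:
  assumes "projection (adj v * v)"
  shows "norm v \<le> 1"
proof -
  have "(norm v)\<^sup>2 \<le> 1" using norm_adj_mult[of v] projection_norm_le[OF assms] by linarith
  then show ?thesis by (simp add: power_le_one_iff)
qed

text \<open>
  Real polynomials without constant term in an element of such a set stay in the set; this is all the
  closure that the functional calculus below requires.  Annihilators and corners are of this kind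
  although they contain no unit.
\<close>

definition real_subalgebra :: "'a::cstar_normed_algebra set \<Rightarrow> bool" where
  "real_subalgebra S \<longleftrightarrow>
     (\<forall>x\<in>S. \<forall>y\<in>S. x + y \<in> S) \<and> (\<forall>c. \<forall>x\<in>S. c *\<^sub>R x \<in> S) \<and> (\<forall>x\<in>S. \<forall>y\<in>S. x * y \<in> S)"

text \<open>
  A finite spectral decomposition.  The coefficients may vanish or coincide.
\<close>

definition diagonalizable :: "'a::cstar_normed_algebra \<Rightarrow> bool" where
  "diagonalizable h \<longleftrightarrow> (\<exists>N l e.
     (\<forall>i<N. projection (e i) \<and> e i \<noteq> 0) \<and> (\<forall>i<N. \<forall>j<N. i \<noteq> j \<longrightarrow> e i * e j = 0) \<and>
     h = (\<Sum>i<(N::nat). l i *\<^sub>R e i))"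

lemma real_subalgebraD:
  assumes "real_subalgebra S"
  shows "x \<in> S \<Longrightarrow> y \<in> S \<Longrightarrow> x + y \<in> S" "x \<in> S \<Longrightarrow> c *\<^sub>R x \<in> S"
    "x \<in> S \<Longrightarrow> y \<in> S \<Longrightarrow> x * y \<in> S" "x \<in> S \<Longrightarrow> y \<in> S \<Longrightarrow> x - y \<in> S" "x \<in> S \<Longrightarrow> 0 \<in> S"
proof -
  show a: "x + y \<in> S" if "x \<in> S" "y \<in> S" for x y using assms that by (auto simp: real_subalgebra_def)
  show c: "c *\<^sub>R x \<in> S" if "x \<in> S" for c x using assms that by (auto simp: real_subalgebra_def)
  show "x * y \<in> S" if "x \<in> S" "y \<in> S" using assms that by (auto simp: real_subalgebra_def)
  show "x - y \<in> S" if "x \<in> S" "y \<in> S" using a[OF that(1) c[OF that(2), of "-1"]] by simp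
  show "0 \<in> S" if "x \<in> S" using c[OF that, of 0] by simp
qed

lemma adj_sum: "adj (\<Sum>i\<in>I. f i :: 'a::cstar_normed_algebra) = (\<Sum>i\<in>I. adj (f i))"
  by (induction I rule: infinite_finite_induct) (auto simp: adj_add)

text \<open>
  The factor \<open>x\<close> keeps the interpolating polynomial free of a constant term, as there is no unit to
  multiply it with.
\<close>

lemma interpolation_vanishing_at_0:
  fixes f :: "real \<Rightarrow> real"
  assumes "finite X" "f 0 = 0"
  shows "\<exists>q. \<forall>x\<in>X. f x = x * poly q x"
  using assms(1)
proof (induction X rule: finite_induct)
  case (insert a X)
  then obtain q where q: "\<forall>x\<in>X. f x = x * poly q x" by auto
  show ?case
  proof (cases "a = 0")
    case True
    then show ?thesis using q assms(2) by (intro exI[of _ q]) auto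
  next
    case False
    define R where "R = (\<Prod>x\<in>X. [:- x, 1:])"
    have R: "poly R x = (\<Prod>y\<in>X. x - y)" for x by (simp add: R_def poly_prod)
    have "poly R a \<noteq> 0" unfolding R using insert by auto
    moreover have "poly R x = 0" if "x \<in> X" for x unfolding R using insert that by auto
    ultimately show ?thesis using False q
      by (intro exI[of _ "q + smult ((f a - a * poly q a) / (a * poly R a)) R"])
        (auto simp: field_simps)
  qed
qed simp

context
  fixes N :: nat and e :: "nat \<Rightarrow> 'a::cstar_normed_algebra"
  assumes proj: "\<And>i. i < N \<Longrightarrow> projection (e i)"
    and nonzero: "\<And>i. i < N \<Longrightarrow> e i \<noteq> 0"
    and orth: "\<And>i j. i < N \<Longrightarrow> j < N \<Longrightarrow> i \<noteq> j \<Longrightarrow> e i * e j = 0"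
begin

abbreviation "diag c \<equiv> (\<Sum>i<N. c i *\<^sub>R e i)"

lemma diag_mult_e: "j < N \<Longrightarrow> diag c * e j = c j *\<^sub>R e j"
proof -
  assume j: "j < N"
  have "diag c * e j = (\<Sum>i<N. if i = j then c j *\<^sub>R e j else 0)"
    unfolding sum_distrib_right using j proj orth by (intro sum.cong) (auto simp: projection_def)
  then show ?thesis using j by simp
qed

lemma diag_mult: "diag c * diag d = diag (\<lambda>i. c i * d i)"
proof -
  have "diag c * diag d = (\<Sum>j<N. d j *\<^sub>R (diag c * e j))" by (simp add: sum_distrib_left)
  also have "\<dots> = diag (\<lambda>i. c i * d i)"
    by (intro sum.cong) (auto simp: diag_mult_e mult.commute)
  finally show ?thesis .
qed

lemma adj_diag: "adj (diag c) = diag c"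
  unfolding adj_sum using proj by (intro sum.cong) (auto simp: adj_scaleR projection_def)

text \<open>
  The triangle inequality gives the case \<open>k = 0\<close>.  By the C*-inequality the square of the norm of a
  diagonal element is at most the norm of its square, which is diagonal too; repeated squaring thus
  makes the factor \<open>N\<close> harmless.
\<close>

lemma norm_diag_power_le:
  assumes "\<And>i. i < N \<Longrightarrow> \<bar>c i\<bar> \<le> M" "0 \<le> M"
  shows "norm (diag c) ^ (2 ^ k) \<le> real N * M ^ (2 ^ k)"
  using assms
proof (induction k arbitrary: c M)
  case 0
  have "norm (diag c) \<le> (\<Sum>i<N. M)"
  proof (rule sum_norm_le)
    fix i assume "i \<in> {..<N}"
    then have "\<bar>c i\<bar> * norm (e i) \<le> M * 1"
      using 0 projection_norm_le[OF proj] by (intro mult_mono) auto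
    then show "norm (c i *\<^sub>R e i) \<le> M" by simp
  qed
  then show ?case by simp
next
  case (Suc k)
  have "(norm (diag c))\<^sup>2 \<le> norm (diag (\<lambda>i. (c i)\<^sup>2))"
    using norm_adj_mult[of "diag c"] by (simp add: adj_diag diag_mult power2_eq_square)
  then have "((norm (diag c))\<^sup>2) ^ (2 ^ k) \<le> norm (diag (\<lambda>i. (c i)\<^sup>2)) ^ (2 ^ k)"
    by (intro power_mono) auto
  also have "\<dots> \<le> real N * (M\<^sup>2) ^ (2 ^ k)"
    using Suc.prems by (intro Suc.IH) (auto simp: abs_le_square_iff[symmetric])
  finally show ?case by (simp add: power_mult[symmetric])
qed

text \<open>
  The bound does not depend on the number of projections, hence not on the size of the matrices.
\<close>

lemma norm_diag_le:
  assumes "\<And>i. i < N \<Longrightarrow> \<bar>c i\<bar> \<le> M" "0 \<le> M"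
  shows "norm (diag c) \<le> M"
proof (rule ccontr)
  assume "\<not> ?thesis"
  then have gt: "norm (diag c) > M" by simp
  show False
  proof (cases "M = 0")
    case True
    then show False using norm_diag_power_le[OF assms, where k = 0] gt by simp
  next
    case False
    then have M: "M > 0" using assms by simp
    define t where "t = norm (diag c) / M"
    have t: "t > 1" using gt M by (simp add: t_def)
    then obtain k where k: "real N < t ^ k" using real_arch_pow by blast
    have "t ^ k \<le> t ^ (2 ^ k)" using t by (intro power_increasing) (auto simp: less_imp_le)
    also have "\<dots> \<le> real N"
      using norm_diag_power_le[OF assms, where k = k] M by (simp add: t_def power_divide pos_divide_le_eq)
    finally show False using k by simp
  qed
qed

lemma coeff_le_norm_diag:
  assumes j: "j < N"
  shows "\<bar>c j\<bar> \<le> norm (diag c)"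
proof -
  have e: "norm (e j) = 1"
    using projection_norm_le[OF proj[OF j]] projection_eq_0[OF proj[OF j]] nonzero[OF j] by force
  have "\<bar>c j\<bar> = norm (diag c * e j)" using j e by (simp add: diag_mult_e)
  also have "\<dots> \<le> norm (diag c)" using norm_mult_ineq[of "diag c" "e j"] e by simp
  finally show ?thesis .
qed

lemma diag_mem_real_subalgebra:
  fixes f :: "real \<Rightarrow> real"
  assumes S: "real_subalgebra S" and h: "diag l \<in> S" and f0: "f 0 = 0"
  shows "diag (\<lambda>i. f (l i)) \<in> S"
proof -
  have poly: "diag (\<lambda>i. l i * poly q (l i)) \<in> S" for q
  proof (induction q)
    case 0
    then show ?case using real_subalgebraD(5)[OF S h] by simp
  next
    case (pCons a q)
    have "diag (\<lambda>i. l i * poly (pCons a q) (l i))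
        = a *\<^sub>R diag l + diag l * diag (\<lambda>i. l i * poly q (l i))"
      unfolding diag_mult scaleR_sum_right sum.distrib[symmetric]
      by (intro sum.cong) (auto simp: distrib_left scaleR_add_left mult_ac)
    then show ?case using real_subalgebraD(1,2,3)[OF S] h pCons by simp
  qed
  obtain q where "\<forall>x\<in>l ` {..<N}. f x = x * poly q x"
    using interpolation_vanishing_at_0[of "l ` {..<N}" f] f0 by auto
  then have "diag (\<lambda>i. f (l i)) = diag (\<lambda>i. l i * poly q (l i))" by (intro sum.cong) auto
  then show ?thesis using poly by simp
qed

end

lemma inverse_sqrt_close:
  fixes l :: real
  assumes "l > 1/2"
  shows "\<bar>1 / sqrt l - 1\<bar> \<le> 2 * \<bar>l - 1\<bar>"
proof -
  define t where "t = sqrt l"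
  have t: "t > 0" "t * t = l" using assms by (auto simp: t_def)
  have "1 / 2 \<le> t * (1 + t)" using t assms by (simp add: distrib_left)
  then have "\<bar>1 - t\<bar> \<le> \<bar>1 - t\<bar> * (2 * (t * (1 + t)))"
    using mult_left_mono[of 1 "2 * (t * (1 + t))" "\<bar>1 - t\<bar>"] by simp
  also have "\<dots> = 2 * \<bar>(1 - t) * (1 + t)\<bar> * t" using t by (simp add: abs_mult)
  also have "(1 - t) * (1 + t) = 1 - l" using t by (simp add: algebra_simps)
  finally have "\<bar>1 - t\<bar> / t \<le> 2 * \<bar>1 - l\<bar>" using t by (simp add: pos_divide_le_eq)
  moreover have "\<bar>1 - t\<bar> / t = \<bar>1 / t - 1\<bar>" using t by (simp add: field_simps abs_divide[symmetric] abs_if)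
  ultimately show ?thesis by (simp add: t_def abs_minus_commute)
qed

text \<open>
  With \<open>\<eta> = \<parallel>h\<^sup>2 - h\<parallel>\<close> every eigenvalue \<open>l\<close> satisfies \<open>\<bar>l\<bar> \<bar>l - 1\<bar> \<le> \<eta>\<close>, so it is within \<open>2\<eta>\<close> of
  \<open>0\<close> or of \<open>1\<close>.  The projection \<open>p\<close> belongs to the eigenvalues above \<open>1/2\<close>, and \<open>s\<close> is the inverse square
  root of \<open>h\<close> on its range.
\<close>

lemma spectral_projection:
  fixes h :: "'a::cstar_normed_algebra"
  assumes "diagonalizable h"
  obtains p s where "projection p" "adj s = s" "s * h * s = p" "p * s = s" "s * p = s"
    "norm (h - p) \<le> 2 * norm (h * h - h)" "norm (s - p) \<le> 4 * norm (h * h - h)"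
    "\<And>S. real_subalgebra S \<Longrightarrow> h \<in> S \<Longrightarrow> p \<in> S" "\<And>S. real_subalgebra S \<Longrightarrow> h \<in> S \<Longrightarrow> s \<in> S"
proof -
  obtain N :: nat and l e where e: "\<And>i. i < N \<Longrightarrow> projection (e i)" "\<And>i. i < N \<Longrightarrow> e i \<noteq> 0"
    "\<And>i j. i < N \<Longrightarrow> j < N \<Longrightarrow> i \<noteq> j \<Longrightarrow> e i * e j = 0" and h: "h = (\<Sum>i<N. l i *\<^sub>R e i)"
    using assms unfolding diagonalizable_def by blast
  have mult: "(\<Sum>i<N. a i *\<^sub>R e i) * (\<Sum>i<N. b i *\<^sub>R e i) = (\<Sum>i<N. (a i * b i) *\<^sub>R e i)" for a b
    by (rule diag_mult) (use e in auto)
  have adj: "adj (\<Sum>i<N. a i *\<^sub>R e i) = (\<Sum>i<N. a i *\<^sub>R e i)" for a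
    by (rule adj_diag) (use e in auto)
  define f where "f = (\<lambda>x::real. if x > 1/2 then 1 else 0 :: real)"
  define g where "g = (\<lambda>x::real. if x > 1/2 then 1 / sqrt x else 0)"
  define p where "p = (\<Sum>i<N. f (l i) *\<^sub>R e i)"
  define s where "s = (\<Sum>i<N. g (l i) *\<^sub>R e i)"
  define \<eta> where "\<eta> = norm (h * h - h)"
  have "h * h - h = (\<Sum>i<N. (l i * l i - l i) *\<^sub>R e i)"
    unfolding h mult by (simp add: scaleR_diff_left sum_subtractf)
  then have eta: "\<bar>l i * l i - l i\<bar> \<le> \<eta>" if "i < N" for i
    using coeff_le_norm_diag[OF e that, where c = "\<lambda>i. l i * l i - l i"] that by (simp add: \<eta>_def)
  have lf: "\<bar>l i - f (l i)\<bar> \<le> 2 * \<eta>" if i: "i < N" for i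
  proof (cases "l i > 1/2")
    case True
    have "1/2 * \<bar>l i - 1\<bar> \<le> \<bar>l i\<bar> * \<bar>l i - 1\<bar>" using True by (intro mult_right_mono) auto
    also have "\<dots> \<le> \<eta>" using eta[OF i] by (simp add: abs_mult[symmetric] algebra_simps)
    finally show ?thesis using True by (simp add: f_def)
  next
    case False
    have "\<bar>l i\<bar> * (1/2) \<le> \<bar>l i\<bar> * \<bar>l i - 1\<bar>" using False by (intro mult_left_mono) auto
    also have "\<dots> \<le> \<eta>" using eta[OF i] by (simp add: abs_mult[symmetric] algebra_simps)
    finally show ?thesis using False by (simp add: f_def)
  qed
  have gf: "\<bar>g (l i) - f (l i)\<bar> \<le> 4 * \<eta>" if i: "i < N" for i
    using lf[OF i] inverse_sqrt_close[of "l i"] by (auto simp: f_def g_def split: if_splits)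
  have \<eta>0: "\<eta> \<ge> 0" by (simp add: \<eta>_def)
  show ?thesis
  proof (rule that[of p s])
    show "projection p"
      unfolding projection_def p_def adj mult by (auto intro!: sum.cong simp: f_def)
    show "adj s = s" unfolding s_def adj ..
    show "s * h * s = p"
      unfolding s_def h p_def mult by (intro sum.cong) (auto simp: f_def g_def)
    show "p * s = s" "s * p = s"
      unfolding s_def p_def mult by (auto intro!: sum.cong simp: f_def g_def)
    have "norm (\<Sum>i<N. (l i - f (l i)) *\<^sub>R e i) \<le> 2 * \<eta>"
      using norm_diag_le[OF e, where c = "\<lambda>i. l i - f (l i)" and M = "2 * \<eta>"] lf \<eta>0 by auto
    then show "norm (h - p) \<le> 2 * norm (h * h - h)"
      unfolding \<eta>_def[symmetric] by (simp add: h p_def scaleR_diff_left sum_subtractf)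
    have "norm (\<Sum>i<N. (g (l i) - f (l i)) *\<^sub>R e i) \<le> 4 * \<eta>"
      using norm_diag_le[OF e, where c = "\<lambda>i. g (l i) - f (l i)" and M = "4 * \<eta>"] gf \<eta>0 by auto
    then show "norm (s - p) \<le> 4 * norm (h * h - h)"
      unfolding \<eta>_def[symmetric] by (simp add: s_def p_def scaleR_diff_left sum_subtractf)
    show "p \<in> S" "s \<in> S" if "real_subalgebra S" "h \<in> S" for S
      using diag_mem_real_subalgebra[OF e that(1), where l = l and f = f]
        diag_mem_real_subalgebra[OF e that(1), where l = l and f = g] that(2)
      by (auto simp: p_def s_def f_def g_def h)
  qed
qed

text \<open>
  The partial isometry \<open>w s\<close> is the polar part of \<open>w\<close>, with \<open>s = (w*w)\<^bsup>-1/2\<^esup>\<close> formed in the corner of \<open>q\<close>.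
  That \<open>s\<close> lies in every real subalgebra containing \<open>w*w\<close> is what later keeps \<open>w s\<close> inside the nest
  algebra.
\<close>

lemma normalize:
  fixes w q :: "'a::cstar_normed_algebra"
  assumes q: "projection q" and wq: "w * q = w" and dg: "diagonalizable (adj w * w)"
    and small: "norm (adj w * w - q) \<le> 1/8"
  obtains s where "adj s = s" "s * q = s" "q * s = s" "adj (w * s) * (w * s) = q"
    "norm (w * s - w) \<le> 8 * norm w * norm (adj w * w - q)"
    "\<And>S. real_subalgebra S \<Longrightarrow> adj w * w \<in> S \<Longrightarrow> s \<in> S"
proof -
  define h where "h = adj w * w"
  define \<eta> where "\<eta> = norm (h - q)"
  obtain p s where ps: "projection p" "adj s = s" "s * h * s = p" "p * s = s" "s * p = s"
    "norm (h - p) \<le> 2 * norm (h * h - h)" "norm (s - p) \<le> 4 * norm (h * h - h)"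
    "\<And>S. real_subalgebra S \<Longrightarrow> h \<in> S \<Longrightarrow> p \<in> S" "\<And>S. real_subalgebra S \<Longrightarrow> h \<in> S \<Longrightarrow> s \<in> S"
    using spectral_projection[OF dg[folded h_def]] by metis
  have qs: "adj q = q" "q * q = q" using q by (auto simp: projection_def)
  have hq: "h * q = h" using wq by (simp add: h_def mult.assoc)
  have qh: "q * h = h" using arg_cong[OF wq, of adj] by (simp add: h_def adj_mult qs mult.assoc[symmetric])
  \<comment> \<open>The bound \<open>1/8\<close> is used twice: it gives \<open>\<parallel>h\<parallel> \<le> 2\<close> here and \<open>5\<eta> < 1\<close> below.\<close>
  have "norm h \<le> norm (h - q) + norm q" using norm_triangle_ineq[of "h - q" q] by simp
  then have h2: "norm h \<le> 2" using small projection_norm_le[OF q] by (simp add: h_def)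
  have "h * h - h = h * (h - q)" using hq by (simp add: right_diff_distrib)
  then have "norm (h * h - h) \<le> norm h * \<eta>" by (simp add: norm_mult_ineq \<eta>_def)
  also have "\<dots> \<le> 2 * \<eta>" using h2 by (intro mult_right_mono) (auto simp: \<eta>_def)
  finally have hh: "norm (h * h - h) \<le> 2 * \<eta>" .
  define T where "T = {x. x * q = x \<and> q * x = x}"
  have T: "real_subalgebra T"
    unfolding real_subalgebra_def T_def by (auto simp: distrib_left distrib_right mult.assoc)
      (simp add: mult.assoc[symmetric])
  have hT: "h \<in> T" using hq qh by (simp add: T_def)
  have pT: "p * q = p" "q * p = p" and sT: "s * q = s" "q * s = s"
    using ps(8,9)[OF T hT] by (auto simp: T_def)
  have "norm (q - p) \<le> norm (h - q) + norm (h - p)"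
    using norm_triangle_ineq4[of "h - p" "h - q"] by simp
  also have "\<dots> \<le> 5 * \<eta>" using ps(6) hh by (simp add: \<eta>_def)
  finally have "norm (q - p) < 1" using small by (simp add: \<eta>_def h_def)
  moreover have "projection (q - p)"
    using ps(1) pT qs by (simp add: projection_def adj_diff algebra_simps)
  ultimately have pq: "q = p" using projection_eq_0[of "q - p"] by simp
  show ?thesis
  proof (rule that[of s])
    show "adj s = s" "s * q = s" "q * s = s" by (fact ps sT)+
    show "adj (w * s) * (w * s) = q"
      using ps(3) by (simp add: adj_mult ps(2) pq h_def mult.assoc)
    have "w * s - w = w * (s - q)" using wq by (simp add: right_diff_distrib)
    then have "norm (w * s - w) \<le> norm w * norm (s - q)" by (simp add: norm_mult_ineq)
    also have "\<dots> \<le> norm w * (8 * \<eta>)"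
      using ps(7) hh pq by (intro mult_left_mono) auto
    finally show "norm (w * s - w) \<le> 8 * norm w * norm (adj w * w - q)"
      by (simp add: \<eta>_def h_def)
    show "s \<in> S" if "real_subalgebra S" "adj w * w \<in> S" for S
      using ps(9) that by (simp add: h_def)
  qed
qed

section \<open>Asymptotic equality along a filter\<close>

text \<open>
  A point of the filter is one instance of the perturbation problem.  Functions on the instances are
  compared modulo functions that tend to \<open>0\<close>; this relation respects sums, adjoints and products of
  bounded functions.
\<close>

locale asymptotic =
  fixes F :: "'c filter"
begin

definition asymp_eq :: "('c \<Rightarrow> 'a::cstar_normed_algebra) \<Rightarrow> ('c \<Rightarrow> 'a) \<Rightarrow> bool" (infix "\<approx>" 50) where
  "X \<approx> Y \<longleftrightarrow> Zfun (\<lambda>c. X c - Y c) F"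

abbreviation bdd :: "('c \<Rightarrow> 'a::cstar_normed_algebra) \<Rightarrow> bool" where
  "bdd X \<equiv> Bfun X F"

lemma asymp_refl [simp, intro]: "X \<approx> X"
  by (simp add: asymp_eq_def Zfun_zero)

lemma asymp_sym: "X \<approx> Y \<Longrightarrow> Y \<approx> X"
  unfolding asymp_eq_def using Zfun_minus by fastforce

lemma asymp_trans [trans]: "X \<approx> Y \<Longrightarrow> Y \<approx> Z \<Longrightarrow> X \<approx> Z"
  unfolding asymp_eq_def using Zfun_add by fastforce

lemma asymp_add: "X \<approx> X' \<Longrightarrow> Y \<approx> Y' \<Longrightarrow> (\<lambda>c. X c + Y c) \<approx> (\<lambda>c. X' c + Y' c)"
  unfolding asymp_eq_def by (drule (1) Zfun_add) (simp add: algebra_simps)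

lemma asymp_diff: "X \<approx> X' \<Longrightarrow> Y \<approx> Y' \<Longrightarrow> (\<lambda>c. X c - Y c) \<approx> (\<lambda>c. X' c - Y' c)"
  unfolding asymp_eq_def by (drule (1) Zfun_diff) (simp add: algebra_simps)

lemma asymp_sum:
  "(\<And>i. i \<in> I \<Longrightarrow> X i \<approx> Y i) \<Longrightarrow> (\<lambda>c. \<Sum>i\<in>I. X i c) \<approx> (\<lambda>c. \<Sum>i\<in>I. Y i c)"
  by (induction I rule: infinite_finite_induct) (auto intro: asymp_add)

lemma asymp_adj: "X \<approx> Y \<Longrightarrow> (\<lambda>c. adj (X c)) \<approx> (\<lambda>c. adj (Y c))"
  unfolding asymp_eq_def adj_diff[symmetric] by (subst (asm) Zfun_norm_iff[symmetric], subst Zfun_norm_iff[symmetric]) simp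

lemma asymp_scaleR: "X \<approx> Y \<Longrightarrow> (\<lambda>c. k *\<^sub>R X c) \<approx> (\<lambda>c. k *\<^sub>R Y c)"
  unfolding asymp_eq_def scaleR_diff_right[symmetric] by (rule bounded_linear.Zfun[OF bounded_linear_scaleR_right])

lemma bdd_asymp: "X \<approx> Y \<Longrightarrow> bdd Y \<Longrightarrow> bdd X"
proof -
  assume "X \<approx> Y" "bdd Y"
  then obtain K where K: "K > 0" "\<forall>\<^sub>F c in F. norm (Y c) \<le> K" by (auto elim!: BfunE)
  have "\<forall>\<^sub>F c in F. norm (X c - Y c) < 1"
    using \<open>X \<approx> Y\<close> by (simp add: asymp_eq_def Zfun_def)
  then have "\<forall>\<^sub>F c in F. norm (X c) \<le> K + 1"
    using K(2)
  proof eventually_elim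
    case (elim c)
    then show ?case using norm_triangle_ineq[of "X c - Y c" "Y c"] by simp
  qed
  then show ?thesis by (rule BfunI)
qed

lemma bdd_mult: "bdd X \<Longrightarrow> bdd Y \<Longrightarrow> bdd (\<lambda>c. X c * Y c)"
proof -
  assume "bdd X" "bdd Y"
  then obtain K L where K: "K > 0" "\<forall>\<^sub>F c in F. norm (X c) \<le> K" and L: "\<forall>\<^sub>F c in F. norm (Y c) \<le> L"
    by (auto elim!: BfunE)
  show ?thesis
    by (rule BfunI[where K = "K * L"], rule eventually_mono[OF eventually_conj[OF K(2) L]])
      (use K(1) in \<open>auto intro!: order_trans[OF norm_mult_ineq] mult_mono\<close>)
qed

lemma bdd_adj: "bdd X \<Longrightarrow> bdd (\<lambda>c. adj (X c))"
  by (simp add: Bfun_def)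

lemma bdd_norm_le_1: "(\<And>c. norm (X c) \<le> 1) \<Longrightarrow> bdd X"
  by (rule BfunI[where K = 1]) auto

lemma asymp_mult:
  assumes "X \<approx> X'" "Y \<approx> Y'" "bdd X" "bdd Y'"
  shows "(\<lambda>c. X c * Y c) \<approx> (\<lambda>c. X' c * Y' c)"
proof -
  have "Zfun (\<lambda>c. X c * (Y c - Y' c)) F"
    using assms unfolding asymp_eq_def
    by (intro bounded_bilinear.Bfun_prod_Zfun[OF bounded_bilinear_mult])
  moreover have "Zfun (\<lambda>c. (X c - X' c) * Y' c) F"
    using assms unfolding asymp_eq_def
    by (intro bounded_bilinear.Zfun_prod_Bfun[OF bounded_bilinear_mult])
  ultimately have "Zfun (\<lambda>c. X c * (Y c - Y' c) + (X c - X' c) * Y' c) F" by (rule Zfun_add)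
  then show ?thesis by (simp add: asymp_eq_def algebra_simps)
qed

lemma asymp_mult_left: "Y \<approx> Y' \<Longrightarrow> bdd X \<Longrightarrow> (\<lambda>c. X c * Y c) \<approx> (\<lambda>c. X c * Y' c)"
  unfolding asymp_eq_def right_diff_distrib[symmetric]
  by (rule bounded_bilinear.Bfun_prod_Zfun[OF bounded_bilinear_mult])

lemma asymp_mult_right: "X \<approx> X' \<Longrightarrow> bdd Y \<Longrightarrow> (\<lambda>c. X c * Y c) \<approx> (\<lambda>c. X' c * Y c)"
  unfolding asymp_eq_def left_diff_distrib[symmetric]
  by (rule bounded_bilinear.Zfun_prod_Bfun[OF bounded_bilinear_mult])

lemma asymp_by_norm_bound:
  assumes "U \<approx> V" "\<And>c. norm (X c - Y c) \<le> K * norm (U c - V c)"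
  shows "X \<approx> Y"
  using assms(1) unfolding asymp_eq_def
  by (rule Zfun_imp_Zfun[where K = K]) (use assms(2) in \<open>auto simp: mult.commute\<close>)

lemma asymp_eventually_norm_less:
  assumes "X \<approx> Y" "0 < \<epsilon>"
  shows "\<forall>\<^sub>F c in F. norm (X c - Y c) < \<epsilon>"
  using assms by (simp add: asymp_eq_def Zfun_def)

lemma asymptotic_projection:
  assumes dg: "\<And>c. diagonalizable (H c)" and H: "H \<approx> G" and G: "\<And>c. projection (G c)"
  obtains P where "\<And>c. projection (P c)" "P \<approx> G"
    "\<And>c S. real_subalgebra S \<Longrightarrow> H c \<in> S \<Longrightarrow> P c \<in> S"
proof -
  have "\<exists>p. projection p \<and> norm (H c - p) \<le> 2 * norm (H c * H c - H c) \<and>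
      (\<forall>S. real_subalgebra S \<longrightarrow> H c \<in> S \<longrightarrow> p \<in> S)" for c
    by (rule spectral_projection[OF dg[of c]]) blast
  then obtain P where P: "\<And>c. projection (P c)"
    "\<And>c. norm (H c - P c) \<le> 2 * norm (H c * H c - H c)"
    "\<And>c S. real_subalgebra S \<Longrightarrow> H c \<in> S \<Longrightarrow> P c \<in> S" by metis
  have bG: "bdd G" using projection_norm_le[OF G] by (intro bdd_norm_le_1)
  have "(\<lambda>c. H c * H c) \<approx> (\<lambda>c. G c * G c)"
    by (rule asymp_mult[OF H H bdd_asymp[OF H bG] bG])
  also have "(\<lambda>c. G c * G c) = G" using G by (simp add: projection_def)
  also have "G \<approx> H" by (rule asymp_sym[OF H])
  finally have "(\<lambda>c. H c * H c) \<approx> H" .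
  then have "H \<approx> P" by (rule asymp_by_norm_bound[OF _ P(2)])
  then show ?thesis using that[of P] P H asymp_trans asymp_sym by blast
qed

lemma asymptotic_normalize:
  assumes dg: "\<And>c. diagonalizable (adj (W c) * W c)" and q: "\<And>c. projection (q c)"
    and Wq: "\<And>c. W c * q c = W c" and WW: "(\<lambda>c. adj (W c) * W c) \<approx> q" and bW: "bdd W"
  obtains s where "\<And>c. adj (s c) = s c" "(\<lambda>c. W c * s c) \<approx> W"
    "\<forall>\<^sub>F c in F. adj (W c * s c) * (W c * s c) = q c"
    "\<And>c S. real_subalgebra S \<Longrightarrow> adj (W c) * W c \<in> S \<Longrightarrow> s c \<in> S"
proof -
  have "\<exists>s. adj s = s \<and> (norm (adj (W c) * W c - q c) \<le> 1/8 \<longrightarrow> adj (W c * s) * (W c * s) = q c \<and>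
        norm (W c * s - W c) \<le> 8 * norm (W c) * norm (adj (W c) * W c - q c)) \<and>
      (\<forall>S. real_subalgebra S \<longrightarrow> adj (W c) * W c \<in> S \<longrightarrow> s \<in> S)" for c
  proof (cases "norm (adj (W c) * W c - q c) \<le> 1/8")
    case True
    show ?thesis by (rule normalize[OF q Wq dg True]) blast
  next
    case False
    then show ?thesis using real_subalgebraD(5) by (intro exI[of _ 0]) auto
  qed
  then obtain s where s: "\<And>c. adj (s c) = s c"
    "\<And>c. norm (adj (W c) * W c - q c) \<le> 1/8 \<Longrightarrow> adj (W c * s c) * (W c * s c) = q c"
    "\<And>c. norm (adj (W c) * W c - q c) \<le> 1/8 \<Longrightarrow>
      norm (W c * s c - W c) \<le> 8 * norm (W c) * norm (adj (W c) * W c - q c)"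
    "\<And>c S. real_subalgebra S \<Longrightarrow> adj (W c) * W c \<in> S \<Longrightarrow> s c \<in> S" by metis
  have small: "\<forall>\<^sub>F c in F. norm (adj (W c) * W c - q c) \<le> 1/8"
    using asymp_eventually_norm_less[OF WW, of "1/8"] by (auto elim: eventually_mono)
  obtain K where K: "K > 0" "\<forall>\<^sub>F c in F. norm (W c) \<le> K" using bW by (auto elim!: BfunE)
  have "\<forall>\<^sub>F c in F. norm (W c * s c - W c) \<le> norm (adj (W c) * W c - q c) * (8 * K)"
    using small K(2)
  proof eventually_elim
    case (elim c)
    have "8 * norm (W c) * norm (adj (W c) * W c - q c) \<le> 8 * K * norm (adj (W c) * W c - q c)"
      using elim(2) by (intro mult_right_mono) auto
    then show ?case using s(3)[OF elim(1)] by (simp add: mult_ac)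
  qed
  then have "(\<lambda>c. W c * s c) \<approx> W"
    using WW unfolding asymp_eq_def by (rule Zfun_imp_Zfun[rotated])
  moreover have "\<forall>\<^sub>F c in F. adj (W c * s c) * (W c * s c) = q c"
    using small s(2) by (auto elim: eventually_mono)
  ultimately show ?thesis using that[of s] s by blast
qed

text \<open>
  The final projection of \<open>V\<close> lies below \<open>p\<close> and is asymptotic to it, so the two agree eventually.
\<close>

lemma asymptotic_coisometry:
  assumes "\<And>c. projection (p c)" "\<And>c. p c * V c = V c" "\<And>c. V c * q c = V c"
    and VV: "\<forall>\<^sub>F c in F. adj (V c) * V c = q c"
    and "V \<approx> Y" "bdd Y" "(\<lambda>c. Y c * adj (Y c)) \<approx> p"
  shows "\<forall>\<^sub>F c in F. V c * adj (V c) = p c"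
proof -
  have "(\<lambda>c. V c * adj (V c)) \<approx> (\<lambda>c. Y c * adj (Y c))"
    using assms by (intro asymp_mult asymp_adj bdd_adj) (auto intro: bdd_asymp)
  also have "\<dots> \<approx> p" by fact
  finally have "\<forall>\<^sub>F c in F. norm (V c * adj (V c) - p c) < 1" by (rule asymp_eventually_norm_less) simp
  with VV show ?thesis
  proof eventually_elim
    case (elim c)
    have p: "adj (p c) = p c" "p c * p c = p c" using assms(1) by (auto simp: projection_def)
    have "adj (V c) * p c = adj (p c * V c)" by (simp add: adj_mult p)
    then have "adj (V c) * p c = adj (V c)" using assms(2) by simp
    moreover have "V c * adj (V c) * (V c * adj (V c)) = V c * adj (V c)"
      using elim(1) assms(3) by (metis mult.assoc)
    ultimately have "projection (p c - V c * adj (V c))"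
      using p assms(2)[of c] unfolding projection_def
      by (simp add: adj_diff adj_mult right_diff_distrib left_diff_distrib mult.assoc mult.assoc[symmetric, of "p c"])
    moreover have "norm (p c - V c * adj (V c)) < 1" using elim(2) by (simp add: norm_minus_commute)
    ultimately show ?case using projection_eq_0 by fastforce
  qed
qed

end

section \<open>Nests of projections\<close>

text \<open>
  In the application \<open>M c\<close> is \<open>M\<^sub>n\<close>, \<open>C c\<close> is the image of the full matrix algebra that contains the
  second nest algebra, and \<open>E l c\<close> is the image of its \<open>l\<close>-th nest projection, so that \<open>E r c\<close> is the unit of
  \<open>C c\<close>.
\<close>

locale asymptotic_nest = asymptotic F
  for F :: "'c filter" +
  fixes M C :: "'c \<Rightarrow> 'a::cstar_normed_algebra set" and E :: "nat \<Rightarrow> 'c \<Rightarrow> 'a" and r :: nat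
  assumes M_alg: "\<And>c. real_subalgebra (M c)" and M_adj: "\<And>c x. x \<in> M c \<Longrightarrow> adj x \<in> M c"
    and M_diagonalizable: "\<And>c h. h \<in> M c \<Longrightarrow> adj h = h \<Longrightarrow> diagonalizable h"
    and C_sub_M: "\<And>c. C c \<subseteq> M c"
    and C_alg: "\<And>c. real_subalgebra (C c)" and C_adj: "\<And>c x. x \<in> C c \<Longrightarrow> adj x \<in> C c"
    and E_in_C: "\<And>l c. l \<le> r \<Longrightarrow> E l c \<in> C c"
    and E_adj: "\<And>l c. l \<le> r \<Longrightarrow> adj (E l c) = E l c"
    and E_mult: "\<And>k l c. k \<le> l \<Longrightarrow> l \<le> r \<Longrightarrow> E k c * E l c = E k c"
    and E_0: "\<And>c. E 0 c = 0" and E_r: "\<And>c x. x \<in> C c \<Longrightarrow> x * E r c = x"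
begin

text \<open>
  \<open>B\<close> is the image of the nest algebra itself, \<open>D\<close> its block diagonal part and \<open>Q l\<close> the projection of
  its \<open>l\<close>-th block.
\<close>

definition B :: "'c \<Rightarrow> 'a set" where
  "B c = {x \<in> C c. \<forall>l\<le>r. E l c * (x * E l c) = x * E l c}"

definition D :: "'c \<Rightarrow> 'a set" where
  "D c = {x \<in> C c. \<forall>l\<le>r. E l c * x = x * E l c}"

abbreviation Q :: "nat \<Rightarrow> 'c \<Rightarrow> 'a" where
  "Q l c \<equiv> E (Suc l) c - E l c"

lemma E_mult': "k \<le> l \<Longrightarrow> l \<le> r \<Longrightarrow> E l c * E k c = E k c"
  using arg_cong[OF E_mult[of k l c], of adj] by (simp add: adj_mult E_adj)

lemma E_idem [simp]: "l \<le> r \<Longrightarrow> E l c * E l c = E l c"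
  by (rule E_mult) auto

lemma E_bdd: "l \<le> r \<Longrightarrow> bdd (E l)"
  by (intro bdd_norm_le_1 projection_norm_le) (auto simp: projection_def E_adj)

lemma Q_E: "k \<le> r \<Longrightarrow> l < r \<Longrightarrow> Q l c * E k c = (if l < k then Q l c else 0)"
  by (auto simp: left_diff_distrib E_mult E_mult' Suc_le_eq)

lemma E_Q: "k \<le> r \<Longrightarrow> l < r \<Longrightarrow> E k c * Q l c = (if l < k then Q l c else 0)"
  by (auto simp: right_diff_distrib E_mult E_mult' Suc_le_eq)

lemma Q_adj: "l < r \<Longrightarrow> adj (Q l c) = Q l c"
  by (simp add: adj_diff E_adj)

lemma Q_idem: "l < r \<Longrightarrow> Q l c * Q l c = Q l c"
  by (simp add: right_diff_distrib[of "Q l c"] Q_E)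

lemma Q_in_C: "l < r \<Longrightarrow> Q l c \<in> C c"
  by (intro real_subalgebraD(4)[OF C_alg] E_in_C) auto

lemma Q_bdd: "l < r \<Longrightarrow> bdd (Q l)"
  by (intro bdd_norm_le_1 projection_norm_le) (simp add: projection_def Q_adj Q_idem)

lemma B_alg: "real_subalgebra (B c)"
  unfolding real_subalgebra_def
proof (intro conjI ballI allI)
  fix x y assume xy: "x \<in> B c" "y \<in> B c"
  show "x + y \<in> B c" using xy real_subalgebraD(1)[OF C_alg] by (auto simp: B_def distrib_left distrib_right)
  have "E l c * (x * y * E l c) = x * y * E l c" if "l \<le> r" for l
  proof -
    have yE: "E l c * (y * E l c) = y * E l c" and xE: "E l c * (x * E l c) = x * E l c"
      using xy that by (auto simp: B_def)
    have "E l c * (x * y * E l c) = E l c * (x * E l c) * (y * E l c)"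
      using yE by (simp add: mult.assoc)
    also have "\<dots> = x * (E l c * (y * E l c))" unfolding xE by (simp add: mult.assoc)
    also have "\<dots> = x * y * E l c" unfolding yE by (simp add: mult.assoc)
    finally show ?thesis .
  qed
  then show "x * y \<in> B c" using xy real_subalgebraD(3)[OF C_alg] by (auto simp: B_def)
next
  fix k x assume "x \<in> B c"
  then show "k *\<^sub>R x \<in> B c" using real_subalgebraD(2)[OF C_alg] by (auto simp: B_def)
qed

lemma D_alg: "real_subalgebra (D c)"
  unfolding real_subalgebra_def
proof (intro conjI ballI allI)
  fix x y assume xy: "x \<in> D c" "y \<in> D c"
  show "x + y \<in> D c" using xy real_subalgebraD(1)[OF C_alg] by (auto simp: D_def distrib_left distrib_right)
  have "E l c * (x * y) = x * y * E l c" if "l \<le> r" for l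
    using xy that by (simp add: D_def) (metis mult.assoc)
  then show "x * y \<in> D c" using xy real_subalgebraD(3)[OF C_alg] by (auto simp: D_def)
next
  fix k x assume "x \<in> D c"
  then show "k *\<^sub>R x \<in> D c" using real_subalgebraD(2)[OF C_alg] by (auto simp: D_def)
qed

lemma D_adj: "x \<in> D c \<Longrightarrow> adj x \<in> D c"
proof -
  assume x: "x \<in> D c"
  have "E l c * adj x = adj x * E l c" if "l \<le> r" for l
  proof -
    have "adj (x * E l c) = adj (E l c * x)" using x that by (simp add: D_def)
    then show ?thesis using that by (simp only: adj_mult E_adj)
  qed
  then show ?thesis using x C_adj by (auto simp: D_def)
qed

lemma D_sub_B: "D c \<subseteq> B c"
proof
  fix x assume x: "x \<in> D c"
  have "E l c * (x * E l c) = x * E l c" if "l \<le> r" for l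
    using x that by (simp add: D_def mult.assoc[symmetric]) (simp add: mult.assoc)
  then show "x \<in> B c" using x by (auto simp: B_def D_def)
qed

lemma B_sub_C: "B c \<subseteq> C c" and D_sub_C: "D c \<subseteq> C c"
  by (auto simp: B_def D_def)

lemma E_in_D: "l \<le> r \<Longrightarrow> E l c \<in> D c"
  using E_in_C by (auto simp: D_def) (metis E_mult E_mult' nat_le_linear)

lemma Q_in_D: "l < r \<Longrightarrow> Q l c \<in> D c"
  by (intro real_subalgebraD(4)[OF D_alg] E_in_D) auto

lemma corner_alg: "real_subalgebra {x \<in> C c. Q l c * x = x \<and> x * Q l c = x}"
  unfolding real_subalgebra_def
  using real_subalgebraD(1,2,3)[OF C_alg, of _ c]
  by (auto simp: distrib_left distrib_right mult.assoc)
     (simp add: mult.assoc[symmetric])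

lemma corner_sub_D:
  assumes l: "l < r" and x: "x \<in> C c" "Q l c * x = x" "x * Q l c = x"
  shows "x \<in> D c"
proof -
  have "E k c * x = x * E k c" if "k \<le> r" for k
  proof -
    have "E k c * x = E k c * Q l c * x" using x by (simp add: mult.assoc)
    also have "\<dots> = (if l < k then x else 0)" using E_Q[OF that l] x by simp
    also have "\<dots> = x * (Q l c * E k c)" using Q_E[OF that l] x by simp
    also have "\<dots> = x * E k c" using x by (simp add: mult.assoc[symmetric])
    finally show ?thesis .
  qed
  then show ?thesis using x by (simp add: D_def)
qed

lemma strictly_upper_in_B:
  assumes l: "l < r" and x: "x \<in> C c" "E l c * x = x" "x * Q l c = x"
  shows "x \<in> B c"
proof -
  have "E k c * (x * E k c) = x * E k c" if k: "k \<le> r" for k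
  proof -
    have xE: "x * E k c = (if l < k then x else 0)"
      using Q_E[OF k l, of c] x(3) by (metis mult.assoc mult_zero_right)
    have "E k c * x = x" if "l < k"
      using E_mult'[of l k c] that k x(2) by (metis less_imp_le mult.assoc)
    then show ?thesis unfolding xE by simp
  qed
  then show ?thesis using x by (simp add: B_def)
qed

text \<open>
  Closeness of \<open>X\<close> and of \<open>X*\<close> to \<open>B\<close> gives \<open>X E \<approx> E X E \<approx> E X\<close> for the nest projections.  Hence
  the off-diagonal blocks of \<open>X\<close> tend to \<open>0\<close>, and adding up the diagonal blocks of an approximant in
  \<open>B\<close> gives an approximant in \<open>D\<close>.
\<close>

lemma asymptotic_diagonal:
  assumes Y: "\<And>c. Y c \<in> B c" "Y \<approx> X" and Z: "\<And>c. Z c \<in> B c" "Z \<approx> (\<lambda>c. adj (X c))" and bX: "bdd X"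
  obtains W where "\<And>c. W c \<in> D c" "W \<approx> X"
proof -
  have XE: "(\<lambda>c. E l c * X c) \<approx> (\<lambda>c. X c * E l c)" if l: "l \<le> r" for l
  proof -
    have bE: "bdd (E l)" using E_bdd[OF l] .
    have half: "(\<lambda>c. E l c * (X' c * E l c)) \<approx> (\<lambda>c. X' c * E l c)"
      if "\<And>c. Y' c \<in> B c" "Y' \<approx> X'" for Y' X'
    proof -
      have e: "(\<lambda>c. X' c * E l c) \<approx> (\<lambda>c. Y' c * E l c)"
        using that(2) bE by (intro asymp_mult_right) (auto intro: asymp_sym)
      have "(\<lambda>c. E l c * (X' c * E l c)) \<approx> (\<lambda>c. E l c * (Y' c * E l c))"
        by (intro asymp_mult_left e bE)
      also have "\<dots> = (\<lambda>c. Y' c * E l c)" using that(1) l by (auto simp: B_def)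
      also have "\<dots> \<approx> (\<lambda>c. X' c * E l c)" by (rule asymp_sym[OF e])
      finally show ?thesis .
    qed
    have "(\<lambda>c. adj (adj (X c) * E l c)) \<approx> (\<lambda>c. adj (E l c * (adj (X c) * E l c)))"
      by (intro asymp_adj asymp_sym[OF half[OF Z]])
    then have "(\<lambda>c. E l c * X c) \<approx> (\<lambda>c. E l c * (X c * E l c))"
      by (simp add: adj_mult E_adj[OF l] mult.assoc)
    also have "\<dots> \<approx> (\<lambda>c. X c * E l c)" by (rule half[OF Y])
    finally show ?thesis .
  qed
  have "\<exists>W. (\<forall>c. W c \<in> D c) \<and> W \<approx> (\<lambda>c. X c * E l c)" if "l \<le> r" for l
    using that
  proof (induction l)
    case 0
    have "0 \<in> D c" for c using real_subalgebraD(5)[OF D_alg E_in_D] by blast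
    then show ?case by (intro exI[of _ "\<lambda>c. 0"]) (auto simp: E_0)
  next
    case (Suc l)
    then have l: "l < r" by simp
    obtain W where W: "\<And>c. W c \<in> D c" "W \<approx> (\<lambda>c. X c * E l c)" using Suc by auto
    have "Q l c * Y c * Q l c \<in> D c" for c
      using Y(1) B_sub_C Q_in_C[OF l] Q_idem[OF l] l
      by (intro corner_sub_D[OF l] real_subalgebraD(3)[OF C_alg])
        (auto simp: mult.assoc Q_idem[OF l]; simp add: mult.assoc[symmetric] Q_idem[OF l])+
    then have D: "W c + Q l c * Y c * Q l c \<in> D c" for c
      using W by (intro real_subalgebraD(1)[OF D_alg]) auto
    have bQ: "bdd (Q l)" by (rule Q_bdd[OF l])
    have "(\<lambda>c. Q l c * Y c * Q l c) \<approx> (\<lambda>c. Q l c * X c * Q l c)"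
      by (intro asymp_mult_right asymp_mult_left Y bQ)
    also have "(\<lambda>c. Q l c * X c * Q l c) \<approx> (\<lambda>c. X c * Q l c * Q l c)"
    proof (rule asymp_mult_right[OF _ bQ])
      show "(\<lambda>c. Q l c * X c) \<approx> (\<lambda>c. X c * Q l c)"
        unfolding left_diff_distrib right_diff_distrib using l by (intro asymp_diff XE) auto
    qed
    also have "(\<lambda>c. X c * Q l c * Q l c) = (\<lambda>c. X c * Q l c)" by (simp only: mult.assoc Q_idem[OF l])
    finally have "(\<lambda>c. W c + Q l c * Y c * Q l c) \<approx> (\<lambda>c. X c * E l c + X c * Q l c)"
      by (rule asymp_add[OF W(2)])
    then have "(\<lambda>c. W c + Q l c * Y c * Q l c) \<approx> (\<lambda>c. X c * E (Suc l) c)"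
      by (simp add: distrib_left[symmetric])
    with D show ?case by (intro exI[of _ "\<lambda>c. W c + Q l c * Y c * Q l c"]) auto
  qed
  then obtain W where W: "\<And>c. W c \<in> D c" "W \<approx> (\<lambda>c. X c * E r c)" by blast
  have "(\<lambda>c. X c * E r c) \<approx> (\<lambda>c. Y c * E r c)"
    using Y(2) by (intro asymp_mult_right E_bdd) (auto intro: asymp_sym)
  also have "\<dots> = Y" using Y(1) B_sub_C E_r by blast
  also have "Y \<approx> X" by fact
  finally show ?thesis using that[of W] W asymp_trans by blast
qed

end

section \<open>Partial isometries compatible with a nest\<close>

context asymptotic_nest
begin

text \<open>
  Block Gram--Schmidt: column \<open>l\<close> of \<open>Y\<close> is made orthogonal to the part \<open>V\<close> already constructed by
  subtracting \<open>V V* Y Q\<close> and is then normalised.  The subtracted term lies in \<open>B\<close>, since \<open>V* Y Q\<close> maps block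
  \<open>l\<close> into earlier blocks, and the normalising factor lives in block \<open>l\<close> alone.  As \<open>Y* Y \<approx> q\<close>, different
  columns are almost orthogonal and the correction tends to \<open>0\<close>.
\<close>

lemma gram_schmidt_partial:
  assumes Y: "\<And>c. Y c \<in> B c" and p: "\<And>c. p c * Y c = Y c"
    and q: "\<And>c. q c \<in> D c" "\<And>c. projection (q c)" and Yq: "\<And>c. Y c * q c = Y c"
    and YY: "(\<lambda>c. adj (Y c) * Y c) \<approx> q" and bY: "bdd Y" and l: "l \<le> r"
  shows "\<exists>V. (\<forall>c. V c \<in> B c \<and> p c * V c = V c \<and> V c * E l c = V c \<and> V c * q c = V c) \<and>
    (\<forall>\<^sub>F c in F. adj (V c) * V c = q c * E l c) \<and> V \<approx> (\<lambda>c. Y c * E l c)"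
  using l
proof (induction l)
  case 0
  have "0 \<in> B c" for c using real_subalgebraD(5)[OF B_alg Y] .
  then show ?case by (intro exI[of _ "\<lambda>c. 0"]) (auto simp: E_0)
next
  case (Suc l)
  then have l: "l < r" "l \<le> r" by auto
  obtain V where V: "\<And>c. V c \<in> B c" "\<And>c. p c * V c = V c" "\<And>c. V c * E l c = V c" "\<And>c. V c * q c = V c"
    and VV: "\<forall>\<^sub>F c in F. adj (V c) * V c = q c * E l c" and V_Y: "V \<approx> (\<lambda>c. Y c * E l c)"
    using Suc by auto
  have qs: "adj (q c) = q c" "q c * q c = q c" for c using q(2)[of c] by (auto simp: projection_def)
  have qE: "q c * E k c = E k c * q c" if "k \<le> r" for k c using q(1)[of c] that by (simp add: D_def)
  define R where "R c = Q l c" for c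
  have qR: "q c * R c = R c * q c" for c
    using qE[of l c] qE[of "Suc l" c] l by (simp add: R_def left_diff_distrib right_diff_distrib)
  note Qi = Q_idem[OF l(1), folded R_def] and Qa = Q_adj[OF l(1), folded R_def]
    and bQ = Q_bdd[OF l(1), folded R_def] and bE = E_bdd[OF l(2)]
    and R_D = Q_in_D[OF l(1), folded R_def]
  have E_Suc: "E (Suc l) c = E l c + R c" for c by (simp add: R_def)
  have bq: "bdd q" using projection_norm_le[OF q(2)] by (intro bdd_norm_le_1)
  have bV: "bdd V" by (rule bdd_asymp[OF V_Y bdd_mult[OF bY bE]])
  have EV: "E l c * adj (V c) = adj (V c)" and qV: "q c * adj (V c) = adj (V c)" for c
    using arg_cong[OF V(3)[of c], of adj] arg_cong[OF V(4)[of c], of adj] l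
    by (auto simp: adj_mult E_adj qs)
  define W where "W = (\<lambda>c. Y c * R c - V c * (adj (V c) * Y c * R c))"
  have upper: "adj (V c) * Y c * R c \<in> B c" for c
  proof (rule strictly_upper_in_B[OF l(1), folded R_def])
    show "adj (V c) * Y c * R c \<in> C c"
      by (intro real_subalgebraD(3)[OF C_alg] C_adj subsetD[OF B_sub_C] V(1) Y subsetD[OF D_sub_C R_D])
    show "E l c * (adj (V c) * Y c * R c) = adj (V c) * Y c * R c"
      by (simp only: mult.assoc[symmetric] EV)
    show "adj (V c) * Y c * R c * R c = adj (V c) * Y c * R c"
      by (simp only: mult.assoc Qi)
  qed
  \<comment> \<open>\<open>W\<close> is the new column before normalisation.\<close>
  have W_B: "W c \<in> B c" for c
    unfolding W_def
    by (rule real_subalgebraD(4)[OF B_alg real_subalgebraD(3)[OF B_alg Y subsetD[OF D_sub_B R_D]]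
          real_subalgebraD(3)[OF B_alg V(1) upper]])
  have pW: "p c * W c = W c" for c
    unfolding W_def by (simp only: right_diff_distrib mult.assoc[symmetric] p V)
  have WQ: "W c * R c = W c" for c
    unfolding W_def by (simp only: left_diff_distrib[of _ _ "R c"] mult.assoc Qi)
  have Wq: "W c * q c = W c" for c
  proof -
    have e: "Y c * R c * q c = Y c * R c"
      by (simp only: mult.assoc qR[symmetric]) (simp only: mult.assoc[symmetric] Yq)
    have "V c * (adj (V c) * Y c * R c) * q c = V c * (adj (V c) * (Y c * R c * q c))"
      by (simp only: mult.assoc)
    also have "\<dots> = V c * (adj (V c) * Y c * R c)" unfolding e by (simp only: mult.assoc)
    finally show ?thesis unfolding W_def using e by (simp only: left_diff_distrib[of _ _ "q c"])
  qed
  have q': "projection (q c * R c)" for c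
  proof -
    have "q c * R c * (q c * R c) = q c * (R c * q c) * R c" by (simp only: mult.assoc)
    also have "\<dots> = q c * R c" by (simp only: qR[symmetric] mult.assoc[symmetric] qs) (simp only: mult.assoc Qi)
    finally show ?thesis by (simp only: projection_def adj_mult Qa qs qR)
  qed
  have "(\<lambda>c. adj (V c) * Y c * R c) \<approx> (\<lambda>c. adj (Y c * E l c) * Y c * R c)"
    using V_Y by (intro asymp_mult_right asymp_adj bY bQ)
  also have "\<dots> = (\<lambda>c. E l c * (adj (Y c) * Y c) * R c)"
    by (simp only: adj_mult E_adj[OF l(2)] mult.assoc)
  also have "\<dots> \<approx> (\<lambda>c. E l c * q c * R c)"
    by (intro asymp_mult_right asymp_mult_left YY bQ bE)
  also have "\<dots> = (\<lambda>c. 0)"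
    by (simp only: qE[OF l(2), symmetric] mult.assoc E_Q[OF l(2,1), folded R_def]) simp
  finally have "(\<lambda>c. adj (V c) * Y c * R c) \<approx> (\<lambda>c. 0)" .
  then have "(\<lambda>c. V c * (adj (V c) * Y c * R c)) \<approx> (\<lambda>c. V c * 0)"
    by (rule asymp_mult_left[OF _ bV])
  then have "W \<approx> (\<lambda>c. Y c * R c - V c * 0)"
    unfolding W_def by (intro asymp_diff) auto
  then have W_Y: "W \<approx> (\<lambda>c. Y c * R c)" by simp
  have bYQ: "bdd (\<lambda>c. Y c * R c)" by (rule bdd_mult[OF bY bQ])
  have bW: "bdd W" by (rule bdd_asymp[OF W_Y bYQ])
  have "(\<lambda>c. adj (W c) * W c) \<approx> (\<lambda>c. adj (Y c * R c) * (Y c * R c))"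
    by (intro asymp_mult asymp_adj W_Y bYQ bdd_adj bW)
  also have "\<dots> = (\<lambda>c. R c * (adj (Y c) * Y c) * R c)" by (simp only: adj_mult Qa mult.assoc)
  also have "\<dots> \<approx> (\<lambda>c. R c * q c * R c)" by (intro asymp_mult_right asymp_mult_left YY bQ)
  also have "\<dots> = (\<lambda>c. q c * R c)" by (simp only: qR[symmetric] mult.assoc Qi)
  finally have WW: "(\<lambda>c. adj (W c) * W c) \<approx> (\<lambda>c. q c * R c)" .
  have WW_C: "adj (W c) * W c \<in> C c" for c
    by (intro real_subalgebraD(3)[OF C_alg] C_adj subsetD[OF B_sub_C] W_B)
  have dg: "diagonalizable (adj (W c) * W c)" for c
    by (rule M_diagonalizable[OF subsetD[OF C_sub_M WW_C]]) (simp add: adj_mult)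
  have Wq': "W c * (q c * R c) = W c" for c
    by (simp only: mult.assoc[symmetric] Wq WQ)
  obtain s where s: "\<And>c. adj (s c) = s c" "(\<lambda>c. W c * s c) \<approx> W"
    "\<forall>\<^sub>F c in F. adj (W c * s c) * (W c * s c) = q c * R c"
    "\<And>c S. real_subalgebra S \<Longrightarrow> adj (W c) * W c \<in> S \<Longrightarrow> s c \<in> S"
    apply (rule asymptotic_normalize[OF dg q' Wq' WW bW])
    subgoal premises p by (rule p(1)[OF p(2-)])
    done
  have QW: "R c * adj (W c) = adj (W c)" for c
    using arg_cong[OF WQ[of c], of adj] by (simp only: adj_mult Qa)
  have "s c \<in> {x \<in> C c. R c * x = x \<and> x * R c = x}" for c
  proof (rule s(4)[OF corner_alg[where l = l, folded R_def]], intro CollectI conjI WW_C)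
    show "R c * (adj (W c) * W c) = adj (W c) * W c" by (simp only: mult.assoc[symmetric] QW)
    show "adj (W c) * W c * R c = adj (W c) * W c" by (simp only: mult.assoc WQ)
  qed
  then have s_C: "s c \<in> C c" "R c * s c = s c" "s c * R c = s c" for c by auto
  have s_B: "s c \<in> B c" for c using corner_sub_D[OF l(1), folded R_def, OF s_C] D_sub_B by blast
  have sq: "s c * q c = s c" for c
  proof -
    have "real_subalgebra {x. x * q c = x}"
      by (auto simp: real_subalgebra_def distrib_right mult.assoc)
    from s(4)[OF this, of c] show ?thesis by (simp add: mult.assoc Wq)
  qed
  define V' where "V' = (\<lambda>c. V c + W c * s c)"
  show ?case
  proof (intro exI[of _ V'] conjI allI)
    fix c
    show "V' c \<in> B c" unfolding V'_def using V(1) W_B s_B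
      by (intro real_subalgebraD(1,3)[OF B_alg]) auto
    show "p c * V' c = V' c"
      unfolding V'_def by (simp only: distrib_left mult.assoc[symmetric] V pW)
    have "V c * E (Suc l) c = V c * (E l c * E (Suc l) c)"
      by (simp only: mult.assoc[symmetric] V)
    also have "\<dots> = V c" using E_mult[of l "Suc l" c] l V(3) by simp
    finally have a: "V c * E (Suc l) c = V c" .
    have "s c * E (Suc l) c = s c * (R c * E (Suc l) c)"
      by (simp only: mult.assoc[symmetric] s_C)
    also have "\<dots> = s c" using Q_E[of "Suc l" l c, folded R_def] l s_C by simp
    finally have "s c * E (Suc l) c = s c" .
    with a show "V' c * E (Suc l) c = V' c"
      unfolding V'_def by (simp only: distrib_right mult.assoc)
    show "V' c * q c = V' c"
      unfolding V'_def by (simp only: distrib_right mult.assoc V sq)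
  next
    show "\<forall>\<^sub>F c in F. adj (V' c) * V' c = q c * E (Suc l) c"
      using VV s(3)
    proof eventually_elim
      case (elim c)
      have "adj (V c) * W c = adj (V c) * Y c * R c - adj (V c) * V c * (adj (V c) * Y c * R c)"
        unfolding W_def by (simp only: right_diff_distrib[of "adj (V c)"] mult.assoc)
      also have "adj (V c) * V c * (adj (V c) * Y c * R c) = adj (V c) * Y c * R c"
        unfolding elim(1) by (simp only: mult.assoc[symmetric]) (simp only: mult.assoc[of "q c"] EV qV)
      finally have VW: "adj (V c) * W c = 0" by simp
      have "adj (adj (V c) * W c) = 0" unfolding VW by simp
      then have WV: "adj (W c) * V c = 0" by (simp only: adj_mult adj_adj)
      have c1: "adj (V c) * (W c * s c) = 0" using VW by (simp add: mult.assoc[symmetric])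
      have c2: "adj (W c * s c) * V c = 0" using WV by (simp add: adj_mult s(1) mult.assoc)
      have "adj (V' c) * V' c = adj (V c) * V c + adj (W c * s c) * (W c * s c)"
        unfolding V'_def by (simp only: adj_add distrib_left distrib_right c1 c2) simp
      also have "\<dots> = q c * E (Suc l) c" unfolding elim by (simp add: E_Suc distrib_left)
      finally show ?case .
    qed
  next
    have "V' \<approx> (\<lambda>c. Y c * E l c + Y c * R c)"
      unfolding V'_def using V_Y asymp_trans[OF s(2) W_Y] by (rule asymp_add)
    then show "V' \<approx> (\<lambda>c. Y c * E (Suc l) c)" by (simp add: E_Suc distrib_left)
  qed
qed

lemma partial_isometry_in_B:
  assumes Y: "\<And>c. Y c \<in> B c" and p: "\<And>c. projection (p c)" "\<And>c. p c * Y c = Y c"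
    and q: "\<And>c. q c \<in> D c" "\<And>c. projection (q c)" "\<And>c. Y c * q c = Y c"
    and YY: "(\<lambda>c. adj (Y c) * Y c) \<approx> q" "(\<lambda>c. Y c * adj (Y c)) \<approx> p" and bY: "bdd Y"
  obtains V where "\<And>c. V c \<in> B c" "V \<approx> Y" "\<And>c. p c * V c = V c" "\<And>c. V c * q c = V c"
    "\<forall>\<^sub>F c in F. adj (V c) * V c = q c" "\<forall>\<^sub>F c in F. V c * adj (V c) = p c"
proof -
  obtain V where V: "\<And>c. V c \<in> B c" "\<And>c. p c * V c = V c" "\<And>c. V c * q c = V c"
    "\<forall>\<^sub>F c in F. adj (V c) * V c = q c * E r c" "V \<approx> (\<lambda>c. Y c * E r c)"
    using gram_schmidt_partial[OF Y p(2) q YY(1) bY order_refl] by blast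
  have "q c * E r c = q c" "Y c * E r c = Y c" for c
    using q(1) Y D_sub_C B_sub_C E_r by blast+
  then have VV: "\<forall>\<^sub>F c in F. adj (V c) * V c = q c" and VY: "V \<approx> Y" using V(4,5) by auto
  have "\<forall>\<^sub>F c in F. V c * adj (V c) = p c"
    by (rule asymptotic_coisometry[OF p(1) V(2,3) VV VY bY YY(2)])
  then show ?thesis using that[of V] V VV VY by blast
qed

text \<open>
  Inside the self-adjoint algebra \<open>D\<close> a single polar decomposition is enough.
\<close>

lemma partial_isometry_in_D:
  assumes Y: "\<And>c. Y c \<in> D c" and p: "\<And>c. projection (p c)" "\<And>c. p c * Y c = Y c"
    and q: "\<And>c. projection (q c)" "\<And>c. Y c * q c = Y c"
    and YY: "(\<lambda>c. adj (Y c) * Y c) \<approx> q" "(\<lambda>c. Y c * adj (Y c)) \<approx> p" and bY: "bdd Y"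
  obtains V where "\<And>c. V c \<in> D c" "V \<approx> Y" "\<And>c. p c * V c = V c" "\<And>c. V c * q c = V c"
    "\<forall>\<^sub>F c in F. adj (V c) * V c = q c" "\<forall>\<^sub>F c in F. V c * adj (V c) = p c"
proof -
  have YD: "adj (Y c) * Y c \<in> D c" for c
    using Y D_adj by (intro real_subalgebraD(3)[OF D_alg]) auto
  have dg: "diagonalizable (adj (Y c) * Y c)" for c
    by (rule M_diagonalizable[OF subsetD[OF C_sub_M subsetD[OF D_sub_C YD]]]) (simp add: adj_mult)
  obtain s where s: "\<And>c. adj (s c) = s c" "(\<lambda>c. Y c * s c) \<approx> Y"
    "\<forall>\<^sub>F c in F. adj (Y c * s c) * (Y c * s c) = q c"
    "\<And>c S. real_subalgebra S \<Longrightarrow> adj (Y c) * Y c \<in> S \<Longrightarrow> s c \<in> S"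
    apply (rule asymptotic_normalize[OF dg q YY(1) bY])
    subgoal premises p by (rule p(1)[OF p(2-)])
    done
  have sq: "s c * q c = s c" for c
  proof -
    have "real_subalgebra {x. x * q c = x}"
      by (auto simp: real_subalgebra_def distrib_right mult.assoc)
    from s(4)[OF this, of c] show ?thesis by (simp add: mult.assoc q)
  qed
  have a: "Y c * s c \<in> D c" "p c * (Y c * s c) = Y c * s c" "Y c * s c * q c = Y c * s c" for c
    using Y s(4)[OF D_alg YD] by (auto intro: real_subalgebraD(3)[OF D_alg] simp: mult.assoc sq)
      (simp add: mult.assoc[symmetric] p)
  have "\<forall>\<^sub>F c in F. Y c * s c * adj (Y c * s c) = p c"
    by (rule asymptotic_coisometry[OF p(1) a(2,3) s(3,2) bY YY(2)])
  then show ?thesis using that[of "\<lambda>c. Y c * s c"] a s by blast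
qed

end

section \<open>Moving matrix units into a nest algebra\<close>

text \<open>
  The elements \<open>w\<^sub>i* w\<^sub>j\<close> form a system of matrix units, and \<open>u\<close> intertwines it with \<open>f\<close>: it carries the
  range of \<open>f i i\<close> to that of \<open>f 0 0\<close>, moves it by \<open>z\<close> to the range of \<open>p\<close>, and distributes it by \<open>w\<^sub>i*\<close>.
\<close>

lemma conjugating_partial_isometry:
  fixes f :: "nat \<Rightarrow> nat \<Rightarrow> 'a::cstar_normed_algebra"
  assumes m: "0 < m" and f_adj: "\<And>i j. i < m \<Longrightarrow> j < m \<Longrightarrow> adj (f i j) = f j i"
    and f_mult: "\<And>i j k l. i < m \<Longrightarrow> j < m \<Longrightarrow> k < m \<Longrightarrow> l < m \<Longrightarrow>
      f i j * f k l = (if j = k then f i l else 0)"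
    and z: "adj z * z = f 0 0" "z * adj z = p" "p * z = z" "z * f 0 0 = z"
    and w: "\<And>i j. i < m \<Longrightarrow> j < m \<Longrightarrow> w i * adj (w j) = (if i = j then p else 0)"
      "\<And>j. j < m \<Longrightarrow> p * w j = w j"
    and u_def: "u = (\<Sum>i<m. adj (w i) * (z * f 0 i))"
  shows "adj u * u = (\<Sum>i<m. f i i)"
    "\<And>i j. i < m \<Longrightarrow> j < m \<Longrightarrow> u * f i j * adj u = adj (w i) * w j"
proof -
  have wu: "w i * u = z * f 0 i" if i: "i < m" for i
  proof -
    have "w i * u = (\<Sum>k<m. if i = k then p * (z * f 0 i) else 0)"
      unfolding u_def sum_distrib_left mult.assoc[symmetric]
      using i by (intro sum.cong) (auto simp: w mult.assoc)
    then show ?thesis using i by (simp add: mult.assoc[symmetric] z)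
  qed
  have adj_u: "adj u = (\<Sum>i<m. f i 0 * adj z * w i)"
    unfolding u_def adj_sum using m by (intro sum.cong) (auto simp: adj_mult f_adj mult.assoc)
  have "adj u * u = (\<Sum>i<m. f i 0 * adj z * (w i * u))"
    unfolding adj_u sum_distrib_right by (simp add: mult.assoc)
  also have "\<dots> = (\<Sum>i<m. f i i)"
  proof (intro sum.cong refl)
    fix i assume "i \<in> {..<m}"
    then have i: "i < m" by simp
    have "f i 0 * adj z * (w i * u) = f i 0 * (adj z * z) * f 0 i"
      by (simp only: wu[OF i] mult.assoc)
    then show "f i 0 * adj z * (w i * u) = f i i" using i m by (simp add: z f_mult)
  qed
  finally show "adj u * u = (\<Sum>i<m. f i i)" .
  have uf: "u * f i 0 = adj (w i) * z" if i: "i < m" for i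
  proof -
    have "u * f i 0 = (\<Sum>k<m. if k = i then adj (w i) * (z * f 0 0) else 0)"
      unfolding u_def sum_distrib_right using i m
      by (intro sum.cong) (auto simp: mult.assoc f_mult)
    then show ?thesis using i by (simp add: z)
  qed
  fix i j assume ij: "i < m" "j < m"
  have fu: "f 0 j * adj u = adj z * w j"
    using arg_cong[OF uf[OF ij(2)], of adj] ij m by (simp add: adj_mult f_adj)
  have "u * f i j * adj u = u * (f i 0 * f 0 j) * adj u" using ij m by (simp add: f_mult)
  also have "\<dots> = (u * f i 0) * (f 0 j * adj u)" by (simp only: mult.assoc)
  also have "\<dots> = adj (w i) * (z * adj z) * w j" by (simp only: uf[OF ij(1)] fu mult.assoc)
  also have "\<dots> = adj (w i) * w j" using ij by (simp add: z w mult.assoc)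
  finally show "u * f i j * adj u = adj (w i) * w j" .
qed

text \<open>
  \<open>b i\<close> is the block of the index \<open>i\<close> in the first nest algebra, which is spanned by the matrix units
  with \<open>b i \<le> b j\<close>.
\<close>

locale matrix_units_near_nest = asymptotic_nest F M C E r
  for F :: "'c filter" and M C :: "'c \<Rightarrow> 'a::cstar_normed_algebra set"
    and E :: "nat \<Rightarrow> 'c \<Rightarrow> 'a" and r :: nat +
  fixes f :: "nat \<Rightarrow> nat \<Rightarrow> 'c \<Rightarrow> 'a" and m :: nat and b :: "nat \<Rightarrow> nat"
  assumes m: "0 < m" and f_M: "\<And>i j c. i < m \<Longrightarrow> j < m \<Longrightarrow> f i j c \<in> M c"
    and f_adj: "\<And>i j c. i < m \<Longrightarrow> j < m \<Longrightarrow> adj (f i j c) = f j i c"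
    and f_mult: "\<And>i j k l c. i < m \<Longrightarrow> j < m \<Longrightarrow> k < m \<Longrightarrow> l < m \<Longrightarrow>
      f i j c * f k l c = (if j = k then f i l c else 0)"
    and b_mono: "\<And>i j. i \<le> j \<Longrightarrow> j < m \<Longrightarrow> b i \<le> b j"
    and near: "\<And>i j. i < m \<Longrightarrow> j < m \<Longrightarrow> b i \<le> b j \<Longrightarrow> \<exists>Y. (\<forall>c. Y c \<in> B c) \<and> Y \<approx> f i j"
begin

lemma f_proj: "i < m \<Longrightarrow> projection (f i i c)"
  by (simp add: projection_def f_adj f_mult)

lemma f_bdd: "i < m \<Longrightarrow> j < m \<Longrightarrow> bdd (f i j)"
  by (intro bdd_norm_le_1 partial_isometry_norm_le) (simp add: f_adj f_mult f_proj)

lemma near_diagonal: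
  assumes ij: "i < m" "j < m" "b i = b j"
  obtains W where "\<And>c. W c \<in> D c" "W \<approx> f i j"
proof -
  obtain Y where Y: "\<And>c. Y c \<in> B c" "Y \<approx> f i j" using near[of i j] ij by auto
  obtain Z where Z: "\<And>c. Z c \<in> B c" "Z \<approx> f j i" using near[of j i] ij by auto
  have "(\<lambda>c. adj (f i j c)) = f j i" using ij by (auto simp: f_adj)
  then show ?thesis using asymptotic_diagonal[OF Y Z(1), of thesis] Z(2) f_bdd ij that by auto
qed

text \<open>
  One projection at a time: an approximant of \<open>f k k\<close> in \<open>D\<close> is made self-adjoint, compressed to the
  complement of the projections found so far, and replaced by its spectral projection.  The latter
  annihilates the earlier projections because the compressed element does.
\<close>

lemma orthogonal_projections_in_D:
  assumes "k \<le> m"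
  shows "\<exists>P. \<forall>i<k. (\<forall>c. P i c \<in> D c \<and> projection (P i c)) \<and> P i \<approx> f i i \<and>
    (\<forall>j<k. i \<noteq> j \<longrightarrow> (\<forall>c. P i c * P j c = 0))"
  using assms
proof (induction k)
  case (Suc k)
  then have k: "k < m" by simp
  obtain P where P: "\<And>i c. i < k \<Longrightarrow> P i c \<in> D c" "\<And>i c. i < k \<Longrightarrow> projection (P i c)"
    "\<And>i. i < k \<Longrightarrow> P i \<approx> f i i" "\<And>i j c. i < k \<Longrightarrow> j < k \<Longrightarrow> i \<noteq> j \<Longrightarrow> P i c * P j c = 0"
    using Suc by auto blast
  have Pa: "adj (P i c) = P i c" and Pi: "P i c * P i c = P i c" if "i < k" for i c
    using P(2)[OF that] by (auto simp: projection_def)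
  obtain W where W: "\<And>c. W c \<in> D c" "W \<approx> f k k" using near_diagonal[OF k k refl] by blast
  define H where "H = (\<lambda>c. (1/2) *\<^sub>R (W c + adj (W c)))"
  define S where "S = (\<lambda>c. \<Sum>i<k. P i c)"
  define T where "T = (\<lambda>c. \<Sum>i<k. f i i c)"
  \<comment> \<open>\<open>G\<close> is \<open>(1 - S) H (1 - S)\<close>, written without a unit.\<close>
  define G where "G = (\<lambda>c. H c - S c * H c - H c * S c + S c * H c * S c)"
  have H_D: "H c \<in> D c" for c
    unfolding H_def by (intro real_subalgebraD(1,2)[OF D_alg] D_adj W)
  have H_adj: "adj (H c) = H c" for c
    by (simp add: H_def adj_scaleR adj_add add.commute)
  have S_adj: "adj (S c) = S c" for c
    unfolding S_def adj_sum by (intro sum.cong) (auto simp: Pa)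
  have zero_D: "0 \<in> D c" for c using real_subalgebraD(5)[OF D_alg W(1)] .
  have "(\<Sum>i<n. P i c) \<in> D c" if "n \<le> k" for n c using that
  proof (induction n)
    case (Suc n)
    then have "(\<Sum>i<n. P i c) \<in> D c" "P n c \<in> D c" by (auto intro: P(1))
    then show ?case using real_subalgebraD(1)[OF D_alg] by simp
  qed (simp add: zero_D)
  then have S_D: "S c \<in> D c" for c by (auto simp: S_def)
  have G_D: "G c \<in> D c" for c
    unfolding G_def by (intro real_subalgebraD(1,3,4)[OF D_alg] H_D S_D)
  have G_adj: "adj (G c) = G c" for c
    by (simp add: G_def adj_add adj_diff adj_mult H_adj S_adj mult.assoc)
  have PS: "P i c * S c = P i c" if "i < k" for i c
  proof -
    have "P i c * S c = (\<Sum>j<k. if i = j then P i c else 0)"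
      unfolding S_def sum_distrib_left using that by (intro sum.cong) (auto simp: Pi P)
    then show ?thesis using that by simp
  qed
  have SP: "S c * P i c = P i c" if "i < k" for i c
    using arg_cong[OF PS[OF that], of adj c] that by (simp add: adj_mult S_adj Pa)
  have bf: "bdd (f k k)" using f_bdd k by blast
  have "(\<lambda>c. adj (W c)) \<approx> (\<lambda>c. adj (f k k c))" by (rule asymp_adj[OF W(2)])
  also have "\<dots> = f k k" using k by (auto simp: f_adj)
  finally have "(\<lambda>c. (1/2) *\<^sub>R (W c + adj (W c))) \<approx> (\<lambda>c. (1/2) *\<^sub>R (f k k c + f k k c))"
    by (intro asymp_scaleR asymp_add W(2))
  then have Hf: "H \<approx> f k k" unfolding H_def by (simp add: scaleR_add_right[symmetric] scaleR_2[symmetric])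
  have bH: "bdd H" by (rule bdd_asymp[OF Hf bf])
  have ST: "S \<approx> T" unfolding S_def T_def by (intro asymp_sum P) auto
  have Tf: "T c * f k k c = 0" and fT: "f k k c * T c = 0" for c
    unfolding T_def sum_distrib_left sum_distrib_right using k by (auto simp: f_mult)
  have TT: "projection (T c)" for c
  proof -
    have "T c * T c = (\<Sum>i<k. \<Sum>j<k. if i = j then f i i c else 0)"
      unfolding T_def sum_product using k by (intro sum.cong) (auto simp: f_mult)
    moreover have "adj (T c) = T c" unfolding T_def adj_sum using k by (auto simp: f_adj)
    ultimately show ?thesis by (simp add: projection_def T_def)
  qed
  have bT: "bdd T" using projection_norm_le[OF TT] by (intro bdd_norm_le_1)
  have bS: "bdd S" by (rule bdd_asymp[OF ST bT])
  have "G \<approx> (\<lambda>c. f k k c - T c * f k k c - f k k c * T c + T c * f k k c * T c)"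
    unfolding G_def by (intro asymp_add asymp_diff asymp_mult Hf ST bH bS bf bT bdd_mult)
  then have Gf: "G \<approx> f k k" by (simp add: Tf fT)
  have dg: "diagonalizable (G c)" for c
    by (rule M_diagonalizable[OF subsetD[OF C_sub_M subsetD[OF D_sub_C G_D]] G_adj])
  obtain p where p: "\<And>c. projection (p c)" "p \<approx> f k k"
    "\<And>c U. real_subalgebra U \<Longrightarrow> G c \<in> U \<Longrightarrow> p c \<in> U"
    apply (rule asymptotic_projection[OF dg Gf f_proj[OF k]])
    subgoal premises p by (rule p(1)[OF p(2-)])
    done
  have pP: "p c * P i c = 0 \<and> P i c * p c = 0" if i: "i < k" for i c
  proof -
    have "real_subalgebra {x. x * P i c = 0 \<and> P i c * x = 0}"
      by (auto simp: real_subalgebra_def distrib_left distrib_right mult.assoc)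
        (simp add: mult.assoc[symmetric])
    moreover have "P i c * G c = 0"
      by (simp add: G_def distrib_left right_diff_distrib mult.assoc[symmetric] PS[OF i])
    moreover have "G c * P i c = 0"
      by (simp add: G_def distrib_right left_diff_distrib mult.assoc SP[OF i])
    ultimately show ?thesis using p(3) by blast
  qed
  have pD: "p c \<in> D c" for c by (rule p(3)[OF D_alg G_D])
  show ?case
    by (rule exI[of _ "P(k := p)"]) (use P p pP pD in \<open>auto simp: less_Suc_eq\<close>)
qed auto

text \<open>
  Within a block both \<open>f i (i+1)\<close> and its adjoint are close to \<open>B\<close>, hence to \<open>D\<close>.  There the partial
  isometry is needed in \<open>D\<close>, because the perturbed embedding must send both units into \<open>B\<close>.
\<close>

lemma connecting_isometry:
  assumes i: "Suc i < m" and P: "\<And>j c. j < m \<Longrightarrow> P j c \<in> D c" "\<And>j c. j < m \<Longrightarrow> projection (P j c)"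
    "\<And>j. j < m \<Longrightarrow> P j \<approx> f j j"
  shows "\<exists>V. (\<forall>c. V c \<in> B c \<and> (b i = b (Suc i) \<longrightarrow> V c \<in> D c)) \<and> V \<approx> f i (Suc i) \<and>
    (\<forall>\<^sub>F c in F. adj (V c) * V c = P (Suc i) c) \<and> (\<forall>\<^sub>F c in F. V c * adj (V c) = P i c) \<and>
    (\<forall>c. P i c * V c = V c \<and> V c * P (Suc i) c = V c)"
proof -
  have i': "i < m" using i by simp
  define S where "S c = (if b i = b (Suc i) then D c else B c)" for c
  have S_alg: "real_subalgebra (S c)" for c by (simp add: S_def D_alg B_alg)
  have D_S: "x \<in> S c" if "x \<in> D c" for x c using that D_sub_B by (auto simp: S_def)
  obtain Z where Z: "\<And>c. Z c \<in> S c" "Z \<approx> f i (Suc i)"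
  proof (cases "b i = b (Suc i)")
    case True
    then show ?thesis using near_diagonal[OF i' i True] that by (auto simp: S_def)
  next
    case False
    then show ?thesis using near[OF i' i b_mono] i that by (auto simp: S_def)
  qed
  define Y where "Y = (\<lambda>c. P i c * Z c * P (Suc i) c)"
  have Y_S: "Y c \<in> S c" for c
    unfolding Y_def using P i i' by (intro real_subalgebraD(3)[OF S_alg] Z D_S) auto
  have PP: "P j c * P j c = P j c" if "j < m" for j c using P(2)[OF that] by (simp add: projection_def)
  have PY: "P i c * Y c = Y c" and YP: "Y c * P (Suc i) c = Y c" for c
    using PP[OF i'] PP[OF i] by (auto simp: Y_def mult.assoc) (simp add: mult.assoc[symmetric])
  have bP: "bdd (P j)" if "j < m" for j using bdd_asymp[OF P(3) f_bdd] that by blast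
  have bZ: "bdd Z" using bdd_asymp[OF Z(2) f_bdd] i i' by blast
  have "Y \<approx> (\<lambda>c. f i i c * f i (Suc i) c * f (Suc i) (Suc i) c)"
    unfolding Y_def using i i' by (intro asymp_mult P Z bdd_mult bP bZ f_bdd)
  also have "\<dots> = f i (Suc i)" using i i' by (auto simp: f_mult)
  finally have Yf: "Y \<approx> f i (Suc i)" .
  have bf: "bdd (f i (Suc i))" using f_bdd i i' by blast
  have bY: "bdd Y" by (rule bdd_asymp[OF Yf bf])
  have "(\<lambda>c. adj (Y c) * Y c) \<approx> (\<lambda>c. adj (f i (Suc i) c) * f i (Suc i) c)"
    by (intro asymp_mult asymp_adj Yf bdd_adj bY bf)
  also have "\<dots> = f (Suc i) (Suc i)" using i i' by (auto simp: f_mult f_adj)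
  also have "\<dots> \<approx> P (Suc i)" by (rule asymp_sym[OF P(3)[OF i]])
  finally have Y1: "(\<lambda>c. adj (Y c) * Y c) \<approx> P (Suc i)" .
  have "(\<lambda>c. Y c * adj (Y c)) \<approx> (\<lambda>c. f i (Suc i) c * adj (f i (Suc i) c))"
    by (intro asymp_mult asymp_adj Yf bdd_adj bY bf)
  also have "\<dots> = f i i" using i i' by (auto simp: f_mult f_adj)
  also have "\<dots> \<approx> P i" by (rule asymp_sym[OF P(3)[OF i']])
  finally have Y2: "(\<lambda>c. Y c * adj (Y c)) \<approx> P i" .
  show ?thesis
  proof (cases "b i = b (Suc i)")
    case True
    have Y_D: "Y c \<in> D c" for c using Y_S[of c] True by (simp add: S_def)
    obtain V where V: "\<And>c. V c \<in> D c" "V \<approx> Y" "\<And>c. P i c * V c = V c" "\<And>c. V c * P (Suc i) c = V c"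
      "\<forall>\<^sub>F c in F. adj (V c) * V c = P (Suc i) c" "\<forall>\<^sub>F c in F. V c * adj (V c) = P i c"
      apply (rule partial_isometry_in_D[OF Y_D P(2)[OF i'] PY P(2)[OF i] YP Y1 Y2 bY])
      subgoal premises p by (rule p(1)[OF p(2-)])
      done
    then show ?thesis using subsetD[OF D_sub_B V(1)] asymp_trans[OF V(2) Yf] by (intro exI[of _ V]) auto
  next
    case False
    have Y_B: "Y c \<in> B c" for c using Y_S[of c] False by (simp add: S_def)
    obtain V where V: "\<And>c. V c \<in> B c" "V \<approx> Y" "\<And>c. P i c * V c = V c" "\<And>c. V c * P (Suc i) c = V c"
      "\<forall>\<^sub>F c in F. adj (V c) * V c = P (Suc i) c" "\<forall>\<^sub>F c in F. V c * adj (V c) = P i c"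
      apply (rule partial_isometry_in_B[OF Y_B P(2)[OF i'] PY P(1,2)[OF i] YP Y1 Y2 bY])
      subgoal premises p by (rule p(1)[OF p(2-)])
      done
    then show ?thesis using False asymp_trans[OF V(2) Yf] by (intro exI[of _ V]) auto
  qed
qed

text \<open>
  With \<open>w j = V 0 V 1 \<dots> V (j-1)\<close> the units \<open>w\<^sub>i* w\<^sub>j\<close> for \<open>i \<le> j\<close> are products of the connecting
  isometries \<open>V\<close>, so they lie in \<open>B\<close>; if \<open>i\<close> and \<open>j\<close> are in the same block, all factors are in \<open>D\<close>, and the
  adjoint is in \<open>B\<close> as well.  The partial isometry \<open>z\<close> from \<open>f 0 0\<close> to \<open>P 0\<close> is needed because the two
  projections are only close to each other.
\<close>

theorem conjugate_into_nest:
  obtains u where "\<And>c. u c \<in> M c" "u \<approx> (\<lambda>c. \<Sum>i<m. f i i c)"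
    "\<forall>\<^sub>F c in F. adj (u c) * u c = (\<Sum>i<m. f i i c) \<and>
      (\<forall>i<m. \<forall>j<m. b i \<le> b j \<longrightarrow> u c * f i j c * adj (u c) \<in> B c)"
proof -
  obtain P where P: "\<And>i c. i < m \<Longrightarrow> P i c \<in> D c" "\<And>i c. i < m \<Longrightarrow> projection (P i c)"
    "\<And>i. i < m \<Longrightarrow> P i \<approx> f i i" "\<And>i j c. i < m \<Longrightarrow> j < m \<Longrightarrow> i \<noteq> j \<Longrightarrow> P i c * P j c = 0"
    using orthogonal_projections_in_D[of m] by auto blast
  have Pa: "adj (P i c) = P i c" and Pi: "P i c * P i c = P i c" if "i < m" for i c
    using P(2)[OF that] by (auto simp: projection_def)
  have bP: "bdd (P j)" if "j < m" for j using bdd_asymp[OF P(3) f_bdd] that by blast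
  have "\<forall>i. \<exists>V. Suc i < m \<longrightarrow> (\<forall>c. V c \<in> B c \<and> (b i = b (Suc i) \<longrightarrow> V c \<in> D c)) \<and> V \<approx> f i (Suc i) \<and>
    (\<forall>\<^sub>F c in F. adj (V c) * V c = P (Suc i) c) \<and> (\<forall>\<^sub>F c in F. V c * adj (V c) = P i c) \<and>
    (\<forall>c. P i c * V c = V c \<and> V c * P (Suc i) c = V c)"
    (is "\<forall>i. \<exists>V. ?connects i V")
  proof
    fix i
    show "\<exists>V. ?connects i V"
    proof (cases "Suc i < m")
      case True
      show ?thesis using connecting_isometry[OF True P(1,2,3)] by simp
    qed simp
  qed
  from choice[OF this] obtain V where V_all: "\<forall>i. ?connects i (V i)" ..
  have V: "\<And>i c. Suc i < m \<Longrightarrow> V i c \<in> B c"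
    "\<And>i c. Suc i < m \<Longrightarrow> b i = b (Suc i) \<Longrightarrow> V i c \<in> D c"
    "\<And>i. Suc i < m \<Longrightarrow> V i \<approx> f i (Suc i)"
    "\<And>i. Suc i < m \<Longrightarrow> \<forall>\<^sub>F c in F. adj (V i c) * V i c = P (Suc i) c"
    "\<And>i. Suc i < m \<Longrightarrow> \<forall>\<^sub>F c in F. V i c * adj (V i c) = P i c"
    "\<And>i c. Suc i < m \<Longrightarrow> P i c * V i c = V i c" "\<And>i c. Suc i < m \<Longrightarrow> V i c * P (Suc i) c = V i c"
    using V_all by simp_all
  define w where "w = rec_nat (P 0) (\<lambda>j wj c. wj c * V j c)"
  have w0: "w 0 = P 0" and wS: "w (Suc j) c = w j c * V j c" for j c by (auto simp: w_def)
  have wf: "w j \<approx> f 0 j" if "j < m" for j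
    using that
  proof (induction j)
    case (Suc j)
    have "w (Suc j) \<approx> (\<lambda>c. f 0 j c * f j (Suc j) c)"
      unfolding wS[abs_def] using Suc by (intro asymp_mult Suc V bdd_asymp[OF Suc.IH] f_bdd) auto
    also have "\<dots> = f 0 (Suc j)" using Suc m by (auto simp: f_mult)
    finally show ?case .
  qed (use m P w0 in auto)
  have wP: "w j c * P j c = w j c" if "j < m" for j c
    using that by (cases j) (auto simp: w0 wS Pi V mult.assoc)
  have Pw: "P 0 c * w j c = w j c" if "j < m" for j c
    using that m by (induction j) (auto simp: w0 wS Pi mult.assoc[symmetric])
  have Pw': "P j c * adj (w j c) = adj (w j c)" if "j < m" for j c
    using arg_cong[OF wP[OF that], of adj c] that by (simp add: adj_mult Pa)

  define W where "W = (\<lambda>c. P 0 c * f 0 0 c)"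
  have Wf0: "W c * f 0 0 c = W c" for c using m by (simp add: W_def mult.assoc f_mult)
  have bf0: "bdd (f 0 0)" using f_bdd m by blast
  have "W \<approx> (\<lambda>c. f 0 0 c * f 0 0 c)"
    unfolding W_def using m by (intro asymp_mult P bP bf0) auto
  then have Wf: "W \<approx> f 0 0" using m by (simp add: f_mult)
  have bW: "bdd W" by (rule bdd_asymp[OF Wf bf0])
  have "(\<lambda>c. adj (W c) * W c) \<approx> (\<lambda>c. adj (f 0 0 c) * f 0 0 c)"
    by (intro asymp_mult asymp_adj Wf bdd_adj bW bf0)
  then have WW: "(\<lambda>c. adj (W c) * W c) \<approx> f 0 0" using m by (simp add: f_adj f_mult)
  have "(\<lambda>c. W c * adj (W c)) \<approx> (\<lambda>c. f 0 0 c * adj (f 0 0 c))"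
    by (intro asymp_mult asymp_adj Wf bdd_adj bW bf0)
  also have "\<dots> = f 0 0" using m by (auto simp: f_adj f_mult)
  also have "f 0 0 \<approx> P 0" by (rule asymp_sym[OF P(3)[OF m]])
  finally have WW': "(\<lambda>c. W c * adj (W c)) \<approx> P 0" .
  have P_M: "P i c \<in> M c" if "i < m" for i c using P(1)[OF that] D_sub_C C_sub_M by blast
  have W_M: "W c \<in> M c" for c unfolding W_def using m by (intro real_subalgebraD(3)[OF M_alg] P_M f_M)
  have WW_M: "adj (W c) * W c \<in> M c" for c by (intro real_subalgebraD(3)[OF M_alg] M_adj W_M)
  have dg: "diagonalizable (adj (W c) * W c)" for c
    by (rule M_diagonalizable[OF WW_M]) (simp add: adj_mult)
  obtain s where s: "\<And>c. adj (s c) = s c" "(\<lambda>c. W c * s c) \<approx> W"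
    "\<forall>\<^sub>F c in F. adj (W c * s c) * (W c * s c) = f 0 0 c"
    "\<And>c S. real_subalgebra S \<Longrightarrow> adj (W c) * W c \<in> S \<Longrightarrow> s c \<in> S"
    apply (rule asymptotic_normalize[OF dg f_proj[OF m] Wf0 WW bW])
    subgoal premises p by (rule p(1)[OF p(2-)])
    done
  define z where "z = (\<lambda>c. W c * s c)"
  have sf: "s c * f 0 0 c = s c" for c
  proof -
    have "real_subalgebra {x. x * f 0 0 c = x}"
      by (auto simp: real_subalgebra_def distrib_right mult.assoc)
    from s(4)[OF this, of c] show ?thesis by (simp add: mult.assoc Wf0)
  qed
  have zf: "z c * f 0 0 c = z c" for c by (simp add: z_def mult.assoc sf)
  have Pz: "P 0 c * z c = z c" for c using m by (simp add: z_def W_def mult.assoc[symmetric] Pi)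
  have z_M: "z c \<in> M c" for c
    unfolding z_def by (intro real_subalgebraD(3)[OF M_alg] W_M s(4)[OF M_alg WW_M])
  have zz: "\<forall>\<^sub>F c in F. adj (z c) * z c = f 0 0 c" using s(3) by (simp add: z_def)
  have zW: "z \<approx> W" using s(2) by (simp add: z_def)
  have zz': "\<forall>\<^sub>F c in F. z c * adj (z c) = P 0 c"
    by (rule asymptotic_coisometry[OF P(2)[OF m] Pz zf zz zW bW WW'])
  have z_f: "z \<approx> f 0 0" by (rule asymp_trans[OF zW Wf])
  have bz: "bdd z" by (rule bdd_asymp[OF z_f bf0])

  define u where "u = (\<lambda>c. \<Sum>i<m. adj (w i c) * (z c * f 0 i c))"
  have u_near: "u \<approx> (\<lambda>c. \<Sum>i<m. f i i c)"
    unfolding u_def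
  proof (rule asymp_sum)
    fix i assume "i \<in> {..<m}"
    then have i: "i < m" by simp
    have "(\<lambda>c. adj (w i c) * (z c * f 0 i c)) \<approx> (\<lambda>c. adj (f 0 i c) * (f 0 0 c * f 0 i c))"
      using i m by (intro asymp_mult asymp_adj wf z_f bdd_adj bdd_mult f_bdd bz bdd_asymp[OF wf]) auto
    also have "\<dots> = f i i" using i m by (auto simp: f_adj f_mult)
    finally show "(\<lambda>c. adj (w i c) * (z c * f 0 i c)) \<approx> f i i" .
  qed
  have w_M: "w i c \<in> M c" if "i < m" for i c
    using that
  proof (induction i)
    case (Suc i)
    then have "w i c \<in> M c" "V i c \<in> M c"
      using subsetD[OF C_sub_M subsetD[OF B_sub_C V(1)]] by auto
    then show ?case unfolding wS by (rule real_subalgebraD(3)[OF M_alg])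
  qed (use m P_M w0 in auto)
  have M_zero: "0 \<in> M c" for c using real_subalgebraD(5)[OF M_alg z_M] .
  have "(\<Sum>i<k. adj (w i c) * (z c * f 0 i c)) \<in> M c" if "k \<le> m" for k c using that
  proof (induction k)
    case (Suc k)
    then show ?case using m
      by (auto intro!: real_subalgebraD(1,3)[OF M_alg] M_adj w_M z_M f_M)
  qed (simp add: M_zero)
  then have u_M: "u c \<in> M c" for c by (simp add: u_def)

  have "\<forall>\<^sub>F c in F. \<forall>i\<in>{i. Suc i < m}. adj (V i c) * V i c = P (Suc i) c \<and> V i c * adj (V i c) = P i c"
  proof (rule eventually_ball_finite)
    show "finite {i. Suc i < m}" by (rule finite_subset[of _ "{..<m}"]) auto
    show "\<forall>i\<in>{i. Suc i < m}. \<forall>\<^sub>F c in F. adj (V i c) * V i c = P (Suc i) c \<and> V i c * adj (V i c) = P i c"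
      using V(4,5) by (auto intro: eventually_conj)
  qed
  then have "\<forall>\<^sub>F c in F. adj (u c) * u c = (\<Sum>i<m. f i i c) \<and>
      (\<forall>i<m. \<forall>j<m. b i \<le> b j \<longrightarrow> u c * f i j c * adj (u c) \<in> B c)"
    using zz zz'
  proof eventually_elim
    case (elim c)
    have VV: "adj (V i c) * V i c = P (Suc i) c" "V i c * adj (V i c) = P i c" if "Suc i < m" for i
      using elim(1) that by auto
    have ww: "w j c * adj (w j c) = P 0 c" if "j < m" for j
      using that
    proof (induction j)
      case (Suc j)
      have "w (Suc j) c * adj (w (Suc j) c) = w j c * (V j c * adj (V j c)) * adj (w j c)"
        by (simp add: wS adj_mult mult.assoc)
      also have "\<dots> = w j c * adj (w j c)" using VV Suc wP by simp
      finally show ?case using Suc by simp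
    qed (use m w0 Pa Pi in auto)
    have ww0: "w i c * adj (w j c) = 0" if "i < m" "j < m" "i \<noteq> j" for i j
    proof -
      have "w i c * adj (w j c) = w i c * (P i c * P j c) * adj (w j c)"
        using wP Pw' that by (simp add: mult.assoc) (simp add: mult.assoc[symmetric])
      then show ?thesis using P(4)[OF that] by simp
    qed
    have ww': "adj (w j c) * w j c = P j c" if "j < m" for j
      using that
    proof (induction j)
      case (Suc j)
      have "adj (w (Suc j) c) * w (Suc j) c = adj (V j c) * (adj (w j c) * w j c) * V j c"
        by (simp add: wS adj_mult mult.assoc)
      also have "\<dots> = adj (V j c) * V j c" using Suc V(6) by (simp add: mult.assoc)
      finally show ?case using VV Suc by simp
    qed (use m w0 Pa Pi in auto)
    have ascending: "adj (w i c) * w j c \<in> B c \<and> (b i = b j \<longrightarrow> adj (w i c) * w j c \<in> D c)"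
      if "i \<le> j" "j < m" for i j
      using that
    proof (induction j rule: dec_induct)
      case base
      then show ?case using ww' P(1) subsetD[OF D_sub_B P(1)] by auto
    next
      case (step j)
      have e: "adj (w i c) * w (Suc j) c = adj (w i c) * w j c * V j c" by (simp add: wS mult.assoc)
      have same: "b i = b j \<and> b j = b (Suc j)" if "b i = b (Suc j)"
        using that b_mono[of i j] b_mono[of j "Suc j"] step by auto
      have j: "Suc j < m" "j < m" using step by auto
      have "adj (w i c) * w j c \<in> B c" "b i = b j \<Longrightarrow> adj (w i c) * w j c \<in> D c"
        using step.IH j by auto
      then show ?case unfolding e
        using real_subalgebraD(3)[OF B_alg _ V(1)[OF j(1)]]
          real_subalgebraD(3)[OF D_alg _ V(2)[OF j(1)]] same by auto
    qed
    have uu: "adj (u c) * u c = (\<Sum>i<m. f i i c)"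
      "\<And>i j. i < m \<Longrightarrow> j < m \<Longrightarrow> u c * f i j c * adj (u c) = adj (w i c) * w j c"
    proof -
      have "w i c * adj (w j c) = (if i = j then P 0 c else 0)" if "i < m" "j < m" for i j
        using ww ww0 that by simp
      note uu_raw = conjugating_partial_isometry[OF m f_adj f_mult elim(2,3) Pz zf this Pw, where u = "u c"]
      show "adj (u c) * u c = (\<Sum>i<m. f i i c)"
        "\<And>i j. i < m \<Longrightarrow> j < m \<Longrightarrow> u c * f i j c * adj (u c) = adj (w i c) * w j c"
        by (rule uu_raw; simp add: u_def)+
    qed
    have "adj (w i c) * w j c \<in> B c" if "i < m" "j < m" "b i \<le> b j" for i j
    proof (cases "i \<le> j")
      case True
      then show ?thesis using ascending that by blast
    next
      case False
      then have "b i = b j" using b_mono[of j i] that by auto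
      then have "adj (w j c) * w i c \<in> D c" using ascending[of j i] False that by auto
      from subsetD[OF D_sub_B D_adj[OF this]] show ?thesis by (simp add: adj_mult)
    qed
    then show ?case using uu by auto
  qed
  from that[of u, OF u_M u_near this] show ?thesis .
qed

end

section \<open>Bounded families of square matrices\<close>

text \<open>
  A type that contains every \<open>M\<^sub>n\<close> as a corner: the bounded part of the product of all \<open>M\<^sub>n\<close>.  Sequences
  of matrices of varying sizes become sequences in one normed algebra.
\<close>

typedef matfam = "{x :: nat \<Rightarrow> complex mat. (\<forall>n. x n \<in> carrier_mat n n) \<and> bdd_above (range (\<lambda>n. op_norm (x n)))}"
  morphisms component Matfam
  by (rule exI[of _ "\<lambda>n. 0\<^sub>m n n"]) auto

lemma component_carrier [simp]: "component x n \<in> carrier_mat n n"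
  using component[of x] by auto

lemma component_dim [simp]: "dim_row (component x n) = n" "dim_col (component x n) = n"
  using component_carrier[of x n] by blast+

lemma component_bdd: "bdd_above (range (\<lambda>n. op_norm (component x n)))"
  using component[of x] by auto

lemma matfam_eqI: "(\<And>n. component x n = component y n) \<Longrightarrow> x = y"
  by (metis component_inject ext)

lemma component_Matfam:
  assumes "\<And>n. x n \<in> carrier_mat n n" "\<And>n. op_norm (x n) \<le> K"
  shows "component (Matfam x) n = x n"
  using assms by (subst Matfam_inverse) (auto intro!: bdd_aboveI[of _ K])

instantiation matfam :: cstar_normed_algebra
begin

definition "norm x = (SUP n. op_norm (component x n))"
definition "0 = Matfam (\<lambda>n. 0\<^sub>m n n)"
definition "x + y = Matfam (\<lambda>n. component x n + component y n)"
definition "c *\<^sub>R x = Matfam (\<lambda>n. complex_of_real c \<cdot>\<^sub>m component x n)"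
definition "- x = (-1::real) *\<^sub>R (x::matfam)"
definition "x - y = x + (- y :: matfam)"
definition "x * y = Matfam (\<lambda>n. component x n * component y n)"
definition "adj x = Matfam (\<lambda>n. mat_adjoint (component x n))"
definition "dist x y = norm (x - y :: matfam)"
definition "sgn x = inverse (norm x) *\<^sub>R (x::matfam)"
definition "uniformity = (INF e\<in>{0 <..}. principal {(x, y). dist x (y::matfam) < e})"
definition "open U \<longleftrightarrow> (\<forall>x\<in>U. \<forall>\<^sub>F (x', y) in uniformity. x' = x \<longrightarrow> y \<in> (U::matfam set))"

lemma op_norm_component: "op_norm (component x n) \<le> norm x"
  unfolding norm_matfam_def by (rule cSUP_upper[OF UNIV_I component_bdd])

lemma norm_matfam_le: "(\<And>n. op_norm (component x n) \<le> K) \<Longrightarrow> norm x \<le> K"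
  unfolding norm_matfam_def by (rule cSUP_least) auto

lemma component_zero [simp]: "component 0 n = 0\<^sub>m n n"
  unfolding zero_matfam_def by (rule component_Matfam[where K = 0]) auto

lemma component_add [simp]: "component (x + y) n = component x n + component y n"
  unfolding plus_matfam_def
  by (rule component_Matfam[where K = "norm x + norm y"])
    (auto intro!: add_mono op_norm_component order_trans[OF op_norm_triangle] component_carrier)

lemma component_mult [simp]: "component (x * y) n = component x n * component y n"
  unfolding times_matfam_def
proof (rule component_Matfam[where K = "norm x * norm y"])
  show "op_norm (component x k * component y k) \<le> norm x * norm y" for k
    using op_norm_mult[of "component x k" k k "component y k" k]
      mult_mono[OF op_norm_component[of x k] op_norm_component[of y k]]
      order_trans[OF op_norm_nonneg op_norm_component[of x k]] by simp
qed (auto intro: mult_carrier_mat[OF component_carrier component_carrier])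

lemma component_scaleR [simp]: "component (c *\<^sub>R x) n = complex_of_real c \<cdot>\<^sub>m component x n"
  unfolding scaleR_matfam_def
  by (rule component_Matfam[where K = "\<bar>c\<bar> * norm x"])
    (auto simp: op_norm_smult intro!: mult_left_mono op_norm_component)

lemma component_adj [simp]: "component (adj x) n = mat_adjoint (component x n)"
  unfolding adj_matfam_def
  by (rule component_Matfam[where K = "norm x"])
    (auto intro: order_trans[OF op_norm_adjoint op_norm_component] component_carrier)

lemma component_uminus [simp]: "component (- x) n = - component x n"
  unfolding uminus_matfam_def component_scaleR by (rule eq_matI) auto

lemma component_diff [simp]: "component (x - y) n = component x n - component y n"
  unfolding minus_matfam_def component_add component_uminus by (rule eq_matI) auto

instance
proof
  fix x y z :: matfam and a b :: real
  show "x + y + z = x + (y + z)" "x + y = y + x" "0 + x = x"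
    by (rule matfam_eqI, rule eq_matI; simp)+
  show "- x + x = 0" by (rule matfam_eqI, rule eq_matI) simp_all
  show "x - y = x + - y" by (rule minus_matfam_def)
  show "a *\<^sub>R (x + y) = a *\<^sub>R x + a *\<^sub>R y" "(a + b) *\<^sub>R x = a *\<^sub>R x + b *\<^sub>R x"
    "a *\<^sub>R b *\<^sub>R x = (a * b) *\<^sub>R x" "1 *\<^sub>R x = x"
    by (rule matfam_eqI, rule eq_matI; simp add: algebra_simps)+
  show "x * y * z = x * (y * z)"
    by (rule matfam_eqI)
      (simp add: assoc_mult_mat[OF component_carrier component_carrier component_carrier])
  show "(x + y) * z = x * z + y * z"
    by (rule matfam_eqI)
      (simp add: add_mult_distrib_mat[OF component_carrier component_carrier component_carrier])
  show "x * (y + z) = x * y + x * z"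
    by (rule matfam_eqI)
      (simp add: mult_add_distrib_mat[OF component_carrier component_carrier component_carrier])
  show "a *\<^sub>R x * y = a *\<^sub>R (x * y)"
    by (rule matfam_eqI) (simp add: mult_smult_assoc_mat[OF component_carrier component_carrier])
  show "x * a *\<^sub>R y = a *\<^sub>R (x * y)"
    by (rule matfam_eqI) (simp add: mult_smult_distrib[OF component_carrier component_carrier])
  show "dist x y = norm (x - y)" by (rule dist_matfam_def)
  show "sgn x = inverse (norm x) *\<^sub>R x" by (rule sgn_matfam_def)
  show "uniformity = (INF e\<in>{0 <..}. principal {(x, y). dist x (y::matfam) < e})"
    by (rule uniformity_matfam_def)
  show "open U \<longleftrightarrow> (\<forall>x\<in>U. \<forall>\<^sub>F (x', y) in uniformity. x' = x \<longrightarrow> y \<in> U)" for U :: "matfam set"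
    by (rule open_matfam_def)
  show "norm x = 0 \<longleftrightarrow> x = 0"
  proof
    assume "norm x = 0"
    then have z: "op_norm (component x n) = 0" for n
      using op_norm_component[of x n] op_norm_nonneg[of "component x n"] by simp
    show "x = 0"
      by (rule matfam_eqI, rule eq_matI)
        (use entry_le_op_norm[OF component_carrier[of x]] z in auto)
  qed (simp add: norm_matfam_def)
  show "norm (x + y) \<le> norm x + norm y"
    by (rule norm_matfam_le)
      (simp add: order_trans[OF op_norm_triangle[OF component_carrier component_carrier]] add_mono op_norm_component)
  show "norm (x * y) \<le> norm x * norm y"
  proof (rule norm_matfam_le)
    fix n
    have "op_norm (component (x * y) n) \<le> op_norm (component x n) * op_norm (component y n)"
      using op_norm_mult[OF component_carrier component_carrier] by simp
    also have "\<dots> \<le> norm x * norm y"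
      using order_trans[OF op_norm_nonneg op_norm_component] by (intro mult_mono op_norm_component) auto
    finally show "op_norm (component (x * y) n) \<le> norm x * norm y" .
  qed
  show "norm (a *\<^sub>R x) = \<bar>a\<bar> * norm x"
  proof (rule antisym)
    have le: "norm (c *\<^sub>R y) \<le> \<bar>c\<bar> * norm y" for c and y :: matfam
      by (rule norm_matfam_le) (simp add: op_norm_smult mult_left_mono op_norm_component)
    show "norm (a *\<^sub>R x) \<le> \<bar>a\<bar> * norm x" by (rule le)
    show "\<bar>a\<bar> * norm x \<le> norm (a *\<^sub>R x)"
    proof (cases "a = 0")
      case True
      have "0 \<le> op_norm (component (a *\<^sub>R x) 0)" by (rule op_norm_nonneg)
      also have "\<dots> \<le> norm (a *\<^sub>R x)" by (rule op_norm_component)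
      finally show ?thesis using True by simp
    next
      case False
      have "inverse a *\<^sub>R a *\<^sub>R x = x"
        by (rule matfam_eqI, rule eq_matI) (use False in auto)
      then have "norm x \<le> \<bar>inverse a\<bar> * norm (a *\<^sub>R x)" using le[of "inverse a" "a *\<^sub>R x"] by simp
      then have "\<bar>a\<bar> * norm x \<le> \<bar>a\<bar> * (\<bar>inverse a\<bar> * norm (a *\<^sub>R x))" by (rule mult_left_mono) simp
      then show ?thesis using False by (simp add: mult.assoc[symmetric] abs_mult[symmetric])
    qed
  qed
  show "adj (adj x) = x" by (rule matfam_eqI) simp
  show "adj (x + y) = adj x + adj y"
    by (rule matfam_eqI) (simp add: mat_adjoint_add[OF component_carrier component_carrier])
  show "adj (x * y) = adj y * adj x"
    by (rule matfam_eqI) (simp add: mat_adjoint_mult[OF component_carrier component_carrier])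
  show "adj (a *\<^sub>R x) = a *\<^sub>R adj x"
    by (rule matfam_eqI) (simp add: mat_adjoint_smult)
  show "(norm x)\<^sup>2 \<le> norm (adj x * x)"
  proof -
    have "op_norm (component x n) \<le> sqrt (norm (adj x * x))" for n
      using op_norm_adjoint_mult[OF component_carrier[of x n]] op_norm_component[of "adj x * x" n]
      by (intro real_le_rsqrt) simp
    then have "norm x \<le> sqrt (norm (adj x * x))" by (rule norm_matfam_le)
    moreover have "0 \<le> norm x" using order_trans[OF op_norm_nonneg op_norm_component] .
    moreover have "0 \<le> norm (adj x * x)" using order_trans[OF op_norm_nonneg op_norm_component] .
    ultimately show ?thesis using power_mono[of "norm x" "sqrt (norm (adj x * x))" 2] by simp
  qed
qed

end

definition embed :: "nat \<Rightarrow> complex mat \<Rightarrow> matfam" where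
  "embed n a = Matfam (\<lambda>k. if k = n then a else 0\<^sub>m k k)"

lemma component_embed:
  assumes "a \<in> carrier_mat n n"
  shows "component (embed n a) k = (if k = n then a else 0\<^sub>m k k)"
  unfolding embed_def by (rule component_Matfam[where K = "op_norm a"]) (use assms in auto)

lemma component_embed_same [simp]: "a \<in> carrier_mat n n \<Longrightarrow> component (embed n a) n = a"
  by (simp add: component_embed)

lemma norm_embed:
  assumes a: "a \<in> carrier_mat n n"
  shows "norm (embed n a) = op_norm a"
proof (rule antisym)
  show "norm (embed n a) \<le> op_norm a"
    by (rule norm_matfam_le) (simp add: component_embed[OF a])
  show "op_norm a \<le> norm (embed n a)"
    using op_norm_component[of "embed n a" n] a by simp
qed

lemma embed_add: "a \<in> carrier_mat n n \<Longrightarrow> b \<in> carrier_mat n n \<Longrightarrow> embed n (a + b) = embed n a + embed n b"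
  by (rule matfam_eqI) (simp add: component_embed)

lemma embed_diff: "a \<in> carrier_mat n n \<Longrightarrow> b \<in> carrier_mat n n \<Longrightarrow> embed n (a - b) = embed n a - embed n b"
  by (rule matfam_eqI, rule eq_matI) (auto simp: component_embed minus_carrier_mat)

lemma embed_mult: "a \<in> carrier_mat n n \<Longrightarrow> b \<in> carrier_mat n n \<Longrightarrow> embed n (a * b) = embed n a * embed n b"
  by (rule matfam_eqI) (simp add: component_embed)

lemma embed_scaleR: "a \<in> carrier_mat n n \<Longrightarrow> embed n (complex_of_real c \<cdot>\<^sub>m a) = c *\<^sub>R embed n a"
  by (rule matfam_eqI) (simp add: component_embed)

lemma embed_zero: "embed n (0\<^sub>m n n) = 0"
  by (rule matfam_eqI) (simp add: component_embed)

lemma embed_adj: "a \<in> carrier_mat n n \<Longrightarrow> embed n (mat_adjoint a) = adj (embed n a)"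
  by (rule matfam_eqI) (simp add: component_embed adjoint_zero_mat)

lemma embed_inject:
  "a \<in> carrier_mat n n \<Longrightarrow> b \<in> carrier_mat n n \<Longrightarrow> embed n a = embed n b \<longleftrightarrow> a = b"
  by (metis component_embed_same)

abbreviation matrices :: "nat \<Rightarrow> matfam set" where
  "matrices n \<equiv> embed n ` carrier_mat n n"

lemma trace_sum:
  "(\<Sum>i<n. component (\<Sum>k<N. e k) n $$ (i,i)) = (\<Sum>k<(N::nat). \<Sum>i<n. component (e k) n $$ (i,i))"
  by (induction N) (auto simp: sum.distrib)

text \<open>
  The sum of the projections is a projection, so each of its \<open>n\<close> diagonal entries has modulus at most
  \<open>1\<close>, while its trace is \<open>N\<close>.
\<close>

lemma orthogonal_projections_card:
  assumes e: "\<And>i. i < N \<Longrightarrow> projection (e i)" "\<And>i j. i < N \<Longrightarrow> j < N \<Longrightarrow> i \<noteq> j \<Longrightarrow> e i * e j = 0"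
    and tr: "\<And>i. i < N \<Longrightarrow> (\<Sum>a<n. component (e i) n $$ (a,a)) = 1"
  shows "N \<le> n"
proof -
  define p where "p = (\<Sum>i<N. e i)"
  have "p * p = (\<Sum>i<N. \<Sum>j<N. if i = j then e i else 0)"
    unfolding p_def sum_product using e by (intro sum.cong) (auto simp: projection_def)
  moreover have "adj p = p"
    unfolding p_def adj_sum using e by (intro sum.cong) (auto simp: projection_def)
  ultimately have "projection p" by (simp add: projection_def p_def)
  then have p1: "norm p \<le> 1" by (rule projection_norm_le)
  have "complex_of_real (real N) = (\<Sum>i<N. \<Sum>a<n. component (e i) n $$ (a,a))"
    using tr by simp
  also have "\<dots> = (\<Sum>a<n. component p n $$ (a,a))" by (simp add: p_def trace_sum)
  finally have "real N = cmod (\<Sum>a<n. component p n $$ (a,a))" by (metis norm_of_nat of_real_of_nat_eq)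
  also have "\<dots> \<le> (\<Sum>a<n. 1)"
    using order_trans[OF entry_le_op_norm[OF component_carrier] order_trans[OF op_norm_component p1]]
    by (intro sum_norm_le) auto
  finally show ?thesis by simp
qed

text \<open>
  Take a family of orthogonal eigenprojections of maximal size and subtract its contribution from
  \<open>h\<close>.  If the difference \<open>k\<close> were not \<open>0\<close>, it would have an eigenprojection for a nonzero eigenvalue;
  as \<open>k\<close> annihilates the family, so does that projection, and it would enlarge the family.
\<close>

lemma matrices_diagonalizable:
  assumes h: "h \<in> matrices n" and sa: "adj h = h"
  shows "diagonalizable h"
proof -
  define good where "good N l e \<longleftrightarrow> (\<forall>i<N. projection (e i) \<and> e i \<in> matrices n \<and>
      (\<Sum>a<n. component (e i) n $$ (a,a)) = 1 \<and> h * e i = l i *\<^sub>R e i) \<and>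
      (\<forall>i<N. \<forall>j<N. i \<noteq> j \<longrightarrow> e i * e j = 0)" for N :: nat and l :: "nat \<Rightarrow> real" and e
  have good_le: "N \<le> n" if "good N l e" for N l e
    using that orthogonal_projections_card[of N e n] by (auto simp: good_def)
  define Ns where "Ns = {N. \<exists>l e. good N l e}"
  have "Ns \<subseteq> {..n}" using good_le by (auto simp: Ns_def)
  then have fin: "finite Ns" by (rule finite_subset) simp
  have "0 \<in> Ns" by (simp add: Ns_def good_def)
  then have "Max Ns \<in> Ns" using fin by (intro Max_in) auto
  moreover define N where "N = Max Ns"
  ultimately have "\<exists>l e. good N l e" by (simp add: Ns_def)
  then obtain l e where g: "good N l e" by auto
  have e: "projection (e i)" "e i \<in> matrices n" "(\<Sum>a<n. component (e i) n $$ (a,a)) = 1"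
    "h * e i = l i *\<^sub>R e i" if "i < N" for i using g that by (auto simp: good_def)
  have orth: "e i * e j = 0" if "i < N" "j < N" "i \<noteq> j" for i j using g that by (auto simp: good_def)
  have ee: "e i * e i = e i" "adj (e i) = e i" if "i < N" for i
    using e(1)[OF that] by (auto simp: projection_def)
  define k where "k = h - (\<Sum>i<N. l i *\<^sub>R e i)"
  have ke: "k * e i = 0" if "i < N" for i
  proof -
    have "(\<Sum>j<N. l j *\<^sub>R e j) * e i = (\<Sum>j<N. if j = i then l i *\<^sub>R e i else 0)"
      unfolding sum_distrib_right using that ee orth by (intro sum.cong) auto
    then show ?thesis using that e(4) by (simp add: k_def left_diff_distrib)
  qed
  have k_adj: "adj k = k"
    unfolding k_def adj_diff sa adj_sum using ee by (simp add: adj_scaleR)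
  have ek: "e i * k = 0" if "i < N" for i
    using arg_cong[OF ke[OF that], of adj] that by (simp add: adj_mult k_adj ee)
  have "k = 0"
  proof (rule ccontr)
    assume "k \<noteq> 0"
    define a where "a = component k n"
    have comp0: "component x j = 0\<^sub>m j j" if "x \<in> matrices n" "j \<noteq> n" for x j
      using that by (auto simp: component_embed)
    have "component (\<Sum>i<M. l i *\<^sub>R e i) j = 0\<^sub>m j j" if "j \<noteq> n" "M \<le> N" for M j
      using that(2)
    proof (induction M)
      case (Suc M)
      then show ?case using comp0[OF e(2), of M j] that(1) by simp
    qed simp
    then have "component k j = 0\<^sub>m j j" if "j \<noteq> n" for j
      using that comp0[OF h that] by (simp add: k_def)
    then have ka: "k = embed n a"
      by (intro matfam_eqI) (simp add: component_embed a_def)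
    have a: "a \<in> carrier_mat n n" by (simp add: a_def)
    have "mat_adjoint a = a" using arg_cong[OF k_adj, of "\<lambda>x. component x n"] by (simp add: a_def)
    moreover have "a \<noteq> 0\<^sub>m n n" using \<open>k \<noteq> 0\<close> ka embed_zero by auto
    ultimately obtain t :: real and p where t: "t \<noteq> 0" "p \<in> carrier_mat n n" "mat_adjoint p = p"
      "p * p = p" "a * p = of_real t \<cdot>\<^sub>m p" "(\<Sum>i<n. p $$ (i,i)) = 1"
      using self_adjoint_eigenprojection[OF a] by metis
    define q where "q = embed n p"
    have q: "projection q" "q \<in> matrices n" "(\<Sum>i<n. component q n $$ (i,i)) = 1" "k * q = t *\<^sub>R q"
      using t a by (auto simp: q_def ka projection_def embed_adj[symmetric] embed_mult[symmetric] embed_scaleR[symmetric])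
    have eq: "e i * q = 0" if "i < N" for i
    proof -
      have "t *\<^sub>R (e i * q) = e i * (k * q)" using q(4) by simp
      also have "\<dots> = 0" using ek[OF that] by (simp add: mult.assoc[symmetric])
      finally show ?thesis using t(1) by simp
    qed
    have qa: "adj q = q" using q(1) by (simp add: projection_def)
    have qe: "q * e i = 0" if "i < N" for i
      using arg_cong[OF eq[OF that], of adj] that by (simp add: adj_mult qa ee)
    have "(\<Sum>i<N. l i *\<^sub>R e i) * q = 0" unfolding sum_distrib_right using eq by simp
    then have hq: "h * q = t *\<^sub>R q" using q(4) by (simp add: k_def left_diff_distrib)
    have "good (Suc N) (l(N := t)) (e(N := q))"
      unfolding good_def using e orth q hq eq qe by (auto simp: less_Suc_eq)
    then have "Suc N \<in> Ns" by (auto simp: Ns_def)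
    then have "Suc N \<le> N" using fin by (simp add: N_def)
    then show False by simp
  qed
  then have "h = (\<Sum>i<N. l i *\<^sub>R e i)" by (simp add: k_def)
  moreover have "e i \<noteq> 0" if "i < N" for i using e(3)[OF that] by auto
  ultimately show ?thesis unfolding diagonalizable_def using e orth by blast
qed

section \<open>Matrix units and nest algebras\<close>

definition matrix_unit :: "nat \<Rightarrow> nat \<Rightarrow> nat \<Rightarrow> complex mat" where
  "matrix_unit m i j = mat m m (\<lambda>(a,b). if a = i \<and> b = j then 1 else 0)"

lemma matrix_unit_carrier [simp]: "matrix_unit m i j \<in> carrier_mat m m"
  by (simp add: matrix_unit_def)

lemma matrix_unit_index [simp]:
  "a < m \<Longrightarrow> b < m \<Longrightarrow> matrix_unit m i j $$ (a,b) = (if a = i \<and> b = j then 1 else 0)"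
  by (simp add: matrix_unit_def)

lemma matrix_unit_dim [simp]: "dim_row (matrix_unit m i j) = m" "dim_col (matrix_unit m i j) = m"
  by (simp_all add: matrix_unit_def)

lemma adjoint_matrix_unit: "mat_adjoint (matrix_unit m i j) = matrix_unit m j i"
  by (rule eq_matI) auto

lemma matrix_unit_mult:
  assumes "j < m" "k < m"
  shows "matrix_unit m i j * matrix_unit m k l = (if j = k then matrix_unit m i l else 0\<^sub>m m m)"
proof (rule eq_matI)
  fix a b assume "a < dim_row (if j = k then matrix_unit m i l else 0\<^sub>m m m)"
    "b < dim_col (if j = k then matrix_unit m i l else 0\<^sub>m m m)"
  then have ab: "a < m" "b < m" by (auto split: if_splits)
  have "(matrix_unit m i j * matrix_unit m k l) $$ (a,b)
      = (\<Sum>c<m. if c = j then (if a = i \<and> j = k \<and> b = l then 1 else 0) else 0)"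
    unfolding mult_mat_index_sum[OF matrix_unit_carrier matrix_unit_carrier ab]
    using ab by (intro sum.cong) auto
  then show "(matrix_unit m i j * matrix_unit m k l) $$ (a,b) =
      (if j = k then matrix_unit m i l else 0\<^sub>m m m) $$ (a,b)"
    using ab assms by simp
qed auto

text \<open>
  Restricting a matrix to a set of positions; filling the positions one after the other gives an
  induction principle that avoids sums of matrices.
\<close>

definition mask :: "nat \<Rightarrow> (nat \<times> nat) set \<Rightarrow> complex mat \<Rightarrow> complex mat" where
  "mask m T x = mat m m (\<lambda>ij. if ij \<in> T then x $$ ij else 0)"

lemma mask_carrier [simp]: "mask m T x \<in> carrier_mat m m"
  by (simp add: mask_def)

lemma mask_empty: "mask m {} x = 0\<^sub>m m m"
  by (rule eq_matI) (auto simp: mask_def)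

lemma mask_full: "x \<in> carrier_mat m m \<Longrightarrow> mask m ({..<m} \<times> {..<m}) x = x"
  by (rule eq_matI) (auto simp: mask_def)

lemma mask_insert:
  assumes "(i,j) \<notin> T"
  shows "mask m (insert (i,j) T) x = mask m T x + x $$ (i,j) \<cdot>\<^sub>m matrix_unit m i j"
  using assms by (intro eq_matI) (auto simp: mask_def)

lemma matrix_units_span:
  assumes x: "x \<in> carrier_mat m m" and zero: "0\<^sub>m m m \<in> S"
    and add: "\<And>y z. y \<in> S \<Longrightarrow> z \<in> S \<Longrightarrow> y + z \<in> S"
    and units: "\<And>i j. i < m \<Longrightarrow> j < m \<Longrightarrow> x $$ (i,j) \<noteq> 0 \<Longrightarrow> x $$ (i,j) \<cdot>\<^sub>m matrix_unit m i j \<in> S"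
  shows "x \<in> S"
proof -
  have "mask m T x \<in> S" if "T \<subseteq> {..<m} \<times> {..<m}" for T
    using finite_subset[OF that finite_SigmaI[OF finite_lessThan finite_lessThan]] that
  proof (induction T rule: finite_induct)
    case (insert ij T)
    obtain i j where ij: "ij = (i,j)" by (cases ij)
    have "x $$ (i,j) \<cdot>\<^sub>m matrix_unit m i j \<in> S"
    proof (cases "x $$ (i,j) = 0")
      case True
      then have "x $$ (i,j) \<cdot>\<^sub>m matrix_unit m i j = 0\<^sub>m m m" by (intro eq_matI) auto
      then show ?thesis using zero by simp
    qed (use units insert ij in auto)
    then show ?case using insert ij by (auto simp: mask_insert intro: add)
  qed (simp add: mask_empty zero)
  from this[of "{..<m} \<times> {..<m}"] show ?thesis by (simp add: mask_full[OF x])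
qed

lemma sum_list_take_mono: "k \<le> l \<Longrightarrow> sum_list (take k ns) \<le> sum_list (take l (ns :: nat list))"
proof -
  assume "k \<le> l"
  then have "take l ns = take k ns @ take (l - k) (drop k ns)" by (metis le_add_diff_inverse take_add)
  then show ?thesis by simp
qed

lemma ex_block:
  "i < sum_list (take k ns) \<Longrightarrow> \<exists>p<k. sum_list (take p ns) \<le> i \<and> i < sum_list (take (Suc p) (ns :: nat list))"
proof (induction k)
  case (Suc k)
  show ?case
  proof (cases "i < sum_list (take k ns)")
    case True
    from Suc.IH[OF this] obtain p where "p < k" "sum_list (take p ns) \<le> i" "i < sum_list (take (Suc p) ns)"
      by (elim exE conjE)
    then show ?thesis by (intro exI[of _ p] conjI) simp_all
  next
    case False
    then show ?thesis using Suc.prems by (intro exI[of _ k] conjI) simp_all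
  qed
qed simp

lemma nest_algebra_iff:
  "x \<in> nest_algebra ns \<longleftrightarrow> x \<in> carrier_mat (sum_list ns) (sum_list ns) \<and>
    (\<forall>l\<le>length ns. \<forall>i<sum_list ns. \<forall>j<sum_list (take l ns). sum_list (take l ns) \<le> i \<longrightarrow> x $$ (i,j) = 0)"
    (is "?L \<longleftrightarrow> ?C \<and> ?R")
proof (intro iffI conjI)
  assume ?L
  then show ?C by (simp add: nest_algebra_def)
  show ?R
  proof (intro allI impI)
    fix l i j assume l: "l \<le> length ns" "i < sum_list ns" "j < sum_list (take l ns)" "sum_list (take l ns) \<le> i"
    obtain q where q: "q < l" "sum_list (take q ns) \<le> j" "j < sum_list (take (Suc q) ns)"
      using ex_block[OF l(3)] by (elim exE conjE)
    have "\<exists>p<length ns. sum_list (take p ns) \<le> i \<and> i < sum_list (take (Suc p) ns)"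
      using l by (intro ex_block) simp
    then obtain p where p: "p < length ns" "sum_list (take p ns) \<le> i" "i < sum_list (take (Suc p) ns)"
      by (elim exE conjE)
    have "q < p"
    proof (rule ccontr)
      assume "\<not> q < p"
      then have "sum_list (take (Suc p) ns) \<le> sum_list (take l ns)"
        using q by (intro sum_list_take_mono) auto
      then show False using p l by simp
    qed
    then show "x $$ (i,j) = 0" using \<open>?L\<close> p q by (simp add: nest_algebra_def block_def)
  qed
next
  assume R: "?C \<and> ?R"
  show ?L
    unfolding nest_algebra_def
  proof (intro CollectI conjI allI impI ballI)
    fix p q i j assume p: "p < length ns" "q < p" "i \<in> block ns p" "j \<in> block ns q"
    have "sum_list (take (Suc q) ns) \<le> sum_list (take p ns)" using p by (intro sum_list_take_mono) auto
    moreover have "sum_list (take (Suc p) ns) \<le> sum_list ns"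
      using sum_list_take_mono[of "Suc p" "length ns" ns] p by simp
    ultimately have *: "i < sum_list ns" "j < sum_list (take p ns)" "sum_list (take p ns) \<le> i"
      using p by (auto simp: block_def)
    show "x $$ (i,j) = 0" by (rule conjunct2[OF R, rule_format, OF less_imp_le[OF p(1)] *])
  qed (rule conjunct1[OF R])
qed

text \<open>
  A monotone numbering of the blocks: indices have the same level exactly if no partial sum of the
  block sizes separates them.  Only comparisons of levels matter.
\<close>

definition level :: "nat list \<Rightarrow> nat \<Rightarrow> nat" where
  "level ns i = card {l. l \<le> length ns \<and> sum_list (take l ns) \<le> i}"

lemma level_finite: "finite {l. l \<le> length ns \<and> sum_list (take l ns) \<le> i}"
  by (rule finite_subset[of _ "{..length ns}"]) auto

lemma level_mono: "i \<le> j \<Longrightarrow> level ns i \<le> level ns j"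
  unfolding level_def by (intro card_mono level_finite) auto

lemma level_less_iff:
  "level ns j < level ns i \<longleftrightarrow> (\<exists>l\<le>length ns. j < sum_list (take l ns) \<and> sum_list (take l ns) \<le> i)"
proof
  assume less: "level ns j < level ns i"
  have "\<not> {l. l \<le> length ns \<and> sum_list (take l ns) \<le> i} \<subseteq> {l. l \<le> length ns \<and> sum_list (take l ns) \<le> j}"
  proof
    assume "{l. l \<le> length ns \<and> sum_list (take l ns) \<le> i} \<subseteq> {l. l \<le> length ns \<and> sum_list (take l ns) \<le> j}"
    then have "level ns i \<le> level ns j" unfolding level_def by (rule card_mono[OF level_finite])
    then show False using less by simp
  qed
  then show "\<exists>l\<le>length ns. j < sum_list (take l ns) \<and> sum_list (take l ns) \<le> i" by auto
next
  assume "\<exists>l\<le>length ns. j < sum_list (take l ns) \<and> sum_list (take l ns) \<le> i"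
  then obtain l where l: "l \<le> length ns" "j < sum_list (take l ns)" "sum_list (take l ns) \<le> i" by blast
  show "level ns j < level ns i"
    unfolding level_def
  proof (rule psubset_card_mono[OF level_finite psubsetI])
    show "{l. l \<le> length ns \<and> sum_list (take l ns) \<le> j} \<subseteq> {l. l \<le> length ns \<and> sum_list (take l ns) \<le> i}"
      using l by auto
    show "{l. l \<le> length ns \<and> sum_list (take l ns) \<le> j} \<noteq> {l. l \<le> length ns \<and> sum_list (take l ns) \<le> i}"
    proof
      assume eq: "{l. l \<le> length ns \<and> sum_list (take l ns) \<le> j} = {l. l \<le> length ns \<and> sum_list (take l ns) \<le> i}"
      have "l \<in> {l. l \<le> length ns \<and> sum_list (take l ns) \<le> i}" using l by simp
      then have "sum_list (take l ns) \<le> j" unfolding eq[symmetric] by simp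
      then show False using l by simp
    qed
  qed
qed

lemma nest_algebra_level:
  "x \<in> nest_algebra ns \<longleftrightarrow> x \<in> carrier_mat (sum_list ns) (sum_list ns) \<and>
    (\<forall>i<sum_list ns. \<forall>j<sum_list ns. x $$ (i,j) \<noteq> 0 \<longrightarrow> level ns i \<le> level ns j)"
  unfolding nest_algebra_iff
proof (intro conj_cong refl iffI allI impI)
  fix i j
  assume R: "\<forall>l\<le>length ns. \<forall>i<sum_list ns. \<forall>j<sum_list (take l ns). sum_list (take l ns) \<le> i \<longrightarrow> x $$ (i,j) = 0"
    and ij: "i < sum_list ns" "x $$ (i,j) \<noteq> 0"
  show "level ns i \<le> level ns j"
  proof (rule ccontr)
    assume "\<not> level ns i \<le> level ns j"
    then obtain l where "l \<le> length ns" "j < sum_list (take l ns)" "sum_list (take l ns) \<le> i"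
      using level_less_iff[of ns j i] by auto
    then have "x $$ (i,j) = 0" using R[rule_format, of l i j] ij(1) by simp
    then show False using ij(2) by simp
  qed
next
  fix l i j
  assume R: "\<forall>i<sum_list ns. \<forall>j<sum_list ns. x $$ (i,j) \<noteq> 0 \<longrightarrow> level ns i \<le> level ns j"
    and l: "l \<le> length ns" "i < sum_list ns" "j < sum_list (take l ns)" "sum_list (take l ns) \<le> i"
  have "j < sum_list ns" using l(3) sum_list_take_mono[OF l(1), of ns] by simp
  moreover have "level ns j < level ns i" unfolding level_less_iff using l by blast
  ultimately show "x $$ (i,j) = 0" using R[rule_format, of i j] l(2) by auto
qed

lemma nest_algebra_carrier: "x \<in> nest_algebra ns \<Longrightarrow> x \<in> carrier_mat (sum_list ns) (sum_list ns)"
  by (simp add: nest_algebra_def)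

lemma matrix_unit_in_nest_algebra:
  "level ns i \<le> level ns j \<Longrightarrow> matrix_unit (sum_list ns) i j \<in> nest_algebra ns"
  by (simp add: nest_algebra_level)

lemma nest_algebra_zero: "0\<^sub>m (sum_list ns) (sum_list ns) \<in> nest_algebra ns"
  by (simp add: nest_algebra_level)

lemma nest_algebra_add: "x \<in> nest_algebra ns \<Longrightarrow> y \<in> nest_algebra ns \<Longrightarrow> x + y \<in> nest_algebra ns"
  unfolding nest_algebra_level
proof (elim conjE, intro conjI allI impI)
  let ?m = "sum_list ns"
  assume c: "x \<in> carrier_mat ?m ?m" "y \<in> carrier_mat ?m ?m"
    and x: "\<forall>i<?m. \<forall>j<?m. x $$ (i,j) \<noteq> 0 \<longrightarrow> level ns i \<le> level ns j"
    and y: "\<forall>i<?m. \<forall>j<?m. y $$ (i,j) \<noteq> 0 \<longrightarrow> level ns i \<le> level ns j"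
  show "x + y \<in> carrier_mat ?m ?m" using c by simp
  fix i j assume ij: "i < ?m" "j < ?m" "(x + y) $$ (i,j) \<noteq> 0"
  then have "x $$ (i,j) \<noteq> 0 \<or> y $$ (i,j) \<noteq> 0" using c by auto
  then show "level ns i \<le> level ns j" using x y ij by blast
qed

lemma nest_algebra_smult: "x \<in> nest_algebra ns \<Longrightarrow> c \<cdot>\<^sub>m x \<in> nest_algebra ns"
  by (auto simp: nest_algebra_level)

lemma nest_algebra_mult:
  assumes x: "x \<in> nest_algebra ns" and y: "y \<in> nest_algebra ns"
  shows "x * y \<in> nest_algebra ns"
  unfolding nest_algebra_level
proof (intro conjI allI impI)
  note c = nest_algebra_carrier[OF x] nest_algebra_carrier[OF y]
  show "x * y \<in> carrier_mat (sum_list ns) (sum_list ns)" using c by auto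
  fix i j assume ij: "i < sum_list ns" "j < sum_list ns" and nz: "(x * y) $$ (i,j) \<noteq> 0"
  have "(\<Sum>a<sum_list ns. x $$ (i,a) * y $$ (a,j)) \<noteq> 0"
    using nz unfolding mult_mat_index_sum[OF c ij] .
  then obtain a where a: "a \<in> {..<sum_list ns}" "x $$ (i,a) * y $$ (a,j) \<noteq> 0"
    by (rule sum.not_neutral_contains_not_neutral)
  then have "level ns i \<le> level ns a" "level ns a \<le> level ns j"
    using x y ij by (auto simp: nest_algebra_level)
  then show "level ns i \<le> level ns j" by simp
qed

definition nest_projection :: "nat \<Rightarrow> nat \<Rightarrow> complex mat" where
  "nest_projection m k = mat m m (\<lambda>(i,j). if i = j \<and> i < k then 1 else 0)"

lemma nest_projection_carrier [simp]: "nest_projection m k \<in> carrier_mat m m"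
  by (simp add: nest_projection_def)

lemma nest_projection_dim [simp]:
  "dim_row (nest_projection m k) = m" "dim_col (nest_projection m k) = m"
  by (simp_all add: nest_projection_def)

lemma nest_projection_mult_left:
  assumes x: "x \<in> carrier_mat m m" and ij: "i < m" "j < m"
  shows "(nest_projection m k * x) $$ (i,j) = (if i < k then x $$ (i,j) else 0)"
proof -
  have "(nest_projection m k * x) $$ (i,j) = (\<Sum>a<m. if a = i then (if i < k then x $$ (i,j) else 0) else 0)"
    unfolding mult_mat_index_sum[OF nest_projection_carrier x ij]
    using ij by (intro sum.cong) (auto simp: nest_projection_def)
  then show ?thesis using ij by simp
qed

lemma nest_projection_mult_right:
  assumes x: "x \<in> carrier_mat m m" and ij: "i < m" "j < m"
  shows "(x * nest_projection m k) $$ (i,j) = (if j < k then x $$ (i,j) else 0)"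
proof -
  have "(x * nest_projection m k) $$ (i,j) = (\<Sum>a<m. if a = j then (if j < k then x $$ (i,j) else 0) else 0)"
    unfolding mult_mat_index_sum[OF x nest_projection_carrier ij]
    using ij by (intro sum.cong) (auto simp: nest_projection_def)
  then show ?thesis using ij by simp
qed

lemma adjoint_nest_projection: "mat_adjoint (nest_projection m k) = nest_projection m k"
  by (rule eq_matI) (auto simp: nest_projection_def)

lemma nest_projection_mult:
  "k \<le> l \<Longrightarrow> nest_projection m k * nest_projection m l = nest_projection m k"
  by (rule eq_matI)
    (auto simp: nest_projection_mult_left[OF nest_projection_carrier] simp del: index_mult_mat(1),
     auto simp: nest_projection_def)

lemma nest_projection_0: "nest_projection m 0 = 0\<^sub>m m m"
  by (rule eq_matI) (auto simp: nest_projection_def)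

lemma nest_projection_full: "nest_projection m m = 1\<^sub>m m"
  by (rule eq_matI) (auto simp: nest_projection_def)

lemma nest_projection_Suc: "nest_projection m (Suc k) = nest_projection m k + matrix_unit m k k"
  by (rule eq_matI) (auto simp: nest_projection_def)

text \<open>
  The coordinate-free form of block triangularity; it survives a *-homomorphism.
\<close>

lemma nest_algebra_invariance:
  fixes ns :: "nat list" and x :: "complex mat"
  defines "m \<equiv> sum_list ns" and "P \<equiv> \<lambda>l. nest_projection (sum_list ns) (sum_list (take l ns))"
  assumes x: "x \<in> carrier_mat m m"
  shows "x \<in> nest_algebra ns \<longleftrightarrow> (\<forall>l\<le>length ns. P l * (x * P l) = x * P l)"
proof -
  have le: "sum_list (take l ns) \<le> m" if "l \<le> length ns" for l
    using sum_list_take_mono[OF that, of ns] by (simp add: m_def)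
  have "P l * (x * P l) = x * P l \<longleftrightarrow>
      (\<forall>i<m. \<forall>j<sum_list (take l ns). sum_list (take l ns) \<le> i \<longrightarrow> x $$ (i,j) = 0)" (is "?L \<longleftrightarrow> ?R")
    if l: "l \<le> length ns" for l
  proof -
    have Pc: "P l \<in> carrier_mat m m" and xP: "x * P l \<in> carrier_mat m m"
      using x by (auto simp: P_def m_def)
    have idx: "(P l * (x * P l)) $$ (i,j) = (if i < sum_list (take l ns) then (x * P l) $$ (i,j) else 0)"
      "(x * P l) $$ (i,j) = (if j < sum_list (take l ns) then x $$ (i,j) else 0)"
      if "i < m" "j < m" for i j
      using nest_projection_mult_left[OF xP that] nest_projection_mult_right[OF x that]
      by (auto simp: P_def m_def)
    show ?thesis
    proof
      assume eq: ?L
      show ?R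
      proof (intro allI impI)
        fix i j assume h: "i < m" "j < sum_list (take l ns)" "sum_list (take l ns) \<le> i"
        then have j: "j < m" using le[OF l] by simp
        show "x $$ (i,j) = 0"
          using arg_cong[OF eq, of "\<lambda>y. y $$ (i,j)"] idx[OF h(1) j] h by simp
      qed
    next
      assume R: ?R
      show ?L
        by (rule eq_matI)
          (use R idx x in \<open>auto simp: P_def m_def not_less simp del: index_mult_mat(1)\<close>)
    qed
  qed
  then show ?thesis unfolding nest_algebra_iff using x by (auto simp: m_def)
qed

section \<open>Star extendible embeddings of nest algebras\<close>

lemma cstar_subalgebra_carrier: "cstar_subalgebra n (carrier_mat n n)"
  by (simp add: cstar_subalgebra_def)

lemma cstar_generated_carrier: "cstar_generated n (carrier_mat n n) = carrier_mat n n"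
  unfolding cstar_generated_def using cstar_subalgebra_carrier by blast

text \<open>
  Of each pair of transposed matrix units at least one is block upper triangular, and the other one
  is its adjoint.
\<close>

lemma cstar_generated_nest_algebra:
  "cstar_generated (sum_list ns) (nest_algebra ns) = carrier_mat (sum_list ns) (sum_list ns)"
  (is "cstar_generated ?m ?A = _")
proof
  show "cstar_generated ?m ?A \<subseteq> carrier_mat ?m ?m"
    unfolding cstar_generated_def using cstar_subalgebra_carrier nest_algebra_carrier by blast
  show "carrier_mat ?m ?m \<subseteq> cstar_generated ?m ?A"
    unfolding cstar_generated_def
  proof (intro subsetI InterI)
    fix x :: "complex mat" and \<C> assume x: "x \<in> carrier_mat ?m ?m" and "\<C> \<in> {\<C>. cstar_subalgebra ?m \<C> \<and> ?A \<subseteq> \<C>}"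
    then have C: "cstar_subalgebra ?m \<C>" "?A \<subseteq> \<C>" by auto
    have unit: "matrix_unit ?m i j \<in> \<C>" for i j
    proof (cases "level ns i \<le> level ns j")
      case True
      then show ?thesis using matrix_unit_in_nest_algebra C by blast
    next
      case False
      then have "matrix_unit ?m j i \<in> \<C>" using matrix_unit_in_nest_algebra[of ns j i] C by auto
      then have "mat_adjoint (matrix_unit ?m j i) \<in> \<C>" using C(1) by (simp add: cstar_subalgebra_def)
      then show ?thesis by (simp add: adjoint_matrix_unit)
    qed
    show "x \<in> \<C>"
      by (rule matrix_units_span[OF x]) (use C(1) unit in \<open>auto simp: cstar_subalgebra_def\<close>)
  qed
qed

locale star_embedding =
  fixes m n :: nat and g :: "complex mat \<Rightarrow> complex mat"
  assumes carrier: "\<And>x. x \<in> carrier_mat m m \<Longrightarrow> g x \<in> carrier_mat n n"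
    and add: "\<And>x y. x \<in> carrier_mat m m \<Longrightarrow> y \<in> carrier_mat m m \<Longrightarrow> g (x + y) = g x + g y"
    and smult: "\<And>c x. x \<in> carrier_mat m m \<Longrightarrow> g (c \<cdot>\<^sub>m x) = c \<cdot>\<^sub>m g x"
    and mult: "\<And>x y. x \<in> carrier_mat m m \<Longrightarrow> y \<in> carrier_mat m m \<Longrightarrow> g (x * y) = g x * g y"
    and adjoint: "\<And>x. x \<in> carrier_mat m m \<Longrightarrow> g (mat_adjoint x) = mat_adjoint (g x)"
    and inj: "inj_on g (carrier_mat m m)"

text \<open>
  Since a nest algebra generates the full matrix algebra, its star extendible embeddings are the
  restrictions of injective *-homomorphisms of that algebra.
\<close>

lemma star_extendible_embedding_iff:
  "star_extendible_embedding (sum_list ns) (nest_algebra ns) n (carrier_mat n n) \<phi> \<longleftrightarrow>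
    (\<exists>g. star_embedding (sum_list ns) n g \<and> (\<forall>x\<in>nest_algebra ns. \<phi> x = g x))" (is "?L \<longleftrightarrow> ?R")
proof
  assume ?L
  then obtain g where g: "star_hom (carrier_mat (sum_list ns) (sum_list ns)) (carrier_mat n n) g"
    "inj_on g (carrier_mat (sum_list ns) (sum_list ns))" "\<forall>x\<in>nest_algebra ns. \<phi> x = g x"
    unfolding star_extendible_embedding_def cstar_generated_nest_algebra cstar_generated_carrier by blast
  then have "star_embedding (sum_list ns) n g"
    by unfold_locales (auto simp: star_hom_def algebra_hom_def image_subset_iff)
  then show ?R using g(3) by blast
next
  assume ?R
  then obtain g where g: "star_embedding (sum_list ns) n g" and eq: "\<And>x. x \<in> nest_algebra ns \<Longrightarrow> \<phi> x = g x"
    by blast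
  interpret star_embedding "sum_list ns" n g by (rule g)
  have "star_hom (carrier_mat (sum_list ns) (sum_list ns)) (carrier_mat n n) g"
    unfolding star_hom_def algebra_hom_def using carrier add smult mult adjoint by (simp add: image_subset_iff)
  moreover have "algebra_hom (nest_algebra ns) (carrier_mat n n) \<phi>"
    unfolding algebra_hom_def using carrier add smult mult nest_algebra_carrier
    by (auto simp: image_subset_iff eq nest_algebra_add nest_algebra_smult nest_algebra_mult)
  ultimately show ?L
    unfolding star_extendible_embedding_def cstar_generated_nest_algebra cstar_generated_carrier
    using inj eq by blast
qed

context star_embedding
begin

lemma zero: "g (0\<^sub>m m m) = 0\<^sub>m n n"
proof -
  have "g (0\<^sub>m m m) = g (0 \<cdot>\<^sub>m 0\<^sub>m m m)" by simp
  also have "\<dots> = 0 \<cdot>\<^sub>m g (0\<^sub>m m m)" by (rule smult) simp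
  also have "\<dots> = 0\<^sub>m n n" using carrier[of "0\<^sub>m m m"] by (intro eq_matI) auto
  finally show ?thesis .
qed

definition lift :: "complex mat \<Rightarrow> matfam" where
  "lift x = embed n (g x)"

lemma lift_add: "x \<in> carrier_mat m m \<Longrightarrow> y \<in> carrier_mat m m \<Longrightarrow> lift (x + y) = lift x + lift y"
  by (simp add: lift_def add embed_add carrier)

lemma lift_mult: "x \<in> carrier_mat m m \<Longrightarrow> y \<in> carrier_mat m m \<Longrightarrow> lift (x * y) = lift x * lift y"
  by (simp add: lift_def mult embed_mult carrier)

lemma lift_adj: "x \<in> carrier_mat m m \<Longrightarrow> lift (mat_adjoint x) = adj (lift x)"
  by (simp add: lift_def adjoint embed_adj carrier)

lemma lift_scaleR: "x \<in> carrier_mat m m \<Longrightarrow> lift (complex_of_real c \<cdot>\<^sub>m x) = c *\<^sub>R lift x"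
  by (simp add: lift_def smult embed_scaleR carrier)

lemma lift_zero: "lift (0\<^sub>m m m) = 0"
  by (simp add: lift_def zero embed_zero)

lemma lift_inject:
  "x \<in> carrier_mat m m \<Longrightarrow> y \<in> carrier_mat m m \<Longrightarrow> lift x = lift y \<longleftrightarrow> x = y"
  using inj by (simp add: lift_def embed_inject carrier inj_on_eq_iff)

text \<open>
  Actually \<open>g\<close> is isometric.  The crude constant comes from adding up the entries and is sufficient
  because \<open>m\<close> is fixed before \<open>\<delta>\<close> is chosen.
\<close>

lemma op_norm_image_le:
  assumes x: "x \<in> carrier_mat m m"
  shows "op_norm (g x) \<le> real (m * m) * op_norm x"
proof -
  have unit: "op_norm (g (matrix_unit m i j)) \<le> 1" if "i < m" "j < m" for i j
  proof -
    have "projection (adj (lift (matrix_unit m i j)) * lift (matrix_unit m i j))"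
      unfolding projection_def using that
      by (simp add: lift_adj[symmetric] lift_mult[symmetric] adjoint_matrix_unit matrix_unit_mult)
    then have "norm (lift (matrix_unit m i j)) \<le> 1" by (rule partial_isometry_norm_le)
    then show ?thesis by (simp add: lift_def norm_embed carrier)
  qed
  have "op_norm (g (mask m T x)) \<le> real (card T) * op_norm x" if "T \<subseteq> {..<m} \<times> {..<m}" for T
    using finite_subset[OF that finite_SigmaI[OF finite_lessThan finite_lessThan]] that
  proof (induction T rule: finite_induct)
    case (insert ij T)
    obtain i j where ij: "ij = (i,j)" by (cases ij)
    then have lt: "i < m" "j < m" using insert by auto
    have "g (mask m (insert ij T) x) = g (mask m T x) + x $$ (i,j) \<cdot>\<^sub>m g (matrix_unit m i j)"
      using insert ij by (simp add: mask_insert add smult)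
    also have "op_norm \<dots> \<le> op_norm (g (mask m T x)) + op_norm (x $$ (i,j) \<cdot>\<^sub>m g (matrix_unit m i j))"
      by (rule op_norm_triangle[of _ n n]) (simp_all add: carrier)
    also have "op_norm (x $$ (i,j) \<cdot>\<^sub>m g (matrix_unit m i j)) \<le> op_norm x * 1"
      unfolding op_norm_smult by (intro mult_mono entry_le_op_norm[OF x] unit lt) auto
    also have "op_norm (g (mask m T x)) \<le> real (card T) * op_norm x" using insert by auto
    finally show ?case using insert by (simp add: algebra_simps)
  qed (simp add: mask_empty zero)
  from this[of "{..<m} \<times> {..<m}"] show ?thesis by (simp add: mask_full[OF x])
qed

lemma sum_lift_units: "k \<le> m \<Longrightarrow> (\<Sum>i<k. lift (matrix_unit m i i)) = lift (nest_projection m k)"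
  by (induction k) (auto simp: nest_projection_0 lift_zero nest_projection_Suc lift_add)

end

section \<open>Stability\<close>

text \<open>
  Write \<open>X - U X U* = (e - U) X + U X (e - U*)\<close>.
\<close>

lemma conjugation_estimate:
  fixes U X e :: "'a::cstar_normed_algebra"
  assumes e: "projection e" and U: "adj U * U = e" and X: "e * X = X" "X * e = X"
  shows "norm (X - U * X * adj U) \<le> 2 * norm (U - e) * norm X"
proof -
  have nU: "norm U \<le> 1" using e U by (intro partial_isometry_norm_le) simp
  have "adj (U - e) = adj U - e" using e by (simp add: adj_diff projection_def)
  then have na: "norm (adj U - e) = norm (U - e)" using norm_adj[of "U - e"] by simp
  have "X - U * X * adj U = (e - U) * X + U * (X * (e - adj U))"
    using X by (simp add: left_diff_distrib right_diff_distrib mult.assoc)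
  then have "norm (X - U * X * adj U) \<le> norm ((e - U) * X) + norm (U * (X * (e - adj U)))"
    by (simp only: norm_triangle_ineq)
  also have "norm ((e - U) * X) \<le> norm (U - e) * norm X"
    using norm_mult_ineq[of "e - U" X] by (simp add: norm_minus_commute)
  also have "norm (U * (X * (e - adj U))) \<le> 1 * (norm X * norm (U - e))"
    using norm_mult_ineq[of U "X * (e - adj U)"] norm_mult_ineq[of X "e - adj U"] nU na
    by (intro order_trans[OF norm_mult_ineq] mult_mono) (auto simp: norm_minus_commute)
  finally show ?thesis by (simp add: algebra_simps)
qed

lemma star_embedding_conjugate:
  assumes g: "star_embedding m n g" and v: "v \<in> carrier_mat n n"
    and vv: "mat_adjoint v * v = g (1\<^sub>m m)"
  shows "star_embedding m n (\<lambda>x. v * g x * mat_adjoint v)"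
proof -
  interpret star_embedding m n g by (rule g)
  note va = mat_adjoint_carrier[OF v]
  have e: "g (1\<^sub>m m) * g x = g x" "g x * g (1\<^sub>m m) = g x" if "x \<in> carrier_mat m m" for x
    using that by (simp_all add: mult[symmetric])
  have inv: "mat_adjoint v * (v * g x * mat_adjoint v) * v = g x" if x: "x \<in> carrier_mat m m" for x
  proof -
    have "mat_adjoint v * (v * g x * mat_adjoint v) * v = (mat_adjoint v * v) * g x * (mat_adjoint v * v)"
      using carrier[OF x] v va by (simp add: assoc_mult_mat[of _ n n _ n _ n] mult_carrier_mat[of _ n n _ n])
    then show ?thesis using x by (simp add: vv e)
  qed
  show ?thesis
  proof
    fix x y :: "complex mat" and c assume x: "x \<in> carrier_mat m m"
    note gx = carrier[OF x]
    have vx: "v * g x \<in> carrier_mat n n" using gx v by auto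
    show "v * g x * mat_adjoint v \<in> carrier_mat n n" using vx va by auto
    show "v * g (c \<cdot>\<^sub>m x) * mat_adjoint v = c \<cdot>\<^sub>m (v * g x * mat_adjoint v)"
      using x by (simp add: smult mult_smult_distrib[OF v gx] mult_smult_assoc_mat[OF vx va])
    show "v * g (mat_adjoint x) * mat_adjoint v = mat_adjoint (v * g x * mat_adjoint v)"
      unfolding mat_adjoint_mult[OF vx va] mat_adjoint_mult[OF v gx] adjoint[OF x] mat_adjoint_adjoint
      by (rule assoc_mult_mat[OF v mat_adjoint_carrier[OF gx] va])
    assume y: "y \<in> carrier_mat m m"
    note gy = carrier[OF y]
    have vy: "v * g y \<in> carrier_mat n n" using gy v by auto
    show "v * g (x + y) * mat_adjoint v = v * g x * mat_adjoint v + v * g y * mat_adjoint v"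
      using x y by (simp add: add mult_add_distrib_mat[OF v gx gy] add_mult_distrib_mat[OF vx vy va])
    have "v * g x * mat_adjoint v * (v * g y * mat_adjoint v) = v * (g x * ((mat_adjoint v * v) * g y)) * mat_adjoint v"
      using v va gx gy by (simp add: assoc_mult_mat[of _ n n _ n _ n] mult_carrier_mat[of _ n n _ n])
    also have "\<dots> = v * g (x * y) * mat_adjoint v" using x y by (simp add: vv e mult)
    finally show "v * g (x * y) * mat_adjoint v = v * g x * mat_adjoint v * (v * g y * mat_adjoint v)" ..
  next
    show "inj_on (\<lambda>x. v * g x * mat_adjoint v) (carrier_mat m m)"
    proof (rule inj_onI)
      fix x y assume xy: "x \<in> carrier_mat m m" "y \<in> carrier_mat m m"
        "v * g x * mat_adjoint v = v * g y * mat_adjoint v"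
      have "g x = mat_adjoint v * (v * g x * mat_adjoint v) * v" by (rule inv[OF xy(1), symmetric])
      also have "\<dots> = g y" unfolding xy(3) by (rule inv[OF xy(2)])
      finally show "x = y" using inj xy by (auto dest: inj_onD)
    qed
  qed
qed

text \<open>
  If no \<open>\<delta>\<close> worked, there would be a counterexample for each \<open>\<delta> = 1/(k+1)\<close>.  These form an instance of
  \<open>matrix_units_near_nest\<close> along the sequence of the \<open>k\<close>, and the partial isometries obtained from it
  refute the counterexamples with large \<open>k\<close>.
\<close>

lemma embedding_perturbation:
  fixes ns :: "nat list"
  defines "m \<equiv> sum_list ns"
  assumes m: "0 < m" and \<epsilon>: "0 < \<epsilon>"
  shows "\<exists>\<delta>>0. \<forall>ns2 n g1 g2. length ns2 = r \<longrightarrow> star_embedding m n g1 \<longrightarrow>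
    star_embedding (sum_list ns2) n g2 \<longrightarrow>
    near_subset \<delta> (g1 ` nest_algebra ns) (g2 ` nest_algebra ns2) \<longrightarrow>
    (\<exists>g. star_embedding m n g \<and>
      (\<forall>x\<in>carrier_mat m m. op_norm x \<le> 1 \<longrightarrow> op_norm (g1 x - g x) \<le> \<epsilon>) \<and>
      g ` nest_algebra ns \<subseteq> g2 ` nest_algebra ns2)"
proof (rule ccontr)
  assume neg: "\<not> ?thesis"
  define perturbs where "perturbs \<delta> ns2 n g1 g2 \<longleftrightarrow> (length ns2 = r \<longrightarrow> star_embedding m n g1 \<longrightarrow>
    star_embedding (sum_list ns2) n g2 \<longrightarrow>
    near_subset \<delta> (g1 ` nest_algebra ns) (g2 ` nest_algebra ns2) \<longrightarrow>
    (\<exists>g. star_embedding m n g \<and>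
      (\<forall>x\<in>carrier_mat m m. op_norm x \<le> 1 \<longrightarrow> op_norm (g1 x - g x) \<le> \<epsilon>) \<and>
      g ` nest_algebra ns \<subseteq> g2 ` nest_algebra ns2))" for \<delta> ns2 n g1 g2
  have "\<not> (\<exists>\<delta>>0. \<forall>ns2 n g1 g2. perturbs \<delta> ns2 n g1 g2)"
    using neg unfolding perturbs_def .
  then have "\<forall>k. \<exists>ns2 n g1 g2. \<not> perturbs (inverse (real (Suc k))) ns2 n g1 g2"
    using inverse_positive_iff_positive[of "real (Suc _)"] by (meson of_nat_0_less_iff zero_less_Suc)
  then obtain ns2 n g1 g2 where bad: "\<And>k. \<not> perturbs (inverse (real (Suc k))) (ns2 k) (n k) (g1 k) (g2 k)"
    by metis
  have "length (ns2 k) = r \<and> star_embedding m (n k) (g1 k) \<and>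
    star_embedding (sum_list (ns2 k)) (n k) (g2 k) \<and>
    near_subset (inverse (real (Suc k))) (g1 k ` nest_algebra ns) (g2 k ` nest_algebra (ns2 k)) \<and>
    \<not> (\<exists>g. star_embedding m (n k) g \<and>
      (\<forall>x\<in>carrier_mat m m. op_norm x \<le> 1 \<longrightarrow> op_norm (g1 k x - g x) \<le> \<epsilon>) \<and>
      g ` nest_algebra ns \<subseteq> g2 k ` nest_algebra (ns2 k))" for k
    using bad[of k] unfolding perturbs_def not_imp .
  note len = this[THEN conjunct1] and g1 = this[THEN conjunct2, THEN conjunct1]
    and g2 = this[THEN conjunct2, THEN conjunct2, THEN conjunct1]
    and ns_near = this[THEN conjunct2, THEN conjunct2, THEN conjunct2, THEN conjunct1]
    and no_embedding = this[THEN conjunct2, THEN conjunct2, THEN conjunct2, THEN conjunct2]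
  define m2 where "m2 k = sum_list (ns2 k)" for k
  define L1 where "L1 k = star_embedding.lift (n k) (g1 k)" for k
  define L2 where "L2 k = star_embedding.lift (n k) (g2 k)" for k
  have L1: "L1 k x = embed (n k) (g1 k x)" for k x by (simp add: L1_def star_embedding.lift_def[OF g1])
  have L2: "L2 k x = embed (n k) (g2 k x)" for k x by (simp add: L2_def star_embedding.lift_def[OF g2])
  note L1s = star_embedding.lift_add[OF g1, folded L1_def] star_embedding.lift_mult[OF g1, folded L1_def]
    star_embedding.lift_adj[OF g1, folded L1_def] star_embedding.lift_zero[OF g1, folded L1_def]
  note L2s = star_embedding.lift_add[OF g2, folded L2_def m2_def] star_embedding.lift_mult[OF g2, folded L2_def m2_def]
    star_embedding.lift_adj[OF g2, folded L2_def m2_def] star_embedding.lift_zero[OF g2, folded L2_def m2_def]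
    star_embedding.lift_scaleR[OF g2, folded L2_def m2_def]
  define P where "P l k = nest_projection (m2 k) (sum_list (take l (ns2 k)))" for l k
  have Pc: "P l k \<in> carrier_mat (m2 k) (m2 k)" for l k by (simp add: P_def)
  define C where "C k = L2 k ` carrier_mat (m2 k) (m2 k)" for k
  define E where "E l k = L2 k (P l k)" for l k
  define f where "f i j k = L1 k (matrix_unit m i j)" for i j k
  define b where "b = level ns"
  have C_sub: "C k \<subseteq> matrices (n k)" for k
    unfolding C_def L2 using star_embedding.carrier[OF g2] by (auto simp: m2_def)
  interpret nest: asymptotic_nest sequentially "\<lambda>k. matrices (n k)" C E r
  proof
    fix c
    show "real_subalgebra (matrices (n c))"
      unfolding real_subalgebra_def
      by (auto simp: embed_add[symmetric] embed_mult[symmetric] embed_scaleR[symmetric])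
    show "adj x \<in> matrices (n c)" if "x \<in> matrices (n c)" for x
      using that by (auto simp: embed_adj[symmetric])
    show "diagonalizable h" if "h \<in> matrices (n c)" "adj h = h" for h
      using matrices_diagonalizable that by blast
    show "C c \<subseteq> matrices (n c)" by (rule C_sub)
    show "real_subalgebra (C c)"
      unfolding real_subalgebra_def C_def
      by (auto simp: L2s(1,2,5)[symmetric])
    show "adj x \<in> C c" if "x \<in> C c" for x
      using that by (auto simp: C_def L2s(3)[symmetric])
    show "E l c \<in> C c" for l by (simp add: E_def C_def Pc)
    show "adj (E l c) = E l c" for l
      using L2s(3)[OF Pc[of l c]] by (simp add: E_def P_def adjoint_nest_projection)
    show "E k c * E l c = E k c" if "k \<le> l" for k l
      using L2s(2)[OF Pc[of k c] Pc[of l c]] nest_projection_mult[OF sum_list_take_mono[OF that], of "m2 c" "ns2 c"]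
      by (simp add: E_def P_def)
    show "E 0 c = 0" by (simp add: E_def P_def nest_projection_0 L2s)
    show "x * E r c = x" if x: "x \<in> C c" for x
    proof -
      have "P r c = 1\<^sub>m (m2 c)" using take_all[of "ns2 c" r] len[of c] by (simp add: P_def m2_def nest_projection_full)
      then show ?thesis using x L2s(2)[OF _ Pc[of r c]] by (auto simp: C_def E_def)
    qed
  qed
  have B_iff: "L2 k a \<in> nest.B k \<longleftrightarrow> a \<in> nest_algebra (ns2 k)" if a: "a \<in> carrier_mat (m2 k) (m2 k)" for a k
  proof -
    have "E l k * (L2 k a * E l k) = L2 k a * E l k \<longleftrightarrow> P l k * (a * P l k) = a * P l k" for l
    proof -
      have aP: "a * P l k \<in> carrier_mat (m2 k) (m2 k)" by (rule mult_carrier_mat[OF a Pc])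
      have PaP: "P l k * (a * P l k) \<in> carrier_mat (m2 k) (m2 k)" by (rule mult_carrier_mat[OF Pc aP])
      have "E l k * (L2 k a * E l k) = L2 k (P l k * (a * P l k))" "L2 k a * E l k = L2 k (a * P l k)"
        using a aP Pc by (simp_all add: E_def L2s(2))
      then show ?thesis
        using star_embedding.lift_inject[OF g2, folded L2_def m2_def, OF PaP aP] by simp
    qed
    then show ?thesis
      using nest_algebra_invariance[of a "ns2 k"] a by (auto simp: nest.B_def C_def P_def m2_def len)
  qed
  have near: "\<exists>Y. (\<forall>k. Y k \<in> nest.B k) \<and> nest.asymp_eq Y (f i j)"
    if ij: "i < m" "j < m" "b i \<le> b j" for i j
  proof -
    have "\<exists>y. y \<in> nest.B k \<and> norm (y - f i j k) \<le> inverse (real (Suc k))" for k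
    proof -
      have A: "matrix_unit m i j \<in> nest_algebra ns"
        using matrix_unit_in_nest_algebra ij(3) by (simp add: b_def m_def)
      have c: "g1 k (matrix_unit m i j) \<in> carrier_mat (n k) (n k)" by (rule star_embedding.carrier[OF g1]) simp
      have "projection (adj (f i j k) * f i j k)"
        using ij by (simp add: f_def L1s[symmetric] adjoint_matrix_unit matrix_unit_mult projection_def)
      then have "norm (f i j k) \<le> 1" by (rule partial_isometry_norm_le)
      then have "op_norm (g1 k (matrix_unit m i j)) \<le> 1" by (simp add: f_def L1 norm_embed[OF c])
      from ns_near[of k, unfolded near_subset_def, rule_format, OF imageI[OF A] this]
      obtain y where y: "y \<in> g2 k ` nest_algebra (ns2 k)"
        "op_norm (g1 k (matrix_unit m i j) - y) \<le> inverse (real (Suc k))"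
        by (elim bexE conjE)
      from y(1) obtain a where a: "y = g2 k a" "a \<in> nest_algebra (ns2 k)" by (rule imageE)
      have ac: "a \<in> carrier_mat (m2 k) (m2 k)" using nest_algebra_carrier[OF a(2)] by (simp add: m2_def)
      have gc: "g2 k a \<in> carrier_mat (n k) (n k)" using star_embedding.carrier[OF g2] ac by (simp add: m2_def)
      have "norm (f i j k - L2 k a) = op_norm (g1 k (matrix_unit m i j) - g2 k a)"
        using c gc by (simp add: f_def L1 L2 embed_diff[symmetric] norm_embed minus_carrier_mat)
      moreover have "L2 k a \<in> nest.B k" unfolding B_iff[OF ac] by (rule a(2))
      ultimately show ?thesis
        using y(2) by (intro exI[of _ "L2 k a"]) (simp add: a(1) norm_minus_commute)
    qed
    then obtain Y where Y: "\<And>k. Y k \<in> nest.B k" "\<And>k. norm (Y k - f i j k) \<le> inverse (real (Suc k))" by metis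
    have "Zfun (\<lambda>k. inverse (real (Suc k))) sequentially"
      using LIMSEQ_inverse_real_of_nat by (simp add: tendsto_Zfun_iff)
    then have "nest.asymp_eq Y (f i j)"
      unfolding nest.asymp_eq_def by (rule Zfun_imp_Zfun[where K = 1]) (use Y(2) in auto)
    then show ?thesis using Y(1) by blast
  qed
  interpret matrix_units_near_nest sequentially "\<lambda>k. matrices (n k)" C E r f m b
  proof
    show "0 < m" by (rule m)
    show "f i j c \<in> matrices (n c)" for i j c
      using star_embedding.carrier[OF g1] by (simp add: f_def L1)
    show "adj (f i j c) = f j i c" for i j c
      by (simp add: f_def L1s[symmetric] adjoint_matrix_unit)
    show "f i j c * f k l c = (if j = k then f i l c else 0)"
      if "i < m" "j < m" "k < m" "l < m" for i j k l c
      using that by (simp add: f_def L1s(2)[symmetric] matrix_unit_mult L1s(4))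
    show "b i \<le> b j" if "i \<le> j" for i j using that by (simp add: b_def level_mono)
    show "\<exists>Y. (\<forall>c. Y c \<in> nest.B c) \<and> nest.asymp_eq Y (f i j)" if "i < m" "j < m" "b i \<le> b j" for i j
      using near that .
  qed
  obtain u where u: "\<And>c. u c \<in> matrices (n c)" "nest.asymp_eq u (\<lambda>c. \<Sum>i<m. f i i c)"
    "\<forall>\<^sub>F c in sequentially. adj (u c) * u c = (\<Sum>i<m. f i i c) \<and>
      (\<forall>i<m. \<forall>j<m. b i \<le> b j \<longrightarrow> u c * f i j c * adj (u c) \<in> nest.B c)"
    apply (rule conjugate_into_nest)
    subgoal premises p by (rule p(1)[OF p(2-)])
    done
  \<comment> \<open>The factor \<open>2 m\<^sup>2\<close> is what \<open>conjugation_estimate\<close> and \<open>op_norm_image_le\<close> lose together.\<close>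
  define \<epsilon>' where "\<epsilon>' = \<epsilon> / (2 * real (m * m))"
  have \<epsilon>': "0 < \<epsilon>'" using \<epsilon> m by (simp add: \<epsilon>'_def)
  have "\<forall>\<^sub>F c in sequentially. norm (u c - (\<Sum>i<m. f i i c)) < \<epsilon>'"
    by (rule nest.asymp_eventually_norm_less[OF u(2) \<epsilon>'])
  with u(3) have "\<forall>\<^sub>F c in sequentially. (adj (u c) * u c = (\<Sum>i<m. f i i c) \<and>
      (\<forall>i<m. \<forall>j<m. b i \<le> b j \<longrightarrow> u c * f i j c * adj (u c) \<in> nest.B c)) \<and>
      norm (u c - (\<Sum>i<m. f i i c)) < \<epsilon>'"
    by (rule eventually_conj)
  from eventually_happens'[OF sequentially_bot this] obtain k where
    k_all: "(adj (u k) * u k = (\<Sum>i<m. f i i k) \<and>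
      (\<forall>i<m. \<forall>j<m. b i \<le> b j \<longrightarrow> u k * f i j k * adj (u k) \<in> nest.B k)) \<and>
      norm (u k - (\<Sum>i<m. f i i k)) < \<epsilon>'" ..
  have k: "adj (u k) * u k = (\<Sum>i<m. f i i k)"
    "\<And>i j. i < m \<Longrightarrow> j < m \<Longrightarrow> b i \<le> b j \<Longrightarrow> u k * f i j k * adj (u k) \<in> nest.B k"
    "norm (u k - (\<Sum>i<m. f i i k)) < \<epsilon>'"
    using k_all by simp_all
  interpret g1: star_embedding m "n k" "g1 k" by (rule g1)
  have sum_f: "(\<Sum>i<m. f i i k) = L1 k (1\<^sub>m m)"
    using g1.sum_lift_units[of m] by (simp add: f_def L1_def nest_projection_full)
  obtain v where v: "v \<in> carrier_mat (n k) (n k)" "u k = embed (n k) v" using u(1)[of k] by auto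
  note va = mat_adjoint_carrier[OF v(1)]
  have one: "g1 k (1\<^sub>m m) \<in> carrier_mat (n k) (n k)" by (rule g1.carrier) simp
  have "embed (n k) (mat_adjoint v * v) = embed (n k) (g1 k (1\<^sub>m m))"
    using k(1) v va by (simp add: sum_f L1 embed_mult embed_adj)
  then have vv: "mat_adjoint v * v = g1 k (1\<^sub>m m)"
    using one v(1) va by (simp add: embed_inject)
  define g where "g x = v * g1 k x * mat_adjoint v" for x
  have g: "star_embedding m (n k) g"
    unfolding g_def by (rule star_embedding_conjugate[OF g1 v(1) vv])
  interpret g: star_embedding m "n k" g by (rule g)
  have embed_g: "embed (n k) (g x) = u k * L1 k x * adj (u k)" if "x \<in> carrier_mat m m" for x
    using g1.carrier[OF that] v va by (simp add: g_def L1 embed_mult embed_adj)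
  have "op_norm (g1 k x - g x) \<le> \<epsilon>" if x: "x \<in> carrier_mat m m" "op_norm x \<le> 1" for x
  proof -
    note c = g1.carrier[OF x(1)] g.carrier[OF x(1)]
    have "mat_adjoint (1\<^sub>m m) = (1\<^sub>m m :: complex mat)"
      using adjoint_nest_projection[of m m] by (simp add: nest_projection_full)
    then have "projection (L1 k (1\<^sub>m m))"
      by (simp add: projection_def L1s(2,3)[symmetric])
    moreover have "L1 k (1\<^sub>m m) * L1 k x = L1 k x" "L1 k x * L1 k (1\<^sub>m m) = L1 k x"
      using x by (simp_all add: L1s(2)[symmetric])
    ultimately have "norm (L1 k x - u k * L1 k x * adj (u k)) \<le> 2 * norm (u k - L1 k (1\<^sub>m m)) * norm (L1 k x)"
      using k(1) by (intro conjugation_estimate) (simp_all add: sum_f)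
    also have "\<dots> \<le> 2 * \<epsilon>' * (real (m * m) * op_norm x)"
      using k(3) g1.op_norm_image_le[OF x(1)] \<epsilon>' c
      by (intro mult_mono) (auto simp: sum_f L1 norm_embed)
    also have "\<dots> \<le> 2 * \<epsilon>' * (real (m * m) * 1)"
      using x(2) \<epsilon>' by (intro mult_left_mono) auto
    also have "\<dots> = \<epsilon>" using m by (simp add: \<epsilon>'_def)
    also have "norm (L1 k x - u k * L1 k x * adj (u k)) = op_norm (g1 k x - g x)"
      unfolding embed_g[OF x(1), symmetric]
      using c by (simp add: L1 embed_diff[symmetric] norm_embed minus_carrier_mat)
    finally show ?thesis .
  qed
  moreover have "g ` nest_algebra ns \<subseteq> g2 k ` nest_algebra (ns2 k)"
  proof (rule image_subsetI)
    fix x assume x: "x \<in> nest_algebra ns"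
    interpret g2: star_embedding "sum_list (ns2 k)" "n k" "g2 k" by (rule g2)
    have xc: "x \<in> carrier_mat m m" using nest_algebra_carrier[OF x] by (simp add: m_def)
    define S where "S = {y \<in> carrier_mat m m. g y \<in> g2 k ` nest_algebra (ns2 k)}"
    have unit: "g (matrix_unit m i j) \<in> g2 k ` nest_algebra (ns2 k)" if ij: "i < m" "j < m" "b i \<le> b j" for i j
    proof -
      have B: "embed (n k) (g (matrix_unit m i j)) \<in> nest.B k"
        using k(2)[OF ij] by (simp add: embed_g f_def)
      have "embed (n k) (g (matrix_unit m i j)) \<in> L2 k ` carrier_mat (m2 k) (m2 k)"
        using subsetD[OF nest.B_sub_C B] by (simp only: C_def)
      then obtain a where a: "embed (n k) (g (matrix_unit m i j)) = L2 k a" "a \<in> carrier_mat (m2 k) (m2 k)"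
        by (rule imageE)
      have "a \<in> nest_algebra (ns2 k)" using B unfolding a(1) B_iff[OF a(2)] .
      moreover have "g (matrix_unit m i j) = g2 k a"
        using a(1) embed_inject[OF g.carrier[OF matrix_unit_carrier] g2.carrier[OF a(2)[unfolded m2_def]]]
        unfolding L2 by (rule iffD1[rotated])
      ultimately show ?thesis by (intro image_eqI)
    qed
    have "x \<in> S"
    proof (rule matrix_units_span[OF xc])
      show "0\<^sub>m m m \<in> S"
        using imageI[OF nest_algebra_zero, of "g2 k" "ns2 k"] g.zero g2.zero by (simp add: S_def)
      show "y + z \<in> S" if yz: "y \<in> S" "z \<in> S" for y z
      proof -
        have c: "y \<in> carrier_mat m m" "z \<in> carrier_mat m m" using yz by (simp_all add: S_def)
        obtain a a' where a: "a \<in> nest_algebra (ns2 k)" "g y = g2 k a"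
          and a': "a' \<in> nest_algebra (ns2 k)" "g z = g2 k a'"
          using yz by (auto simp: S_def)
        have "g (y + z) = g2 k (a + a')"
          using a(2) a'(2) by (simp add: g.add[OF c] g2.add[OF nest_algebra_carrier[OF a(1)] nest_algebra_carrier[OF a'(1)]])
        then show ?thesis using c imageI[OF nest_algebra_add[OF a(1) a'(1)], of "g2 k"] by (simp add: S_def)
      qed
      show "x $$ (i,j) \<cdot>\<^sub>m matrix_unit m i j \<in> S" if "i < m" "j < m" "x $$ (i,j) \<noteq> 0" for i j
      proof -
        have "b i \<le> b j" using x that by (simp add: nest_algebra_level b_def m_def)
        from unit[OF that(1,2) this] obtain a where
          a: "a \<in> nest_algebra (ns2 k)" "g (matrix_unit m i j) = g2 k a" by blast
        have "g (x $$ (i,j) \<cdot>\<^sub>m matrix_unit m i j) = g2 k (x $$ (i,j) \<cdot>\<^sub>m a)"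
          using a(2) by (simp add: g.smult g2.smult[OF nest_algebra_carrier[OF a(1)]])
        then show ?thesis
          using imageI[OF nest_algebra_smult[OF a(1)], of "g2 k"] by (simp add: S_def)
      qed
    qed
    then show "g x \<in> g2 k ` nest_algebra (ns2 k)" by (simp add: S_def)
  qed
  ultimately have "\<exists>g. star_embedding m (n k) g \<and>
      (\<forall>x\<in>carrier_mat m m. op_norm x \<le> 1 \<longrightarrow> op_norm (g1 k x - g x) \<le> \<epsilon>) \<and>
      g ` nest_algebra ns \<subseteq> g2 k ` nest_algebra (ns2 k)"
    using g by (intro exI[of _ g]) simp
  then show False by (rule notE[OF no_embedding])
qed

theorem theorem2p1:
  fixes r :: nat
  assumes "r \<ge> 1"
  shows "stable_family (nest_family r)"
proof -
  have main: "\<exists>\<delta>>0. \<forall>ns2. length ns2 = r \<and> (\<forall>m\<in>set ns2. 0 < m) \<longrightarrow> (\<forall>n\<ge>1. \<forall>\<phi>1 \<phi>2.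
      star_extendible_embedding (sum_list ns) (nest_algebra ns) n (carrier_mat n n) \<phi>1 \<and>
      star_extendible_embedding (sum_list ns2) (nest_algebra ns2) n (carrier_mat n n) \<phi>2 \<and>
      near_subset \<delta> (\<phi>1 ` nest_algebra ns) (\<phi>2 ` nest_algebra ns2) \<longrightarrow>
      (\<exists>\<psi>. star_extendible_embedding (sum_list ns) (nest_algebra ns) n (carrier_mat n n) \<psi> \<and>
        map_norm (nest_algebra ns) (\<lambda>x. \<phi>1 x - \<psi> x) < \<epsilon> \<and> \<psi> ` nest_algebra ns \<subseteq> \<phi>2 ` nest_algebra ns2))"
    if \<epsilon>: "0 < \<epsilon>" and ns: "length ns = r" "\<forall>m\<in>set ns. 0 < m" for \<epsilon> and ns :: "nat list"
  proof -
    define m where "m = sum_list ns"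
    have "0 < m" using ns assms by (cases ns) (auto simp: m_def)
    from embedding_perturbation[of ns "\<epsilon> / 2" r, folded m_def, OF this half_gt_zero[OF \<epsilon>]]
    obtain \<delta> where \<delta>: "\<delta> > 0" and pert: "\<forall>ns2 n g1 g2. length ns2 = r \<longrightarrow> star_embedding m n g1 \<longrightarrow>
      star_embedding (sum_list ns2) n g2 \<longrightarrow>
      near_subset \<delta> (g1 ` nest_algebra ns) (g2 ` nest_algebra ns2) \<longrightarrow>
      (\<exists>g. star_embedding m n g \<and>
        (\<forall>x\<in>carrier_mat m m. op_norm x \<le> 1 \<longrightarrow> op_norm (g1 x - g x) \<le> \<epsilon> / 2) \<and>
        g ` nest_algebra ns \<subseteq> g2 ` nest_algebra ns2)"
      by (elim exE conjE)
    show ?thesis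
    proof (intro exI[of _ \<delta>] conjI allI impI \<delta>)
      fix ns2 n \<phi>1 \<phi>2
      assume ns2: "length ns2 = r \<and> (\<forall>m\<in>set ns2. 0 < m)"
        and A: "star_extendible_embedding (sum_list ns) (nest_algebra ns) n (carrier_mat n n) \<phi>1 \<and>
          star_extendible_embedding (sum_list ns2) (nest_algebra ns2) n (carrier_mat n n) \<phi>2 \<and>
          near_subset \<delta> (\<phi>1 ` nest_algebra ns) (\<phi>2 ` nest_algebra ns2)"
      obtain g1 where g1: "star_embedding m n g1" "\<And>x. x \<in> nest_algebra ns \<Longrightarrow> \<phi>1 x = g1 x"
        using iffD1[OF star_extendible_embedding_iff conjunct1[OF A]] unfolding m_def by blast
      obtain g2 where g2: "star_embedding (sum_list ns2) n g2" "\<And>x. x \<in> nest_algebra ns2 \<Longrightarrow> \<phi>2 x = g2 x"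
        using conjunct1[OF conjunct2[OF A]] unfolding star_extendible_embedding_iff by blast
      have im: "\<phi>1 ` nest_algebra ns = g1 ` nest_algebra ns" "\<phi>2 ` nest_algebra ns2 = g2 ` nest_algebra ns2"
        using g1(2) g2(2) by (auto intro!: image_cong)
      have "near_subset \<delta> (g1 ` nest_algebra ns) (g2 ` nest_algebra ns2)"
        using A unfolding im by (elim conjE)
      from pert[rule_format, OF conjunct1[OF ns2] g1(1) g2(1) this]
      obtain g where g: "star_embedding m n g"
        "\<forall>x\<in>carrier_mat m m. op_norm x \<le> 1 \<longrightarrow> op_norm (g1 x - g x) \<le> \<epsilon> / 2"
        "g ` nest_algebra ns \<subseteq> g2 ` nest_algebra ns2"
        by (elim exE conjE)
      have "map_norm (nest_algebra ns) (\<lambda>x. \<phi>1 x - g x) \<le> \<epsilon> / 2"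
        unfolding map_norm_def
      proof (rule cSup_least)
        show "{op_norm (\<phi>1 x - g x) | x. x \<in> nest_algebra ns \<and> op_norm x \<le> 1} \<noteq> {}"
          using nest_algebra_zero[of ns] op_norm_zero[of "sum_list ns" "sum_list ns"]
          by (auto intro!: exI[of _ "0\<^sub>m (sum_list ns) (sum_list ns)"])
        fix t assume "t \<in> {op_norm (\<phi>1 x - g x) | x. x \<in> nest_algebra ns \<and> op_norm x \<le> 1}"
        then obtain x where x: "t = op_norm (\<phi>1 x - g x)" "x \<in> nest_algebra ns" "op_norm x \<le> 1"
          by (elim CollectE exE conjE)
        show "t \<le> \<epsilon> / 2"
          unfolding x(1) g1(2)[OF x(2)]
          by (rule g(2)[rule_format, OF nest_algebra_carrier[OF x(2), folded m_def] x(3)])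
      qed
      then have "map_norm (nest_algebra ns) (\<lambda>x. \<phi>1 x - g x) < \<epsilon>" using \<epsilon> by simp
      moreover have "star_extendible_embedding (sum_list ns) (nest_algebra ns) n (carrier_mat n n) g"
        unfolding star_extendible_embedding_iff using g(1) unfolding m_def by blast
      ultimately show "\<exists>\<psi>. star_extendible_embedding (sum_list ns) (nest_algebra ns) n (carrier_mat n n) \<psi> \<and>
          map_norm (nest_algebra ns) (\<lambda>x. \<phi>1 x - \<psi> x) < \<epsilon> \<and> \<psi> ` nest_algebra ns \<subseteq> \<phi>2 ` nest_algebra ns2"
        using g(3) unfolding im by blast
    qed
  qed
  show ?thesis
    unfolding stable_family_def
  proof (intro allI impI ballI)
    fix \<epsilon> :: real and A1 assume \<epsilon>: "0 < \<epsilon>" and "A1 \<in> nest_family r"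
    then obtain ns where ns: "length ns = r" "\<forall>m\<in>set ns. 0 < m" and A1: "A1 = (sum_list ns, nest_algebra ns)"
      by (auto simp: nest_family_def)
    from main[OF \<epsilon> ns] obtain \<delta> where "\<delta> > 0" and \<delta>: "\<forall>ns2. length ns2 = r \<and> (\<forall>m\<in>set ns2. 0 < m) \<longrightarrow> (\<forall>n\<ge>1. \<forall>\<phi>1 \<phi>2.
      star_extendible_embedding (sum_list ns) (nest_algebra ns) n (carrier_mat n n) \<phi>1 \<and>
      star_extendible_embedding (sum_list ns2) (nest_algebra ns2) n (carrier_mat n n) \<phi>2 \<and>
      near_subset \<delta> (\<phi>1 ` nest_algebra ns) (\<phi>2 ` nest_algebra ns2) \<longrightarrow>
      (\<exists>\<psi>. star_extendible_embedding (sum_list ns) (nest_algebra ns) n (carrier_mat n n) \<psi> \<and>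
        map_norm (nest_algebra ns) (\<lambda>x. \<phi>1 x - \<psi> x) < \<epsilon> \<and> \<psi> ` nest_algebra ns \<subseteq> \<phi>2 ` nest_algebra ns2))"
      by (elim exE conjE)
    show "case A1 of (m1, \<A>1) \<Rightarrow> \<exists>\<delta>>0. \<forall>(m2, \<A>2)\<in>nest_family r. \<forall>n\<ge>1. \<forall>\<phi>1 \<phi>2.
          star_extendible_embedding m1 \<A>1 n (carrier_mat n n) \<phi>1 \<and>
          star_extendible_embedding m2 \<A>2 n (carrier_mat n n) \<phi>2 \<and>
          near_subset \<delta> (\<phi>1 ` \<A>1) (\<phi>2 ` \<A>2) \<longrightarrow>
          (\<exists>\<psi>. star_extendible_embedding m1 \<A>1 n (carrier_mat n n) \<psi> \<and>
               map_norm \<A>1 (\<lambda>x. \<phi>1 x - \<psi> x) < \<epsilon> \<and> \<psi> ` \<A>1 \<subseteq> \<phi>2 ` \<A>2)"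
      unfolding A1 prod.case
    proof (intro exI[of _ \<delta>] conjI ballI \<open>\<delta> > 0\<close>)
      fix A2 assume "A2 \<in> nest_family r"
      then obtain ns2 where ns2: "length ns2 = r" "\<forall>m\<in>set ns2. 0 < m"
        and A2: "A2 = (sum_list ns2, nest_algebra ns2)"
        by (auto simp: nest_family_def)
      show "case A2 of (m2, \<A>2) \<Rightarrow> \<forall>n\<ge>1. \<forall>\<phi>1 \<phi>2.
          star_extendible_embedding (sum_list ns) (nest_algebra ns) n (carrier_mat n n) \<phi>1 \<and>
          star_extendible_embedding m2 \<A>2 n (carrier_mat n n) \<phi>2 \<and>
          near_subset \<delta> (\<phi>1 ` nest_algebra ns) (\<phi>2 ` \<A>2) \<longrightarrow>
          (\<exists>\<psi>. star_extendible_embedding (sum_list ns) (nest_algebra ns) n (carrier_mat n n) \<psi> \<and>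
               map_norm (nest_algebra ns) (\<lambda>x. \<phi>1 x - \<psi> x) < \<epsilon> \<and> \<psi> ` nest_algebra ns \<subseteq> \<phi>2 ` \<A>2)"
        unfolding A2 prod.case by (rule mp[OF spec[OF \<delta>] conjI[OF ns2]])
    qed
  qed
qed

end
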